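(* Let $f$ be a convenient and nondegenerate polynomial on $\mathbb{C}^n$ with Newton polytope $P$. Then its Newton spectrum $P_{B^*}(z)$ satisfies $$P_{B^*}(z)=P_{\mathrm{gr}^{\mathcal{N}}(\mathcal{B}/\mathcal{L})}(z)+\sum_{p=1}^{n-1}(-1)^p\sum_{(i_1,\dots,i_p)\in I_p}P^{(i_1,\dots,i_p)}_{\mathrm{gr}^{\mathcal{N}}(\mathcal{B}/\mathcal{L})}(z)+(-1)^n,$$ where $P_{\mathrm{gr}^{\mathcal{N}}(\mathcal{B}/\mathcal{L})}(z)$ is the toric Newton spectrum of $f$, and $P^{(i_1,\dots,i_p)}_{\mathrm{gr}^{\mathcal{N}}(\mathcal{B}/\mathcal{L})}(z)$ is the toric Newton spectrum of the restriction of $f$ to $u_{i_1}=\dots=u_{i_p}=0$.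
   Context: Let $n\ge 1$, $\mathbb{N}=\{0,1,2,\dots\}$, $\mathcal{B}=\mathbb{C}[u_1,\dots,u_n]$, $u^m=u_1^{m_1}\cdots u_n^{m_n}$. For $g=\sum_{m\in\mathbb{N}^n}a_mu^m\in\mathcal{B}$, $\mathrm{supp}(g)=\{m: a_m\ne 0\}$, and the Newton polytope of $g$ is the convex hull of $\{0\}\cup\mathrm{supp}(g)$ in $\mathbb{R}^n_+$. The Newton boundary of a Newton polytope is the union of its closed faces that do not contain the origin. A polynomial $f$ is convenient if for each $i=1,\dots,n$ there is an integer $n_i\ge1$ such that $u_i^{n_i}$ appears in $f$ with nonzero coefficient. It is (Newton) nondegenerate if, for each closed face $\Delta$ of the Newton boundary of its Newton polytope, the system $(u_1\frac{\partial f}{\partial u_1})_\Delta=\dots=(u_n\frac{\partial f}{\partial u_n})_\Delta=0$ has no solution in $(\mathbb{C}^* )^n$, where $g_\Delta=\sum_{m\in\mathbb{N}^n\cap\Delta}b_mu^m$ for $g=\sum b_mu^m$. For a facet $F$ (face of dimension $n-1$) of the Newton boundary of $P$, let $u_F\in\mathbb{Q}^n$ be such that $F=P\cap\{x\in\mathbb{R}^n:\langle u_F,x\rangle=1\}$. The Newton function $\nu:\mathbb{N}^n\to\mathbb{Q}$ is $\nu(a)=\max_F\langle u_F,a\rangle$, the maximum being over the facets of the Newton boundary of $P$. The Newton filtration is $\mathcal{N}_\alpha\mathcal{B}=\{g\in\mathcal{B}:\nu(m)\le\alpha \text{ for all } m\in\mathrm{supp}(g)\}$, $\alpha\in\mathbb{Q}$.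 Let $\mathcal{L}$ be the ideal generated by $u_1\frac{\partial f}{\partial u_1},\dots,u_n\frac{\partial f}{\partial u_n}$. The Newton filtration induces by projection a filtration $\mathcal{N}_\bullet$ on $\mathcal{B}/\mathcal{L}$; the toric Newton spectrum of $f$ is $P_{\mathrm{gr}^{\mathcal{N}}(\mathcal{B}/\mathcal{L})}(z)=\sum_{\alpha\in\mathbb{Q}}\dim_{\mathbb{C}}\mathrm{gr}^{\mathcal{N}}_\alpha(\mathcal{B}/\mathcal{L})\,z^\alpha$. Let $\mathcal{I}$ be the ideal generated by $\frac{\partial f}{\partial u_1},\dots,\frac{\partial f}{\partial u_n}$. Define the increasing filtration $W_\alpha\mathcal{B}=\{g\in\mathcal{B}:\nu(m)\le\alpha\text{ for all }m\in\mathrm{supp}(g\,u_1\cdots u_n)\}$, $\alpha\in\mathbb{Q}$, and let $W_\bullet$ also denote the filtration induced by projection on $\mathcal{B}/\mathcal{I}$. Set $B^*_\alpha=\mathrm{gr}^W_\alpha(\mathcal{B}/\mathcal{I})$. The Newton spectrum of $f$ is $P_{B^*}(z)=\sum_{\alpha\in\mathbb{Q}}\dim_{\mathbb{C}}B^*_\alpha\,z^\alpha$. For $1\le p\le n$, $I_p=\{(i_1,\dots,i_p):1\le i_1<\dots<i_p\le n\}$. The restriction $f_{(i_1,\dots,i_p)}$ of $f$ at $u_{i_1}=\dots=u_{i_p}=0$ is viewed as a polynomial in the remaining $n-p$ variables, and is convenient and nondegenerate if $f$ is. For $1\le p\le n-1$, its toric Newton spectrum is defined as follows. Let $h=f_{(i_1,\dots,i_p)}$,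 let $J=\{1,\dots,n\}\setminus\{i_1,\dots,i_p\}$, let $\mathcal{B}'=\mathbb{C}[u_j: j\in J]$ be the polynomial ring in the remaining variables, and let $Q\subset\mathbb{R}^{J}_+$ be the Newton polytope of $h$. For a facet $G$ (face of dimension $n-p-1$) of the Newton boundary of $Q$, let $u_G\in\mathbb{Q}^{J}$ be such that $G=Q\cap\{x\in\mathbb{R}^{J}:\langle u_G,x\rangle=1\}$, and let $\nu'(a)=\max_G\langle u_G,a\rangle$ for $a\in\mathbb{N}^{J}$, the maximum being over the facets of the Newton boundary of $Q$. Let $\mathcal{N}_\alpha\mathcal{B}'=\{g\in\mathcal{B}':\nu'(m)\le\alpha\text{ for all }m\in\mathrm{supp}(g)\}$, $\alpha\in\mathbb{Q}$, let $\mathcal{L}'$ be the ideal of $\mathcal{B}'$ generated by the $u_j\frac{\partial h}{\partial u_j}$, $j\in J$, and let $\mathcal{N}_\bullet$ also denote the filtration induced by projection on $\mathcal{B}'/\mathcal{L}'$. Then the toric Newton spectrum of $f_{(i_1,\dots,i_p)}$ is $P^{(i_1,\dots,i_p)}_{\mathrm{gr}^{\mathcal{N}}(\mathcal{B}/\mathcal{L})}(z)=\sum_{\alpha\in\mathbb{Q}}\dim_{\mathbb{C}}\mathrm{gr}^{\mathcal{N}}_\alpha(\mathcal{B}'/\mathcal{L}')\,z^\alpha$. *)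

theory Defs
  imports "HOL-Analysis.Analysis" "HOL-Library.Poly_Mapping"
begin

text \<open>
  The index set of the variables is a finite type \<open>'n\<close>, so \<open>n = CARD('n)\<close>. For a set \<open>J\<close> of
  variables, the ring \<open>\<complex>[u\<^sub>j : j \<in> J]\<close> is the subring \<open>polys_in J\<close> of \<open>'n mpoly\<close>, and
  \<open>\<real>\<^sup>J\<close> is the coordinate subspace of \<open>real ^ 'n\<close> where the coordinates outside \<open>J\<close> vanish.
  Notions taking a parameter \<open>J\<close> refer to this ring and this space; \<open>J = UNIV\<close> is the case of
  all \<open>n\<close> variables.
\<close>

type_synonym 'n mpoly = "('n \<Rightarrow>\<^sub>0 nat) \<Rightarrow>\<^sub>0 complex"

definition polys_in :: "'n set \<Rightarrow> 'n mpoly set" where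
  "polys_in J = {g. \<forall>m\<in>Poly_Mapping.keys g. Poly_Mapping.keys m \<subseteq> J}"

definition cst :: "complex \<Rightarrow> 'n mpoly" where
  "cst c = Poly_Mapping.single 0 c"

definition var :: "'n \<Rightarrow> 'n mpoly" where
  "var i = Poly_Mapping.single (Poly_Mapping.single i 1) 1"

definition pdiff :: "'n \<Rightarrow> 'n mpoly \<Rightarrow> 'n mpoly" where
  "pdiff i g = (\<Sum>m\<in>Poly_Mapping.keys g. Poly_Mapping.single (m - Poly_Mapping.single i 1)
                              (of_nat (Poly_Mapping.lookup m i) * Poly_Mapping.lookup g m))"

definition eval_at :: "('n::finite \<Rightarrow> complex) \<Rightarrow> 'n mpoly \<Rightarrow> complex" where
  "eval_at z g = (\<Sum>m\<in>Poly_Mapping.keys g. Poly_Mapping.lookup g m * (\<Prod>i\<in>UNIV. z i ^ Poly_Mapping.lookup m i))"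

definition monomial_part :: "('n \<Rightarrow>\<^sub>0 nat) set \<Rightarrow> 'n mpoly \<Rightarrow> 'n mpoly" where
  "monomial_part A g = (\<Sum>m\<in>Poly_Mapping.keys g \<inter> A. Poly_Mapping.single m (Poly_Mapping.lookup g m))"

text \<open>Setting \<open>u\<^sub>i = 0\<close> for all \<open>i \<in> I\<close> kills exactly the monomials involving some \<open>u\<^sub>i\<close>, \<open>i \<in> I\<close>.\<close>

definition set_zero :: "'n set \<Rightarrow> 'n mpoly \<Rightarrow> 'n mpoly" where
  "set_zero I g = monomial_part {m. \<forall>i\<in>I. Poly_Mapping.lookup m i = 0} g"

definition point :: "('n::finite \<Rightarrow>\<^sub>0 nat) \<Rightarrow> real ^ 'n" where
  "point m = (\<chi> i. real (Poly_Mapping.lookup m i))"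

definition newton_polytope :: "'n::finite mpoly \<Rightarrow> (real ^ 'n) set" where
  "newton_polytope g = convex hull (insert 0 (point ` Poly_Mapping.keys g))"

definition newton_boundary :: "(real ^ 'n::finite) set \<Rightarrow> (real ^ 'n) set" where
  "newton_boundary P = \<Union>{F. F face_of P \<and> 0 \<notin> F}"

text \<open>The library counts the empty set as a face; it is excluded here.\<close>

definition boundary_faces :: "(real ^ 'n::finite) set \<Rightarrow> (real ^ 'n) set set" where
  "boundary_faces P = {F. F face_of P \<and> F \<noteq> {} \<and> F \<subseteq> newton_boundary P}"

definition face_part :: "(real ^ 'n::finite) set \<Rightarrow> 'n mpoly \<Rightarrow> 'n mpoly" where
  "face_part \<Delta> g = monomial_part {m. point m \<in> \<Delta>} g"

definition convenient :: "'n::finite mpoly \<Rightarrow> bool" where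
  "convenient f \<longleftrightarrow> (\<forall>i. \<exists>k\<ge>1. Poly_Mapping.lookup f (Poly_Mapping.single i k) \<noteq> 0)"

definition nondegenerate :: "'n::finite mpoly \<Rightarrow> bool" where
  "nondegenerate f \<longleftrightarrow>
     (\<forall>\<Delta>\<in>boundary_faces (newton_polytope f).
        \<not> (\<exists>z. (\<forall>i. z i \<noteq> 0) \<and> (\<forall>i. eval_at z (face_part \<Delta> (var i * pdiff i f)) = 0)))"

definition boundary_facets :: "'n::finite set \<Rightarrow> (real ^ 'n) set \<Rightarrow> (real ^ 'n) set set" where
  "boundary_facets J P = {F \<in> boundary_faces P. aff_dim F = int (card J) - 1}"

text \<open>The vector \<open>u\<^sub>F \<in> \<rat>\<^sup>J\<close>; it is unique when \<open>P \<subseteq> \<real>\<^sup>J\<close> and \<open>F\<close> is in \<open>boundary_facets J P\<close>.\<close>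

definition facet_vec :: "'n::finite set \<Rightarrow> (real ^ 'n) set \<Rightarrow> (real ^ 'n) set \<Rightarrow> 'n \<Rightarrow> rat" where
  "facet_vec J P F = (SOME u. (\<forall>i. i \<notin> J \<longrightarrow> u i = 0) \<and>
                              F = P \<inter> {x. (\<Sum>i\<in>J. of_rat (u i) * x $ i) = 1})"

definition newton_fun :: "'n::finite set \<Rightarrow> 'n mpoly \<Rightarrow> ('n \<Rightarrow>\<^sub>0 nat) \<Rightarrow> rat" where
  "newton_fun J f m =
     (let P = newton_polytope f
      in Max ((\<lambda>F. \<Sum>i\<in>J. facet_vec J P F i * of_nat (Poly_Mapping.lookup m i)) ` boundary_facets J P))"

definition newton_filt :: "'n::finite set \<Rightarrow> 'n mpoly \<Rightarrow> rat \<Rightarrow> 'n mpoly set" where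
  "newton_filt J f \<alpha> = {g \<in> polys_in J. \<forall>m\<in>Poly_Mapping.keys g. newton_fun J f m \<le> \<alpha>}"

definition W_filt :: "'n::finite mpoly \<Rightarrow> rat \<Rightarrow> 'n mpoly set" where
  "W_filt f \<alpha> = {g. \<forall>m\<in>Poly_Mapping.keys (g * (\<Prod>i\<in>UNIV. var i)). newton_fun UNIV f m \<le> \<alpha>}"

definition ideal_gen :: "'n set \<Rightarrow> ('n \<Rightarrow> 'n mpoly) \<Rightarrow> 'n mpoly set" where
  "ideal_gen J h = {\<Sum>j\<in>J. a j * h j | a. \<forall>j\<in>J. a j \<in> polys_in J}"

definition toric_ideal :: "'n set \<Rightarrow> 'n mpoly \<Rightarrow> 'n mpoly set" where
  "toric_ideal J f = ideal_gen J (\<lambda>j. var j * pdiff j f)"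

definition jacobian_ideal :: "'n mpoly \<Rightarrow> 'n mpoly set" where
  "jacobian_ideal f = ideal_gen UNIV (\<lambda>j. pdiff j f)"

definition residue_class :: "'n mpoly set \<Rightarrow> 'n mpoly \<Rightarrow> 'n mpoly set" where
  "residue_class K g = {g + k | k. k \<in> K}"

text \<open>The filtration induced by projection on the quotient by \<open>K\<close>, as a set of residue classes.\<close>

definition quot_filt :: "(rat \<Rightarrow> 'n mpoly set) \<Rightarrow> 'n mpoly set \<Rightarrow> rat \<Rightarrow> 'n mpoly set set" where
  "quot_filt F K \<alpha> = residue_class K ` F \<alpha>"

definition quot_filt_less :: "(rat \<Rightarrow> 'n mpoly set) \<Rightarrow> 'n mpoly set \<Rightarrow> rat \<Rightarrow> 'n mpoly set set" where
  "quot_filt_less F K \<alpha> = (\<Union>\<beta>\<in>{..<\<alpha>}. quot_filt F K \<beta>)"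

text \<open>
  \<open>S\<close> is a finite set of representatives in \<open>F \<alpha>\<close> whose classes form a \<open>\<complex>\<close>-basis of
  \<open>gr\<^sub>\<alpha> = quot_filt F K \<alpha> / quot_filt_less F K \<alpha>\<close>: a polynomial in \<open>F \<alpha>\<close> has zero class in
  \<open>gr\<^sub>\<alpha>\<close> iff its residue class modulo \<open>K\<close> lies in \<open>quot_filt_less F K \<alpha>\<close>. The last
  condition with coefficients \<open>1, -1\<close> forces distinct elements of \<open>S\<close> to have distinct classes.
\<close>

definition gr_basis ::
    "(rat \<Rightarrow> 'n mpoly set) \<Rightarrow> 'n mpoly set \<Rightarrow> rat \<Rightarrow> 'n mpoly set \<Rightarrow> bool" where
  "gr_basis F K \<alpha> S \<longleftrightarrow>
     finite S \<and> S \<subseteq> F \<alpha> \<and>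
     (\<forall>g\<in>F \<alpha>. \<exists>c. residue_class K (g - (\<Sum>s\<in>S. cst (c s) * s)) \<in> quot_filt_less F K \<alpha>) \<and>
     (\<forall>c. residue_class K (\<Sum>s\<in>S. cst (c s) * s) \<in> quot_filt_less F K \<alpha> \<longrightarrow> (\<forall>s\<in>S. c s = 0))"

definition gr_dim :: "(rat \<Rightarrow> 'n mpoly set) \<Rightarrow> 'n mpoly set \<Rightarrow> rat \<Rightarrow> nat" where
  "gr_dim F K \<alpha> = (if \<exists>S. gr_basis F K \<alpha> S then card (SOME S. gr_basis F K \<alpha> S) else 0)"

text \<open>
  A formal sum \<open>\<Sum>\<^sub>\<alpha> c\<^sub>\<alpha> z\<^sup>\<alpha>\<close> over \<open>\<alpha> \<in> \<rat>\<close> is represented by its coefficient function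
  \<open>\<alpha> \<mapsto> c\<^sub>\<alpha>\<close>.
\<close>

definition toric_newton_spectrum :: "'n::finite set \<Rightarrow> 'n mpoly \<Rightarrow> rat \<Rightarrow> int" where
  "toric_newton_spectrum J f \<alpha> = int (gr_dim (newton_filt J f) (toric_ideal J f) \<alpha>)"

definition newton_spectrum :: "'n::finite mpoly \<Rightarrow> rat \<Rightarrow> int" where
  "newton_spectrum f \<alpha> = int (gr_dim (W_filt f) (jacobian_ideal f) \<alpha>)"

end

theory Submission
  imports Defs "HOL-Computational_Algebra.Fundamental_Theorem_Algebra"
begin

text \<open>
  Let \<open>M\<^sub>S\<^sub>,\<^sub>J\<close> be the quotient of the multiples of \<open>\<Prod>i\<in>S. u\<^sub>i\<close> in \<open>\<complex>[u\<^sub>j : j \<in> J]\<close> by the elements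
  \<open>\<Sum>j\<in>J. a\<^sub>j u\<^sub>j \<partial>f/\<partial>u\<^sub>j\<close> with \<open>a\<^sub>j\<close> divisible by \<open>\<Prod>i\<in>S - {j}. u\<^sub>i\<close>. For \<open>S = {}\<close> this is the toric quotient of
  the restriction of \<open>f\<close>, and for \<open>S = J\<close> the full set of variables it is, after multiplication by
  \<open>u\<^sub>1 \<cdots> u\<^sub>n\<close>, the quotient by the Jacobian ideal. Setting \<open>u\<^sub>i = 0\<close> gives a sequence
  \<open>0 \<rightarrow> gr M\<^sub>S\<^sub>\<union>\<^sub>i\<^sub>,\<^sub>J \<rightarrow> gr M\<^sub>S\<^sub>,\<^sub>J \<rightarrow> gr M\<^sub>S\<^sub>,\<^sub>J\<^sub>-\<^sub>i \<rightarrow> 0\<close>, and the theorem follows from its exactness by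
  inclusion and exclusion.

  Exactness reduces to strict triviality of the relations between the \<open>u\<^sub>j \<partial>f/\<partial>u\<^sub>j\<close>, that is, to
  acyclicity below the top degree of the Koszul complex of \<open>t\<close> and the homogenised \<open>u\<^sub>j \<partial>f/\<partial>u\<^sub>j\<close> on the
  semigroup ring of the cone over the Newton polytope. On the group ring of the span of a face the
  complex is exact, because nondegeneracy and the Nullstellensatz give the unit ideal. The cone is
  recovered from its span by sweeping: the lattice points of translates of a cone change along a
  generic path by the lattice points of translates of facets, so acyclicity follows by induction on
  the dimension. This replaces Hochster's theorem on normal semigroup rings.
\<close>

section \<open>The Koszul complex\<close>

text \<open>The variable t turns the filtration into a grading: a polynomial g of level at most s
  becomes t^s g, and passing to the graded ring is dividing by t. With t there are n + 1 elements,
  as many as the dimension of the cone. The obstacle is that exactness is easy only on groups, where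
  a unit ideal contracts the complex in every degree, whereas on the cone it fails in top degree.
  The bound that survives is p < dimension: each facet crossed costs one degree and at most one
  dimension, so the bound passes from a cone to its faces. Degree n, one below the top, is the
  degree of relations between the n + 1 elements, and only its exactness enters the comparison of
  dimensions. All complexes are described by sets of exponents, so that subcomplexes, quotients and
  graded pieces are set operations. Levels are multiplied by an integer D that clears the facet
  normals and also the exponent \<alpha> under consideration, so D varies with \<alpha>. The term
  (-1)^n is the case of no variables at all, where the quotient is the field of constants, placed in
  level 0.\<close>

abbreviation keys :: "('a \<Rightarrow>\<^sub>0 'b::zero) \<Rightarrow> 'a set" where "keys \<equiv> Poly_Mapping.keys"
abbreviation lookup :: "('a \<Rightarrow>\<^sub>0 'b::zero) \<Rightarrow> 'a \<Rightarrow> 'b" where "lookup \<equiv> Poly_Mapping.lookup"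

section \<open>Restriction of finitely supported functions to a set of exponents\<close>

lift_definition part :: "'a set \<Rightarrow> ('a \<Rightarrow>\<^sub>0 'b::zero) \<Rightarrow> 'a \<Rightarrow>\<^sub>0 'b" is
  "\<lambda>X g k. if k \<in> X then g k else 0"
  by (rule finite_subset[rotated]) auto

lemma lookup_part: "lookup (part X g) k = (if k \<in> X then lookup g k else 0)"
  by transfer simp

lemma keys_part [simp]: "keys (part X g) = keys g \<inter> X"
  by (auto simp: in_keys_iff lookup_part split: if_splits)

lemma part_zero [simp]: "part X 0 = 0"
  by (rule poly_mapping_eqI) (simp add: lookup_part)

lemma part_add: "part X (g + h) = part X g + part X (h :: 'a \<Rightarrow>\<^sub>0 'b::monoid_add)"
  by (rule poly_mapping_eqI) (simp add: lookup_part lookup_add)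

lemma part_diff: "part X (g - h) = part X g - part X (h :: 'a \<Rightarrow>\<^sub>0 'b::ab_group_add)"
  by (rule poly_mapping_eqI) (simp add: lookup_part lookup_minus)

lemma part_sum: "part X (\<Sum>i\<in>I. g i) = (\<Sum>i\<in>I. part X (g i :: 'a \<Rightarrow>\<^sub>0 'b::comm_monoid_add))"
  by (induction I rule: infinite_finite_induct) (simp_all add: part_add)

lemma part_id: "keys g \<subseteq> X \<Longrightarrow> part X g = g"
  by (rule poly_mapping_eqI) (auto simp: lookup_part in_keys_iff)

lemma part_eq_0: "keys g \<inter> X = {} \<Longrightarrow> part X g = 0"
  by (rule poly_mapping_eqI) (auto simp: lookup_part in_keys_iff)

lemma part_part [simp]: "part X (part Y g) = part (X \<inter> Y) g"
  by (rule poly_mapping_eqI) (auto simp: lookup_part)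

lemma part_compl: "part X g + part (- X) g = (g :: 'a \<Rightarrow>\<^sub>0 'b::monoid_add)"
  by (rule poly_mapping_eqI) (auto simp: lookup_part lookup_add)

lemma keys_mult_mem:
  assumes "k \<in> keys (a * b)"
  obtains v m where "k = v + m" "v \<in> keys a" "m \<in> keys b"
  using keys_mult[of a b] assms by blast

lemma keys_sum_subset: "(\<And>i. i \<in> I \<Longrightarrow> keys (g i) \<subseteq> X) \<Longrightarrow> keys (\<Sum>i\<in>I. g i) \<subseteq> X"
  for g :: "'i \<Rightarrow> 'a \<Rightarrow>\<^sub>0 'b::comm_monoid_add"
proof (induction I rule: infinite_finite_induct)
  case (insert x F)
  then have "keys (g x + sum g F) \<subseteq> keys (g x) \<union> keys (sum g F)"
    by (intro keys_add)
  moreover have "keys (g x) \<subseteq> X" "keys (sum g F) \<subseteq> X" using insert by auto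
  ultimately show ?case using insert by (simp add: subset_iff) blast
qed auto

lemma keys_add_subset: "keys g \<subseteq> X \<Longrightarrow> keys h \<subseteq> X \<Longrightarrow> keys (g + h) \<subseteq> X"
  for g :: "'a \<Rightarrow>\<^sub>0 'b::monoid_add"
  using keys_add[of g h] by blast

lemma keys_diff_subset: "keys g \<subseteq> X \<Longrightarrow> keys h \<subseteq> X \<Longrightarrow> keys (g - h) \<subseteq> X"
  for g :: "'a \<Rightarrow>\<^sub>0 'b::ab_group_add"
  by (auto simp: in_keys_iff lookup_minus subset_iff) (metis diff_zero)

definition sg :: "'j::finite \<Rightarrow> 'j set \<Rightarrow> 'r::comm_ring_1" where
  "sg j A = (- 1) ^ card {k \<in> A. to_nat k < to_nat j}"

lemma sg_insert [simp]: "sg j (insert j A) = sg j A"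
  unfolding sg_def by (rule arg_cong[where f="\<lambda>X. (-1) ^ card X"]) auto

lemma sg_remove [simp]: "sg j (A - {j}) = sg j A"
  unfolding sg_def by (rule arg_cong[where f="\<lambda>X. (-1) ^ card X"]) auto

lemma sg_sg [simp]: "sg j A * sg j A = 1"
  unfolding sg_def by (simp flip: power_mult_distrib)

lemma sg_sg_left [simp]: "sg j A * (sg j A * x) = x"
  by (simp flip: mult.assoc)

lemma sg_remove_greater: "to_nat j \<le> to_nat k \<Longrightarrow> sg j (A - {k}) = sg j A"
  unfolding sg_def by (rule arg_cong[where f="\<lambda>X. (-1) ^ card X"]) auto

lemma sg_remove_less:
  assumes "to_nat k < to_nat j" "k \<in> A"
  shows "sg j (A - {k}) = - sg j A"
proof -
  have "{l \<in> A. to_nat l < to_nat j} = insert k {l \<in> A - {k}. to_nat l < to_nat j}"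
    using assms by auto
  then have "card {l \<in> A. to_nat l < to_nat j} = Suc (card {l \<in> A - {k}. to_nat l < to_nat j})"
    by (simp add: card_insert_if)
  then show ?thesis unfolding sg_def by simp
qed

lemma sg_antisym:
  assumes "j \<in> A" "k \<in> A" "j \<noteq> k"
  shows "sg j A * sg k (A - {j}) = - (sg k A * sg j (A - {k}))"
proof -
  have "to_nat j \<noteq> to_nat k" using assms by simp
  then consider "to_nat j < to_nat k" | "to_nat k < to_nat j" by linarith
  then show ?thesis
    using assms by cases (simp_all add: sg_remove_less sg_remove_greater)
qed

text \<open>Each pair (j, k) cancels against (k, j). Splitting by the order of the indices avoids
  dividing by 2.\<close>

lemma sum_antisym:
  fixes t :: "'j::finite \<Rightarrow> 'j \<Rightarrow> 'r::comm_ring_1"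
  assumes "\<And>j k. j \<in> A \<Longrightarrow> k \<in> A \<Longrightarrow> j \<noteq> k \<Longrightarrow> t k j = - t j k"
  shows "(\<Sum>j\<in>A. \<Sum>k\<in>A - {j}. t j k) = 0"
proof -
  let ?L = "\<Sum>(j,k)\<in>{(j,k). j \<in> A \<and> k \<in> A \<and> to_nat j < to_nat k}. t j k"
  let ?G = "\<Sum>(j,k)\<in>{(j,k). j \<in> A \<and> k \<in> A \<and> to_nat k < to_nat j}. t j k"
  have "(\<Sum>j\<in>A. \<Sum>k\<in>A - {j}. t j k) = (\<Sum>(j,k)\<in>(SIGMA j:A. A - {j}). t j k)"
    by (simp add: sum.Sigma)
  also have "(SIGMA j:A. A - {j}) = {(j,k). j \<in> A \<and> k \<in> A \<and> to_nat j < to_nat k}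
      \<union> {(j,k). j \<in> A \<and> k \<in> A \<and> to_nat k < to_nat j}"
    by (auto simp: set_eq_iff) (metis inj_eq inj_to_nat linorder_neqE_nat)
  also have "(\<Sum>(j,k)\<in>\<dots>. t j k) = ?L + ?G"
    by (rule sum.union_disjoint) auto
  also have "?G = (\<Sum>(j,k)\<in>{(j,k). j \<in> A \<and> k \<in> A \<and> to_nat j < to_nat k}. t k j)"
    by (rule sum.reindex_bij_witness[where i="\<lambda>(j,k). (k,j)" and j="\<lambda>(j,k). (k,j)"]) auto
  also have "\<dots> = (\<Sum>(j,k)\<in>{(j,k). j \<in> A \<and> k \<in> A \<and> to_nat j < to_nat k}. - t j k)"
    by (rule sum.cong) (auto intro!: assms)
  also have "\<dots> = - ?L" by (simp add: sum_negf case_prod_unfold)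
  finally show ?thesis by simp
qed

text \<open>Read w as the form with coefficient \<open>w A\<close> at e_A: this is exterior
  multiplication by the sum of the f_j e_j.\<close>

definition koszul_d :: "('j::finite \<Rightarrow> 'r::comm_ring_1) \<Rightarrow> ('j set \<Rightarrow> 'r) \<Rightarrow> 'j set \<Rightarrow> 'r" where
  "koszul_d f w A = (\<Sum>j\<in>A. sg j A * (f j * w (A - {j})))"

text \<open>Contraction of forms by the functional that sends e_j to g_j.\<close>

definition koszul_h :: "('j::finite \<Rightarrow> 'r::comm_ring_1) \<Rightarrow> ('j set \<Rightarrow> 'r) \<Rightarrow> 'j set \<Rightarrow> 'r" where
  "koszul_h g w A = (\<Sum>j\<in>- A. sg j A * (g j * w (insert j A)))"

lemma koszul_d_d: "koszul_d f (koszul_d f w) A = 0"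
proof -
  have "koszul_d f (koszul_d f w) A =
      (\<Sum>j\<in>A. \<Sum>k\<in>A - {j}. (sg j A * sg k (A - {j})) * (f j * f k * w (A - {j} - {k})))"
    unfolding koszul_d_def by (simp add: sum_distrib_left mult_ac)
  also have "\<dots> = 0"
  proof (rule sum_antisym)
    fix j k assume jk: "j \<in> A" "k \<in> A" "j \<noteq> k"
    have "A - {k} - {j} = A - {j} - {k}" by auto
    then show "sg k A * sg j (A - {k}) * (f k * f j * w (A - {k} - {j}))
      = - (sg j A * sg k (A - {j}) * (f j * f k * w (A - {j} - {k})))"
      by (simp add: sg_antisym[OF jk] mult.commute[of "f k"])
  qed
  finally show ?thesis .
qed

lemma koszul_d_add: "koszul_d f (\<lambda>A. v A + w A) A = koszul_d f v A + koszul_d f w A"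
  unfolding koszul_d_def by (simp add: algebra_simps sum.distrib)

lemma koszul_d_diff: "koszul_d f (\<lambda>A. v A - w A) A = koszul_d f v A - koszul_d f w A"
  unfolding koszul_d_def by (simp add: algebra_simps sum_subtractf)

text \<open>The diagonal terms f_j g_j come from the first composite when j is in A and from the
  second when it is not; the mixed terms cancel in pairs by \<open>sg_antisym\<close>. A solution of
  f g = 1 therefore contracts the complex.\<close>

lemma koszul_homotopy:
  "koszul_d f (koszul_h g w) A + koszul_h g (koszul_d f w) A = (\<Sum>j\<in>UNIV. f j * g j) * w A"
proof -
  have 1: "sg j A * (f j * koszul_h g w (A - {j})) =
      f j * g j * w A + (\<Sum>k\<in>- A. sg j A * sg k (A - {j}) * (f j * g k * w (insert k (A - {j}))))"
    if "j \<in> A" for j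
  proof -
    have "- (A - {j}) = insert j (- A)" by auto
    then show ?thesis using that
      by (simp add: koszul_h_def sum_distrib_left algebra_simps insert_absorb)
  qed
  have 2: "sg k A * (g k * koszul_d f w (insert k A)) =
      f k * g k * w A + (\<Sum>j\<in>A. sg k A * sg j (insert k A) * (f j * g k * w (insert k A - {j})))"
    if "k \<in> - A" for k
    using that by (simp add: koszul_d_def sum_distrib_left algebra_simps)
  have 3: "sg j A * sg k (A - {j}) * (f j * g k * w (insert k (A - {j})))
      = - (sg k A * sg j (insert k A) * (f j * g k * w (insert k A - {j})))"
    if "j \<in> A" "k \<in> - A" for j k
  proof -
    have ne: "j \<noteq> k" using that by auto
    have e: "insert k (A - {j}) = insert k A - {j}" using ne by auto
    have "sg k A = (sg k (insert k A) :: 'a)" "sg k (A - {j}) = (sg k (insert k A - {j}) :: 'a)"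
      unfolding e[symmetric] by simp_all
    moreover have "sg j A = (sg j (insert k A - {k}) :: 'a)" using that by simp
    moreover have "sg j (insert k A) * sg k (insert k A - {j})
      = - (sg k (insert k A) * sg j (insert k A - {k}) :: 'a)"
      using that ne by (intro sg_antisym) auto
    ultimately have r: "sg j (insert k A) * sg k (A - {j}) = - (sg k A * sg j A :: 'a)"
      by metis
    have "sg j A * sg k (A - {j}) = sg j A * (sg j (insert k A) * (sg j (insert k A) * sg k (A - {j}) :: 'a))"
      by simp
    also have "\<dots> = - (sg j A * (sg j A * (sg k A * sg j (insert k A))))"
      unfolding r by (simp only: mult_minus_right mult_ac)
    finally have "sg j A * sg k (A - {j}) = - (sg k A * sg j (insert k A) :: 'a)"
      by simp
    then show ?thesis by (simp add: e)
  qed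
  have "koszul_d f (koszul_h g w) A + koszul_h g (koszul_d f w) A =
     (\<Sum>j\<in>A. f j * g j * w A) + (\<Sum>k\<in>- A. f k * g k * w A) +
     ((\<Sum>j\<in>A. \<Sum>k\<in>- A. sg j A * sg k (A - {j}) * (f j * g k * w (insert k (A - {j})))) +
      (\<Sum>k\<in>- A. \<Sum>j\<in>A. sg k A * sg j (insert k A) * (f j * g k * w (insert k A - {j}))))"
    unfolding koszul_d_def[of f "koszul_h g w"] koszul_h_def[of g "koszul_d f w"]
    by (simp add: 1 2 sum.distrib)
  also have "(\<Sum>j\<in>A. \<Sum>k\<in>- A. sg j A * sg k (A - {j}) * (f j * g k * w (insert k (A - {j}))))
      = - (\<Sum>j\<in>A. \<Sum>k\<in>- A. sg k A * sg j (insert k A) * (f j * g k * w (insert k A - {j})))"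
    by (simp add: 3 sum_negf)
  also have "(\<Sum>k\<in>- A. \<Sum>j\<in>A. sg k A * sg j (insert k A) * (f j * g k * w (insert k A - {j})))
      = (\<Sum>j\<in>A. \<Sum>k\<in>- A. sg k A * sg j (insert k A) * (f j * g k * w (insert k A - {j})))"
    by (rule sum.swap)
  also have "(\<Sum>j\<in>A. f j * g j * w A) + (\<Sum>k\<in>- A. f k * g k * w A) = (\<Sum>j\<in>A \<union> - A. f j * g j * w A)"
    by (rule sum.union_disjoint[symmetric]) auto
  finally show ?thesis by (simp add: sum_distrib_right Compl_partition)
qed

section \<open>Truncated Koszul complexes over a group ring\<close>

type_synonym ('j, 'v) cochain = "'j set \<Rightarrow> ('v \<Rightarrow>\<^sub>0 complex)"

definition supp_in :: "('j set \<Rightarrow> 'v set) \<Rightarrow> ('j, 'v) cochain \<Rightarrow> bool" where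
  "supp_in Q w \<longleftrightarrow> (\<forall>A. keys (w A) \<subseteq> Q A)"

definition homog :: "int \<Rightarrow> ('j, 'v) cochain \<Rightarrow> bool" where
  "homog p w \<longleftrightarrow> (\<forall>A. w A \<noteq> 0 \<longrightarrow> int (card A) = p)"

text \<open>The monomials \<open>u\<^sup>m e\<^sub>A\<close> with \<open>m \<in> Q A\<close> span a subquotient of the Koszul complex when \<open>Q\<close> is a
  difference of two \<open>d\<close>-closed families; \<open>trunc_d f Q\<close> is its differential. All complexes below
  are of this form.\<close>

definition trunc_d :: "('j::finite \<Rightarrow> ('v::ab_group_add \<Rightarrow>\<^sub>0 complex)) \<Rightarrow> ('j set \<Rightarrow> 'v set) \<Rightarrow>
    ('j, 'v) cochain \<Rightarrow> ('j, 'v) cochain" where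
  "trunc_d f Q w A = part (Q A) (koszul_d f w A)"

text \<open>Degrees are integers, so that degree -1 contains only the zero cochain and exactness at
  0 says that the differential is injective there.\<close>

definition exact_at :: "('j::finite \<Rightarrow> ('v::ab_group_add \<Rightarrow>\<^sub>0 complex)) \<Rightarrow> ('j set \<Rightarrow> 'v set) \<Rightarrow> int \<Rightarrow> bool" where
  "exact_at f Q p \<longleftrightarrow> (\<forall>w. supp_in Q w \<and> homog p w \<and> (\<forall>A. trunc_d f Q w A = 0) \<longrightarrow>
     (\<exists>e. supp_in Q e \<and> homog (p - 1) e \<and> (\<forall>A. trunc_d f Q e A = w A)))"

definition d_closed :: "('j::finite \<Rightarrow> ('v::ab_group_add \<Rightarrow>\<^sub>0 complex)) \<Rightarrow> ('j set \<Rightarrow> 'v set) \<Rightarrow> bool" where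
  "d_closed f U \<longleftrightarrow> (\<forall>A j v m. j \<notin> A \<longrightarrow> v \<in> keys (f j) \<longrightarrow> m \<in> U A \<longrightarrow> v + m \<in> U (insert j A))"

definition loc_closed :: "('j::finite \<Rightarrow> ('v::ab_group_add \<Rightarrow>\<^sub>0 complex)) \<Rightarrow> ('j set \<Rightarrow> 'v set) \<Rightarrow> bool" where
  "loc_closed f Q \<longleftrightarrow> (\<exists>U U'. d_closed f U \<and> d_closed f U' \<and> (\<forall>A. Q A = U A - U' A))"

lemma exact_atD:
  assumes "exact_at f Q p" "supp_in Q w" "homog p w" "\<And>A. trunc_d f Q w A = 0"
  obtains e where "supp_in Q e" "homog (p - 1) e" "\<And>A. trunc_d f Q e A = w A"
  using assms unfolding exact_at_def by blast

lemma supp_in_part: "supp_in Q (\<lambda>A. part (Q A) (w A))"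
  by (simp add: supp_in_def)

lemma homog_part: "homog p w \<Longrightarrow> homog p (\<lambda>A. part (Q A) (w A))"
  unfolding homog_def by (metis part_zero)

lemma homog_diff: "homog p v \<Longrightarrow> homog p w \<Longrightarrow> homog p (\<lambda>A. v A - w A)"
  unfolding homog_def by (metis diff_self)

lemma homog_koszul_d: "homog p w \<Longrightarrow> homog (p + 1) (koszul_d f w)"
  unfolding homog_def
proof (intro allI impI)
  fix A assume h: "\<forall>A. w A \<noteq> 0 \<longrightarrow> int (card A) = p" and "koszul_d f w A \<noteq> 0"
  then obtain j where "j \<in> A" "sg j A * (f j * w (A - {j})) \<noteq> 0"
    unfolding koszul_d_def by (elim sum.not_neutral_contains_not_neutral)
  then have j: "j \<in> A" "w (A - {j}) \<noteq> 0" by auto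
  then have "int (card (A - {j})) = p" using h by blast
  moreover have "card A = Suc (card (A - {j}))"
    using j by (metis card.remove finite)
  ultimately show "int (card A) = p + 1" by simp
qed

lemma homog_koszul_h: "homog p w \<Longrightarrow> homog (p - 1) (koszul_h f w)"
  unfolding homog_def
proof (intro allI impI)
  fix A assume h: "\<forall>A. w A \<noteq> 0 \<longrightarrow> int (card A) = p" and "koszul_h f w A \<noteq> 0"
  then obtain j where "j \<in> - A" "sg j A * (f j * w (insert j A)) \<noteq> 0"
    unfolding koszul_h_def by (elim sum.not_neutral_contains_not_neutral)
  then have j: "j \<notin> A" "w (insert j A) \<noteq> 0" by auto
  then have "int (card (insert j A)) = p" using h by blast
  then show "int (card A) = p - 1" using j by simp
qed

lemma homog_trunc_d: "homog p w \<Longrightarrow> homog (p + 1) (trunc_d f Q w)"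
  unfolding trunc_d_def using homog_koszul_d homog_part by blast

lemma trunc_d_diff: "trunc_d f Q (\<lambda>A. v A - w A) A = trunc_d f Q v A - trunc_d f Q w A"
  by (simp add: trunc_d_def koszul_d_diff part_diff)

lemma sg_mult_keys: "keys (sg j A * g) = keys g"
proof (cases "even (card {k \<in> A. to_nat k < to_nat j})")
  case True then show ?thesis by (simp add: sg_def)
next
  case False then show ?thesis by (simp add: sg_def)
qed

lemma part_sg: "part X (sg j A * g) = sg j A * part X (g :: 'v::ab_group_add \<Rightarrow>\<^sub>0 complex)"
  unfolding sg_def by (cases "even (card {k \<in> A. to_nat k < to_nat j})")
    (auto intro!: poly_mapping_eqI simp: lookup_part)

lemma keys_koszul_d:
  assumes "x \<in> keys (koszul_d f w A)"
  obtains j v m where "j \<in> A" "x = v + m" "v \<in> keys (f j)" "m \<in> keys (w (A - {j}))"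
proof -
  have "keys (koszul_d f w A) \<subseteq> {x. \<exists>j v m. j \<in> A \<and> x = v + m \<and> v \<in> keys (f j) \<and> m \<in> keys (w (A - {j}))}"
    unfolding koszul_d_def
    by (rule keys_sum_subset) (auto simp: sg_mult_keys elim!: keys_mult_mem)
  then show ?thesis using assms that by blast
qed

lemma supp_in_koszul_d:
  assumes "d_closed f U" "supp_in U w"
  shows "supp_in U (koszul_d f w)"
  unfolding supp_in_def
proof (intro allI subsetI)
  fix A x assume "x \<in> keys (koszul_d f w A)"
  then obtain j v m where *: "j \<in> A" "x = v + m" "v \<in> keys (f j)" "m \<in> keys (w (A - {j}))"
    by (rule keys_koszul_d)
  then have "v + m \<in> U (insert j (A - {j}))"
    using assms unfolding d_closed_def supp_in_def by blast
  then show "x \<in> U A" using * by (simp add: insert_absorb)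
qed

lemma koszul_d_split:
  "koszul_d f w A = koszul_d f (\<lambda>A. part (Q A) (w A)) A + koszul_d f (\<lambda>A. part (- Q A) (w A)) A"
  by (simp add: koszul_d_add[symmetric] part_compl)

text \<open>What the truncation cuts off lies in U', and U' absorbs all further differentials, so
  nothing returns to Q and d d = 0 survives.\<close>

lemma trunc_d_trunc_d:
  assumes "loc_closed f Q" "supp_in Q w"
  shows "trunc_d f Q (trunc_d f Q w) A = 0"
proof -
  obtain U U' where U: "d_closed f U" "d_closed f U'" "\<And>A. Q A = U A - U' A"
    using assms(1) unfolding loc_closed_def by blast
  have "supp_in U w" using assms(2) U(3) by (auto simp: supp_in_def)
  then have "supp_in U (koszul_d f w)" by (rule supp_in_koszul_d[OF U(1)])
  then have "supp_in U' (\<lambda>A. part (- Q A) (koszul_d f w A))"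
    using U(3) by (auto simp: supp_in_def)
  then have "supp_in U' (koszul_d f (\<lambda>A. part (- Q A) (koszul_d f w A)))"
    by (rule supp_in_koszul_d[OF U(2)])
  then have "part (Q A) (koszul_d f (\<lambda>A. part (- Q A) (koszul_d f w A)) A) = 0"
    using U(3) by (intro part_eq_0) (auto simp: supp_in_def)
  moreover have "trunc_d f Q (trunc_d f Q w) A =
    part (Q A) (koszul_d f (\<lambda>A. part (Q A) (koszul_d f w A)) A)"
    by (simp add: trunc_d_def[abs_def])
  moreover have "part (Q A) (koszul_d f (koszul_d f w) A) = 0"
    by (simp add: koszul_d_d)
  ultimately show ?thesis
    using koszul_d_split[of f "koszul_d f w" A Q] by (simp add: part_add)
qed

section \<open>Exactness of subcomplexes, summands and shifts\<close>

lemma trunc_d_sub: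
  assumes sub: "\<And>A j v m. j \<notin> A \<Longrightarrow> v \<in> keys (f j) \<Longrightarrow> m \<in> Q1 A \<Longrightarrow> v + m \<in> Q (insert j A) \<Longrightarrow> v + m \<in> Q1 (insert j A)"
    and le: "\<And>A. Q1 A \<subseteq> Q A" and w: "supp_in Q1 w"
  shows "trunc_d f Q w A = trunc_d f Q1 w A"
proof -
  have "keys (koszul_d f w A) \<inter> Q A \<subseteq> Q1 A"
  proof
    fix x assume x: "x \<in> keys (koszul_d f w A) \<inter> Q A"
    then obtain j v m where *: "j \<in> A" "x = v + m" "v \<in> keys (f j)" "m \<in> keys (w (A - {j}))"
      by (auto elim: keys_koszul_d)
    then have "v + m \<in> Q1 (insert j (A - {j}))"
      using sub[of j "A - {j}" v m] w x unfolding supp_in_def by (auto simp: insert_absorb)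
    then show "x \<in> Q1 A" using * by (simp add: insert_absorb)
  qed
  then show ?thesis unfolding trunc_d_def using le
    by (intro poly_mapping_eqI) (auto simp: lookup_part in_keys_iff)
qed

text \<open>Here Q1 is a subcomplex with quotient Q2. A cochain whose differential lies in Q1
  projects to a cocycle of Q2. By exactness of Q2 this projection is a boundary, and subtracting the
  boundary of a lift moves the cochain into Q1 without changing its differential.\<close>

lemma push_down:
  fixes f :: "'j::finite \<Rightarrow> ('v::ab_group_add \<Rightarrow>\<^sub>0 complex)"
  assumes lc: "loc_closed f Q" and Q: "\<And>A. Q A = Q1 A \<union> Q2 A" "\<And>A. Q1 A \<inter> Q2 A = {}"
    and sub: "\<And>A j v m. j \<notin> A \<Longrightarrow> v \<in> keys (f j) \<Longrightarrow> m \<in> Q1 A \<Longrightarrow> v + m \<in> Q (insert j A) \<Longrightarrow> v + m \<in> Q1 (insert j A)"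
    and ex2: "exact_at f Q2 p"
    and e: "supp_in Q e" "homog p e" and de: "supp_in Q1 (trunc_d f Q e)"
  obtains e' where "supp_in Q1 e'" "homog p e'" "\<And>A. trunc_d f Q1 e' A = trunc_d f Q e A"
proof -
  define e1 where "e1 = (\<lambda>A. part (Q1 A) (e A))"
  define e2 where "e2 = (\<lambda>A. part (Q2 A) (e A))"
  have eq: "e = (\<lambda>A. e1 A + e2 A)"
    unfolding e1_def e2_def using e(1) Q(2)
    by (intro ext poly_mapping_eqI) (auto simp: supp_in_def lookup_part lookup_add in_keys_iff Q(1) subset_iff disjoint_iff)
  have s1: "supp_in Q1 e1" and s2: "supp_in Q2 e2"
    unfolding e1_def e2_def by (simp_all add: supp_in_part)
  have le: "Q1 A \<subseteq> Q A" for A using Q(1) by auto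
  have Q2: "part (Q2 A) g = part (Q2 A) (part (Q A) g)" for A and g :: "'v \<Rightarrow>\<^sub>0 complex"
    by (simp add: Q(1) Int_absorb2)
  have z1: "part (Q2 A) (trunc_d f Q e1 A) = 0" for A
    using trunc_d_sub[OF sub le s1, where A=A] Q(2)[of A]
    by (simp add: part_eq_0 trunc_d_def) (simp add: Int_commute part_eq_0)
  have "trunc_d f Q2 e2 A = 0" for A
  proof -
    have "trunc_d f Q2 e2 A = part (Q2 A) (trunc_d f Q e2 A)"
      unfolding trunc_d_def by (rule Q2)
    also have "\<dots> = part (Q2 A) (trunc_d f Q e A) - part (Q2 A) (trunc_d f Q e1 A)"
      unfolding trunc_d_def by (subst eq) (simp add: koszul_d_add part_add)
    also have "part (Q2 A) (trunc_d f Q e A) = 0"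
      using de Q(2)[of A] unfolding supp_in_def by (intro part_eq_0) blast
    finally show ?thesis using z1 by simp
  qed
  moreover have "homog p e2" unfolding e2_def by (rule homog_part[OF e(2)])
  ultimately obtain z where z: "supp_in Q2 z" "homog (p - 1) z" "\<And>A. trunc_d f Q2 z A = e2 A"
    using exact_atD[OF ex2 s2] by blast
  have zQ: "supp_in Q z" using z(1) Q(1) by (auto simp: supp_in_def)
  define e' where "e' = (\<lambda>A. e A - trunc_d f Q z A)"
  have "part (Q2 A) (e' A) = 0" for A
  proof -
    have "part (Q2 A) (e' A) = e2 A - part (Q2 A) (trunc_d f Q z A)"
      unfolding e'_def part_diff e2_def ..
    also have "part (Q2 A) (trunc_d f Q z A) = trunc_d f Q2 z A"
      unfolding trunc_d_def by (rule Q2[symmetric])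
    finally show ?thesis using z(3) by simp
  qed
  then have "keys (e' A) \<inter> Q2 A = {}" for A by (metis keys_part keys_zero)
  moreover have "keys (e' A) \<subseteq> Q A" for A
    unfolding e'_def using e(1) by (intro keys_diff_subset) (auto simp: supp_in_def trunc_d_def)
  ultimately have s': "supp_in Q1 e'"
    unfolding supp_in_def Q(1) by blast
  have "homog p e'"
    unfolding e'_def using homog_trunc_d[OF z(2), of f Q] e(2) by (intro homog_diff) auto
  moreover have "trunc_d f Q1 e' A = trunc_d f Q e A" for A
  proof -
    have "trunc_d f Q1 e' A = trunc_d f Q e' A"
      by (rule trunc_d_sub[OF sub le s', symmetric])
    also have "\<dots> = trunc_d f Q e A - trunc_d f Q (trunc_d f Q z) A"
      unfolding e'_def by (rule trunc_d_diff)
    finally show ?thesis using trunc_d_trunc_d[OF lc zQ] by simp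
  qed
  ultimately show ?thesis using that s' by blast
qed

text \<open>The segment H^(p-1)(Q2) -> H^p(Q1) -> H^p(Q) of the long exact sequence.\<close>

lemma exact_at_sub:
  fixes f :: "'j::finite \<Rightarrow> ('v::ab_group_add \<Rightarrow>\<^sub>0 complex)"
  assumes lc: "loc_closed f Q" and Q: "\<And>A. Q A = Q1 A \<union> Q2 A" "\<And>A. Q1 A \<inter> Q2 A = {}"
    and sub: "\<And>A j v m. j \<notin> A \<Longrightarrow> v \<in> keys (f j) \<Longrightarrow> m \<in> Q1 A \<Longrightarrow> v + m \<in> Q (insert j A) \<Longrightarrow> v + m \<in> Q1 (insert j A)"
    and ex2: "exact_at f Q2 (p - 1)" and ex: "exact_at f Q p"
  shows "exact_at f Q1 p"
  unfolding exact_at_def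
proof (intro allI impI, elim conjE)
  fix w assume w: "supp_in Q1 w" "homog p w" "\<forall>A. trunc_d f Q1 w A = 0"
  have le: "Q1 A \<subseteq> Q A" for A using Q(1) by auto
  have wQ: "supp_in Q w" using w(1) Q(1) by (auto simp: supp_in_def)
  have "trunc_d f Q w A = 0" for A
    using trunc_d_sub[OF sub le w(1)] w(3) by simp
  then obtain e where e: "supp_in Q e" "homog (p - 1) e" "\<And>A. trunc_d f Q e A = w A"
    using exact_atD[OF ex wQ w(2)] by blast
  then have ew: "trunc_d f Q e = w" by auto
  obtain e' where "supp_in Q1 e'" "homog (p - 1) e'" "\<And>A. trunc_d f Q1 e' A = trunc_d f Q e A"
    by (rule push_down[OF lc Q sub ex2 e(1,2)]) (use ew w(1) in auto)
  then show "\<exists>e. supp_in Q1 e \<and> homog (p - 1) e \<and> (\<forall>A. trunc_d f Q1 e A = w A)"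
    using ew by metis
qed

text \<open>The differential preserves both Q1 and its complement in Q, so a primitive can be cut
  down to Q1. This serves to isolate one degree of a grading.\<close>

lemma exact_at_summand:
  fixes f :: "'j::finite \<Rightarrow> ('v::ab_group_add \<Rightarrow>\<^sub>0 complex)"
  assumes le: "\<And>A. Q1 A \<subseteq> Q A"
    and sub: "\<And>A j v m. j \<notin> A \<Longrightarrow> v \<in> keys (f j) \<Longrightarrow> m \<in> Q A \<Longrightarrow> v + m \<in> Q (insert j A) \<Longrightarrow>
       m \<in> Q1 A \<longleftrightarrow> v + m \<in> Q1 (insert j A)"
    and ex: "exact_at f Q p"
  shows "exact_at f Q1 p"
  unfolding exact_at_def
proof (intro allI impI, elim conjE)
  fix w assume w: "supp_in Q1 w" "homog p w" "\<forall>A. trunc_d f Q1 w A = 0"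
  have sub1: "\<And>A j v m. j \<notin> A \<Longrightarrow> v \<in> keys (f j) \<Longrightarrow> m \<in> Q1 A \<Longrightarrow> v + m \<in> Q (insert j A) \<Longrightarrow> v + m \<in> Q1 (insert j A)"
    using sub le by blast
  have wQ: "supp_in Q w" using w(1) le unfolding supp_in_def by blast
  have "trunc_d f Q w A = 0" for A
    using trunc_d_sub[OF sub1 le w(1)] w(3) by simp
  then obtain e where e: "supp_in Q e" "homog (p - 1) e" "\<And>A. trunc_d f Q e A = w A"
    using exact_atD[OF ex wQ w(2)] by blast
  let ?e = "\<lambda>A. part (Q1 A) (e A)"
  let ?e2 = "\<lambda>A. part (- Q1 A) (e A)"
  have "part (Q1 A) (koszul_d f ?e2 A) = 0" for A
  proof (rule part_eq_0, rule ccontr)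
    assume "keys (koszul_d f ?e2 A) \<inter> Q1 A \<noteq> {}"
    then obtain x where x: "x \<in> keys (koszul_d f ?e2 A)" "x \<in> Q1 A" by blast
    from x(1) obtain j v m where *: "j \<in> A" "x = v + m" "v \<in> keys (f j)" "m \<in> keys (?e2 (A - {j}))"
      by (rule keys_koszul_d)
    then have "m \<in> Q (A - {j})" using e(1) by (auto simp: supp_in_def)
    moreover have "insert j (A - {j}) = A" using * by auto
    ultimately have "m \<in> Q1 (A - {j})"
      using sub[of j "A - {j}" v m] * x(2) le[of A] by auto
    then show False using * by auto
  qed
  then have "trunc_d f Q1 ?e A = part (Q1 A) (koszul_d f e A)" for A
    using koszul_d_split[of f e A Q1] by (simp add: trunc_d_def part_add)
  moreover have "part (Q1 A) (koszul_d f e A) = part (Q1 A) (trunc_d f Q e A)" for A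
    using le[of A] by (simp add: trunc_d_def Int_absorb2)
  moreover have "part (Q1 A) (trunc_d f Q e A) = w A" for A
    using e(3) w(1) by (simp add: part_id supp_in_def)
  ultimately show "\<exists>e. supp_in Q1 e \<and> homog (p - 1) e \<and> (\<forall>A. trunc_d f Q1 e A = w A)"
    using supp_in_part homog_part[OF e(2)] by metis
qed

lemma exact_at_neg: "p < 0 \<Longrightarrow> exact_at f Q p"
  unfolding exact_at_def
proof (intro allI impI, elim conjE)
  fix w :: "('a, 'b) cochain" assume "p < 0" "homog p w"
  then have "w A = 0" for A unfolding homog_def by force
  then show "\<exists>e. supp_in Q e \<and> homog (p - 1) e \<and> (\<forall>A. trunc_d f Q e A = w A)"
    by (intro exI[of _ "\<lambda>A. 0"]) (simp add: supp_in_def homog_def trunc_d_def koszul_d_def)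
qed

text \<open>\<open>Q2\<close> is \<open>Q'\<close> multiplied by the exterior generator \<open>e\<^sub>i\<close>, which shifts degrees by one.\<close>

lemma exact_at_shift:
  fixes f :: "'j::finite \<Rightarrow> ('v::ab_group_add \<Rightarrow>\<^sub>0 complex)"
  assumes Q2: "\<And>A. Q2 A = (if i \<in> A then Q' (A - {i}) else {})"
    and Q': "\<And>A. i \<in> A \<Longrightarrow> Q' A = {}"
    and ex: "exact_at f Q' (p - 1)"
  shows "exact_at f Q2 p"
  unfolding exact_at_def
proof (intro allI impI, elim conjE)
  fix w assume w: "supp_in Q2 w" "homog p w" "\<forall>A. trunc_d f Q2 w A = 0"
  define up where "up v = (\<lambda>A. if i \<in> A then sg i A * v (A - {i}) else 0)" for v :: "('j, 'v) cochain"
  have up_d: "trunc_d f Q2 (up v) A = - up (trunc_d f Q' v) A" if "supp_in Q' v" for v A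
  proof (cases "i \<in> A")
    case True
    have z: "up v (A - {i}) = 0" by (simp add: up_def)
    have "koszul_d f (up v) A = (\<Sum>j\<in>A - {i}. sg j A * (f j * up v (A - {j})))"
      unfolding koszul_d_def using True z by (subst sum.remove[OF _ True]) auto
    also have "\<dots> = (\<Sum>j\<in>A - {i}. - (sg i A * (sg j (A - {i}) * (f j * v (A - {i} - {j})))))"
    proof (rule sum.cong[OF refl])
      fix j assume j: "j \<in> A - {i}"
      have e: "A - {j} - {i} = A - {i} - {j}" by auto
      have "sg j A * (f j * up v (A - {j})) = (sg j A * sg i (A - {j})) * (f j * v (A - {i} - {j}))"
        using j True by (auto simp add: up_def e mult_ac)
      also have "\<dots> = - (sg i A * sg j (A - {i})) * (f j * v (A - {i} - {j}))"
        using j True by (subst sg_antisym) auto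
      finally show "sg j A * (f j * up v (A - {j})) = - (sg i A * (sg j (A - {i}) * (f j * v (A - {i} - {j}))))"
        by (simp add: mult_ac)
    qed
    also have "\<dots> = - (sg i A * koszul_d f v (A - {i}))"
      unfolding koszul_d_def by (simp add: sum_negf sum_distrib_left)
    finally have k: "koszul_d f (up v) A = - (sg i A * koszul_d f v (A - {i}))" .
    have mp: "part X (- g) = - part X g" for X and g :: "'v \<Rightarrow>\<^sub>0 complex"
      by (rule poly_mapping_eqI) (simp add: lookup_part)
    show ?thesis unfolding trunc_d_def k using True by (simp add: Q2 up_def mp part_sg)
  next
    case False then show ?thesis by (simp add: trunc_d_def Q2 up_def part_eq_0)
  qed
  have up_supp: "supp_in Q2 (up v)" if "supp_in Q' v" for v
    using that unfolding supp_in_def up_def by (auto simp: Q2 sg_mult_keys)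
  have up_hom: "homog (q + 1) (up v)" if "homog q v" for q v
    unfolding homog_def
  proof (intro allI impI)
    fix A assume "up v A \<noteq> 0"
    then have A: "i \<in> A" "v (A - {i}) \<noteq> 0" unfolding up_def by (auto split: if_splits)
    then have "int (card (A - {i})) = q" using that unfolding homog_def by blast
    moreover have "card A = Suc (card (A - {i}))" using A by (metis card.remove finite)
    ultimately show "int (card A) = q + 1" by simp
  qed
  define v where "v = (\<lambda>A. if i \<in> A then 0 else sg i (insert i A) * w (insert i A))"
  have wv: "w = up v"
  proof
    fix A show "w A = up v A"
    proof (cases "i \<in> A")
      case True then show ?thesis by (simp add: up_def v_def insert_absorb)
    next
      case False
      then have "keys (w A) \<subseteq> {}" using w(1) Q2[of A] unfolding supp_in_def by metis
      then show ?thesis using False by (simp add: up_def)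
    qed
  qed
  have v: "supp_in Q' v"
    unfolding supp_in_def
  proof
    fix A show "keys (v A) \<subseteq> Q' A"
    proof (cases "i \<in> A")
      case False
      then have "keys (w (insert i A)) \<subseteq> Q' A" using w(1) unfolding supp_in_def by (auto simp: Q2 dest!: spec[of _ "insert i A"])
      then show ?thesis using False by (simp add: v_def sg_mult_keys)
    qed (simp add: v_def)
  qed
  have vh: "homog (p - 1) v"
    unfolding homog_def
  proof (intro allI impI)
    fix A assume "v A \<noteq> 0"
    then have A: "i \<notin> A" "w (insert i A) \<noteq> 0" unfolding v_def by (auto split: if_splits)
    then have "int (card (insert i A)) = p" using w(2) unfolding homog_def by blast
    then show "int (card A) = p - 1" using A by simp
  qed
  have "trunc_d f Q' v A = 0" for A
  proof (cases "i \<in> A")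
    case True then show ?thesis using Q' by (simp add: trunc_d_def part_eq_0)
  next
    case False
    have "up (trunc_d f Q' v) (insert i A) = 0"
      using up_d[OF v, of "insert i A"] w(3) wv by simp
    then have "sg i A * trunc_d f Q' v A = 0" using False by (simp add: up_def)
    then show ?thesis by (metis mult_zero_right sg_sg_left)
  qed
  then obtain e where e: "supp_in Q' e" "homog (p - 1 - 1) e" "\<And>A. trunc_d f Q' e A = v A"
    using exact_atD[OF ex v vh] by blast
  let ?e = "\<lambda>A. - up e A"
  have "trunc_d f Q2 ?e A = w A" for A
  proof -
    have "trunc_d f Q2 (\<lambda>A. 0) A = 0" by (simp add: trunc_d_def koszul_d_def)
    then have "trunc_d f Q2 ?e A = - trunc_d f Q2 (up e) A"
      using trunc_d_diff[of f Q2 "\<lambda>A. 0" "up e" A] by simp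
    also have "\<dots> = up (trunc_d f Q' e) A" by (simp add: up_d[OF e(1)])
    also have "trunc_d f Q' e = v" using e(3) by auto
    finally show ?thesis by (simp add: wv)
  qed
  moreover have "supp_in Q2 ?e" using up_supp[OF e(1)] by (simp add: supp_in_def)
  moreover have "homog (p - 1) ?e" using up_hom[OF e(2)] by (simp add: homog_def)
  ultimately show "\<exists>e. supp_in Q2 e \<and> homog (p - 1) e \<and> (\<forall>A. trunc_d f Q2 e A = w A)"
    by blast
qed

text \<open>Inside the coset G only the monomials of f_j lying in Z can act, so the truncated
  complex is the Koszul complex of the \<open>part Z (f j)\<close>. These generate the unit ideal,
  and contraction by g stays within G, so it is a contracting homotopy in every degree.\<close>

lemma exact_at_unit:
  fixes f fZ g :: "'j::finite \<Rightarrow> ('v::ab_group_add \<Rightarrow>\<^sub>0 complex)"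
  assumes G: "\<And>j v m. j \<in> N \<Longrightarrow> v \<in> keys (f j) \<Longrightarrow> m \<in> G \<Longrightarrow> v + m \<in> G \<longleftrightarrow> v \<in> Z"
    and g: "\<And>j v m. j \<in> N \<Longrightarrow> v \<in> keys (g j) \<Longrightarrow> m \<in> G \<Longrightarrow> v + m \<in> G"
    and unit: "(\<Sum>j\<in>N. part Z (f j) * g j) = 1"
  shows "exact_at f (\<lambda>A. if A \<subseteq> N then G else {}) p"
proof -
  define F where "F = (\<lambda>j. if j \<in> N then part Z (f j) else 0)"
  define g' where "g' = (\<lambda>j. if j \<in> N then g j else 0)"
  let ?Q = "\<lambda>A. if A \<subseteq> N then G else {}"
  have supph: "supp_in ?Q (koszul_h g' w)" if "supp_in ?Q w" for w
    unfolding supp_in_def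
  proof
    fix A
    have "keys (sg j A * (g' j * w (insert j A))) \<subseteq> ?Q A" for j
    proof -
      have "x \<in> ?Q A" if "x \<in> keys (g' j * w (insert j A))" for x
      proof -
        from that obtain v m where *: "x = v + m" "v \<in> keys (g' j)" "m \<in> keys (w (insert j A))"
          by (rule keys_mult_mem)
        then have "j \<in> N" "v \<in> keys (g j)" by (auto simp: g'_def split: if_splits)
        moreover have "m \<in> ?Q (insert j A)" using * \<open>supp_in ?Q w\<close> unfolding supp_in_def by blast
        ultimately show ?thesis using * g by (auto split: if_splits)
      qed
      then show ?thesis unfolding sg_mult_keys by blast
    qed
    then show "keys (koszul_h g' w A) \<subseteq> ?Q A"
      unfolding koszul_h_def by (intro keys_sum_subset) auto
  qed
  have tr: "trunc_d f ?Q w A = koszul_d F w A" if w: "supp_in ?Q w" for w A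
  proof (cases "A \<subseteq> N")
    case True
    have "part G (sg j A * (f j * w (A - {j}))) = sg j A * (F j * w (A - {j}))" if "j \<in> A" for j
    proof -
      have j: "j \<in> N" using that True by auto
      have "keys (w (A - {j})) \<subseteq> (if A - {j} \<subseteq> N then G else {})"
        using w unfolding supp_in_def by blast
      then have wG: "keys (w (A - {j})) \<subseteq> G" by (auto split: if_splits)
      have 1: "keys (part Z (f j) * w (A - {j})) \<subseteq> G"
        using G[OF j] wG by (auto elim!: keys_mult_mem)
      have 2: "keys (part (- Z) (f j) * w (A - {j})) \<inter> G = {}"
        using G[OF j] wG by (auto elim!: keys_mult_mem)
      have "part G (sg j A * (f j * w (A - {j}))) =
          part G (sg j A * (part Z (f j) * w (A - {j}))) + part G (sg j A * (part (-Z) (f j) * w (A - {j})))"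
        by (subst part_compl[of Z "f j", symmetric]) (simp only: part_add distrib_left distrib_right)
      also have "\<dots> = sg j A * (part Z (f j) * w (A - {j}))"
        using 1 2 by (simp add: part_id part_eq_0 sg_mult_keys)
      finally show ?thesis using j by (simp add: F_def)
    qed
    then show ?thesis using True by (simp add: trunc_d_def koszul_d_def part_sum)
  next
    case False
    have "F j * w (A - {j}) = 0" for j
    proof (cases "j \<in> N")
      case True
      then have "\<not> A - {j} \<subseteq> N" using False by auto
      moreover have "keys (w (A - {j})) \<subseteq> (if A - {j} \<subseteq> N then G else {})"
        using w unfolding supp_in_def by blast
      ultimately have "keys (w (A - {j})) = {}" by (simp only: if_False subset_empty)
      then show ?thesis by simp
    qed (simp add: F_def)
    then show ?thesis using False by (simp add: trunc_d_def koszul_d_def part_eq_0)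
  qed
  have "(\<Sum>j\<in>UNIV. F j * g' j) = (\<Sum>j\<in>N. part Z (f j) * g j)"
    by (rule sum.mono_neutral_cong_right) (auto simp: F_def g'_def)
  then have u: "(\<Sum>j\<in>UNIV. F j * g' j) = 1" using unit by simp
  show ?thesis unfolding exact_at_def
  proof (intro allI impI, elim conjE)
    fix w assume w: "supp_in ?Q w" "homog p w" "\<forall>A. trunc_d f ?Q w A = 0"
    let ?e = "koszul_h g' w"
    have "koszul_d F w = (\<lambda>A. 0)" using tr[OF w(1)] w(3) by auto
    then have "koszul_h g' (koszul_d F w) A = 0" for A by (simp add: koszul_h_def)
    then have "koszul_d F ?e A = w A" for A
      using koszul_homotopy[of F g' w A] u by simp
    then have "trunc_d f ?Q ?e A = w A" for A
      using tr[OF supph[OF w(1)]] by simp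
    then show "\<exists>e. supp_in ?Q e \<and> homog (p - 1) e \<and> (\<forall>A. trunc_d f ?Q e A = w A)"
      using supph[OF w(1)] homog_koszul_h[OF w(2)] by blast
  qed
qed

section \<open>Cones over lattices\<close>

definition on_subsets :: "'j set \<Rightarrow> 'v set \<Rightarrow> 'j set \<Rightarrow> 'v set" where
  "on_subsets N S A = (if A \<subseteq> N then S else {})"

text \<open>In U each condition removes a proper hyperplane, leaving a dense open set; the Baire
  theorem intersects countably many of them.\<close>

lemma generic_in_subspace:
  fixes U :: "'v::euclidean_space set"
  assumes U: "subspace U" "w0 \<in> U" "e > 0" and cnt: "countable \<Phi>"
    and nz: "\<And>\<phi>. \<phi> \<in> \<Phi> \<Longrightarrow> \<exists>x\<in>U. \<phi> \<bullet> x \<noteq> 0"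
  obtains w where "w \<in> U" "dist w w0 < e" "\<And>\<phi>. \<phi> \<in> \<Phi> \<Longrightarrow> \<phi> \<bullet> w \<noteq> 0"
proof -
  let ?T = "\<lambda>\<phi>. U \<inter> {x. \<phi> \<bullet> x \<noteq> 0}"
  have op: "openin (top_of_set U) (?T \<phi>)" for \<phi>
    by (intro openin_open_Int open_Collect_neq continuous_intros)
  have dense: "U \<subseteq> closure (?T \<phi>)" if \<phi>: "\<phi> \<in> \<Phi>" for \<phi>
  proof
    fix x assume x: "x \<in> U"
    obtain b where b: "b \<in> U" "\<phi> \<bullet> b \<noteq> 0" using nz[OF \<phi>] by blast
    show "x \<in> closure (?T \<phi>)"
    proof (cases "\<phi> \<bullet> x = 0")
      case False then show ?thesis using x closure_subset[of "?T \<phi>"] by blast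
    next
      case True
      have "(\<lambda>n. x + inverse (real (Suc n)) *\<^sub>R b) \<longlonglongrightarrow> x + 0 *\<^sub>R b"
        by (intro tendsto_intros LIMSEQ_inverse_real_of_nat)
      moreover have "x + inverse (real (Suc n)) *\<^sub>R b \<in> ?T \<phi>" for n
        using x b True U(1) by (auto simp: inner_add_right intro!: subspace_add subspace_scale)
      ultimately show ?thesis unfolding closure_sequential
        by (intro exI[of _ "\<lambda>n. x + inverse (real (Suc n)) *\<^sub>R b"]) simp
    qed
  qed
  have "U \<subseteq> closure (\<Inter> (insert U (?T ` \<Phi>)))"
  proof (rule Baire)
    show "closed U" using U(1) by (rule closed_subspace)
    show "countable (insert U (?T ` \<Phi>))" using cnt by simp
    fix T assume "T \<in> insert U (?T ` \<Phi>)"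
    then show "openin (top_of_set U) T \<and> U \<subseteq> closure T"
      using op dense closure_subset[of U] by auto
  qed
  then have "w0 \<in> closure (\<Inter> (insert U (?T ` \<Phi>)))" using U(2) by blast
  then obtain w where "w \<in> \<Inter> (insert U (?T ` \<Phi>))" "dist w w0 < e"
    unfolding closure_approachable using U(3) by blast
  then have "w \<in> U" "\<And>\<phi>. \<phi> \<in> \<Phi> \<Longrightarrow> \<phi> \<bullet> w \<noteq> 0" by blast+
  then show ?thesis using that \<open>dist w w0 < e\<close> by blast
qed

lemma exact_at_empty: "(\<And>A. Q A = {}) \<Longrightarrow> exact_at f Q p"
  unfolding exact_at_def
proof (intro allI impI, elim conjE)
  fix w :: "('a, 'b) cochain" assume "\<And>A. Q A = {}" "supp_in Q w"
  then have "w A = 0" for A unfolding supp_in_def by simp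
  then show "\<exists>e. supp_in Q e \<and> homog (p - 1) e \<and> (\<forall>A. trunc_d f Q e A = w A)"
    by (intro exI[of _ "\<lambda>A. 0"]) (simp add: supp_in_def homog_def trunc_d_def koszul_d_def)
qed

text \<open>C lists the inward normals of the cone. Their integrality on L makes the possible values
  of a normal discrete, so a moving wall meets points of L at only finitely many times in a bounded
  interval.\<close>

locale lattice_cone =
  fixes f :: "'j::finite \<Rightarrow> ('v::euclidean_space \<Rightarrow>\<^sub>0 complex)"
    and C L :: "'v set" and N :: "'j set"
  assumes finite_C: "finite C"
    and integral: "c \<in> C \<Longrightarrow> m \<in> L \<Longrightarrow> c \<bullet> m \<in> \<int>"
    and f_cone: "v \<in> keys (f j) \<Longrightarrow> c \<in> C \<Longrightarrow> 0 \<le> c \<bullet> v"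
    and f_lattice: "v \<in> keys (f j) \<Longrightarrow> m \<in> L \<Longrightarrow> v + m \<in> L"
begin

text \<open>\<open>Z\<close> encodes the face \<open>{x. (\<forall>c\<in>Z. c \<bullet> x = 0) \<and> (\<forall>c\<in>C. 0 \<le> c \<bullet> x)}\<close>, whose relative interior
  contains the witness.\<close>

definition is_face :: "'v set \<Rightarrow> bool" where
  "is_face Z \<longleftrightarrow> Z \<subseteq> C \<and> (\<exists>w. (\<forall>c\<in>Z. c \<bullet> w = 0) \<and> (\<forall>c\<in>C - Z. 0 < c \<bullet> w))"

text \<open>For \<open>is_face Z\<close> this is the linear span of the face: near the witness the
  inequalities outside Z hold automatically.\<close>

definition face_span :: "'v set \<Rightarrow> 'v set" where
  "face_span Z = {x. \<forall>c\<in>Z. c \<bullet> x = 0}"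

definition group_pts :: "'v set \<Rightarrow> 'v \<Rightarrow> 'v set" where
  "group_pts Z y = {m \<in> L. \<forall>c\<in>Z. c \<bullet> m = c \<bullet> y}"

text \<open>The points of L in the face translated by y. The apex y is an arbitrary real vector, so
  that it can move continuously.\<close>

definition conic_pts :: "'v set \<Rightarrow> 'v \<Rightarrow> 'v set" where
  "conic_pts Z y = {m \<in> group_pts Z y. \<forall>c\<in>C. c \<bullet> y \<le> c \<bullet> m}"

lemma subspace_face_span: "subspace (face_span Z)"
  by (auto simp: subspace_def face_span_def inner_add_right)

text \<open>Monomials of f never decrease a normal in C. A point that has left the coset along some
  c in Z has become too large there and cannot come back; U' collects such points.\<close>

lemma loc_closed_conic: 
  assumes "Z \<subseteq> C"
  shows "loc_closed f (on_subsets N (conic_pts Z y))"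
  unfolding loc_closed_def
proof (intro exI conjI allI)
  let ?U = "\<lambda>A::'j set. {m \<in> L. \<forall>c\<in>C. c \<bullet> y \<le> c \<bullet> m}"
  let ?U' = "\<lambda>A. {m \<in> L. (\<forall>c\<in>C. c \<bullet> y \<le> c \<bullet> m) \<and> (\<not> A \<subseteq> N \<or> (\<exists>c\<in>Z. c \<bullet> y < c \<bullet> m))}"
  have ge: "c \<bullet> m \<le> c \<bullet> (v + m)" if "v \<in> keys (f j)" "c \<in> C" for c v m j
    using f_cone[OF that] by (simp add: inner_add_right)
  show "d_closed f ?U" unfolding d_closed_def
    using ge f_lattice by (auto intro: order_trans)
  show "d_closed f ?U'" unfolding d_closed_def
    using ge f_lattice assms by (auto intro: order_trans) (meson less_le_trans subset_iff)
  fix A show "on_subsets N (conic_pts Z y) A = ?U A - ?U' A"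
    using assms by (auto simp: on_subsets_def conic_pts_def group_pts_def not_less intro!: antisym)
qed

text \<open>A primitive with support in \<open>group_pts Z y\<close> is pushed into \<open>conic_pts Z y\<close> by moving the apex
  from \<open>y - t w\<close> back to \<open>y\<close>. For generic \<open>w\<close> the lattice points crossed at one time \<open>t\<close> lie on a
  single facet of the translated cone, and form a conic set for that facet.\<close>

lemma exact_at_conic_step:
  assumes Z: "is_face Z" and p: "p < int (dim (face_span Z))"
    and G: "exact_at f (on_subsets N (group_pts Z y)) p"
    and IH: "\<And>Z' y q. is_face Z' \<Longrightarrow> Z \<subset> Z' \<Longrightarrow> q < int (dim (face_span Z')) \<Longrightarrow>
        exact_at f (on_subsets N (conic_pts Z' y)) q"
  shows "exact_at f (on_subsets N (conic_pts Z y)) p"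
proof -
  obtain w0 where w0: "\<And>c. c \<in> Z \<Longrightarrow> c \<bullet> w0 = 0" "\<And>c. c \<in> C - Z \<Longrightarrow> 0 < c \<bullet> w0" and ZC: "Z \<subseteq> C"
    using Z unfolding is_face_def by blast
  let ?U = "face_span Z"
  \<comment> \<open>If the walls of c and c' sit at the integral levels a and a' at the same
    positive time, the corresponding covector is orthogonal to w. For generic w it then vanishes on
    all of \<open>face_span Z\<close>, which makes c and c' proportional there. Integrality of a and
    a' keeps the set countable.\<close>
  define \<Phi> where "\<Phi> = {(c \<bullet> y - real_of_int a) *\<^sub>R c' - (c' \<bullet> y - real_of_int a') *\<^sub>R c | c c' a a'. c \<in> C \<and> c' \<in> C}"
  have "\<Phi> = (\<lambda>(c,c',a,a'). (c \<bullet> y - real_of_int a) *\<^sub>R c' - (c' \<bullet> y - real_of_int a') *\<^sub>R c) ` (C \<times> C \<times> UNIV \<times> UNIV)"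
    unfolding \<Phi>_def by (auto simp: image_def)
  moreover have "countable (C \<times> C \<times> (UNIV :: int set) \<times> (UNIV :: int set))"
    using countable_finite[OF finite_C] by (intro countable_SIGMA) auto
  ultimately have "countable \<Phi>" by simp
  then have cnt: "countable {\<phi>\<in>\<Phi>. \<exists>x\<in>?U. \<phi> \<bullet> x \<noteq> 0}" by simp
  have "\<exists>e>0. \<forall>w. dist w w0 < e \<longrightarrow> (\<forall>c\<in>C - Z. 0 < c \<bullet> w)"
  proof -
    have "open (\<Inter>c\<in>C - Z. {w. 0 < c \<bullet> w})"
      using finite_C by (intro open_INT ballI open_Collect_less continuous_intros) auto
    moreover have "w0 \<in> (\<Inter>c\<in>C - Z. {w. 0 < c \<bullet> w})" using w0(2) by auto
    ultimately obtain e where "e > 0" "\<And>w. dist w w0 < e \<Longrightarrow> w \<in> (\<Inter>c\<in>C - Z. {w. 0 < c \<bullet> w})"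
      unfolding open_dist by blast
    then show ?thesis by (intro exI[of _ e]) auto
  qed
  then obtain e where e: "e > 0" "\<And>w c. dist w w0 < e \<Longrightarrow> c \<in> C - Z \<Longrightarrow> 0 < c \<bullet> w" by blast
  have "w0 \<in> ?U" using w0(1) by (simp add: face_span_def)
  then obtain w where w: "w \<in> ?U" "dist w w0 < e"
      and gen: "\<And>\<phi>. \<phi> \<in> {\<phi>\<in>\<Phi>. \<exists>x\<in>?U. \<phi> \<bullet> x \<noteq> 0} \<Longrightarrow> \<phi> \<bullet> w \<noteq> 0"
    using generic_in_subspace[OF subspace_face_span _ e(1) cnt] by blast
  have wZ: "c \<bullet> w = 0" if "c \<in> Z" for c using w(1) that by (simp add: face_span_def)
  have wpos: "0 < c \<bullet> w" if "c \<in> C - Z" for c using e(2) w(2) that by blast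
  \<comment> \<open>Each c outside Z is positive on w, so \<open>Y t\<close> grows with t and
    exhausts the coset.\<close>
  define Y where "Y t = conic_pts Z (y - t *\<^sub>R w)" for t
  have Y: "m \<in> Y t \<longleftrightarrow> m \<in> group_pts Z y \<and> (\<forall>c\<in>C - Z. c \<bullet> y - t * (c \<bullet> w) \<le> c \<bullet> m)" for m t
  proof -
    have "group_pts Z (y - t *\<^sub>R w) = group_pts Z y"
      using wZ by (simp add: group_pts_def inner_diff_right)
    moreover have "(\<forall>c\<in>C. c \<bullet> (y - t *\<^sub>R w) \<le> c \<bullet> m) \<longleftrightarrow> (\<forall>c\<in>C - Z. c \<bullet> y - t * (c \<bullet> w) \<le> c \<bullet> m)"
      if "m \<in> group_pts Z y"
    proof -
      have "c \<bullet> (y - t *\<^sub>R w) \<le> c \<bullet> m" if "c \<in> Z" for c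
        using wZ[OF that] that \<open>m \<in> group_pts Z y\<close> by (simp add: group_pts_def inner_diff_right)
      then show ?thesis by (auto simp: inner_diff_right)
    qed
    ultimately show ?thesis by (auto simp: Y_def conic_pts_def)
  qed
  \<comment> \<open>Times at which some wall is at an integral level. \<open>Y\<close> can jump only
    at such times, though it need not jump at each of them.\<close>
  define K where "K T = {t. 0 < t \<and> t \<le> T \<and> (\<exists>c\<in>C - Z. c \<bullet> y - t * (c \<bullet> w) \<in> \<int>)}" for T
  have finK: "finite (K T)" for T
  proof -
    have "K T \<subseteq> (\<Union>c\<in>C - Z. (\<lambda>a. (c \<bullet> y - real_of_int a) / (c \<bullet> w)) ` {\<lfloor>c \<bullet> y - T * (c \<bullet> w)\<rfloor>..\<lceil>c \<bullet> y\<rceil>})"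
    proof
      fix t assume "t \<in> K T"
      then obtain c where t: "0 < t" "t \<le> T" "c \<in> C - Z" "c \<bullet> y - t * (c \<bullet> w) \<in> \<int>"
        unfolding K_def by blast
      then obtain a where a: "c \<bullet> y - t * (c \<bullet> w) = real_of_int a" by (auto elim: Ints_cases)
      have cw: "0 < c \<bullet> w" using wpos t(3) by blast
      have "real_of_int a \<le> c \<bullet> y" using a t(1) cw by (smt (verit) mult_pos_pos)
      moreover have "c \<bullet> y - T * (c \<bullet> w) \<le> real_of_int a"
        using a t(2) cw by (smt (verit) mult_right_mono)
      ultimately have "a \<in> {\<lfloor>c \<bullet> y - T * (c \<bullet> w)\<rfloor>..\<lceil>c \<bullet> y\<rceil>}" by (simp add: floor_le_iff le_ceiling_iff)
      moreover have "t = (c \<bullet> y - real_of_int a) / (c \<bullet> w)" using a cw by (simp add: field_simps)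
      ultimately show "t \<in> (\<Union>c\<in>C - Z. (\<lambda>a. (c \<bullet> y - real_of_int a) / (c \<bullet> w)) ` {\<lfloor>c \<bullet> y - T * (c \<bullet> w)\<rfloor>..\<lceil>c \<bullet> y\<rceil>})"
        using t(3) by blast
    qed
    then show ?thesis by (rule finite_subset) (use finite_C in auto)
  qed
  \<comment> \<open>The quotient is the time at which the wall of c passes through m.\<close>
  have crit: "(c \<bullet> y - c \<bullet> m) / (c \<bullet> w) \<in> K t"
    if "m \<in> group_pts Z y" "c \<in> C - Z" "c \<bullet> m < c \<bullet> y" "c \<bullet> y - t * (c \<bullet> w) \<le> c \<bullet> m" for m c t
  proof -
    have "c \<bullet> m \<in> \<int>" using that integral by (auto simp: group_pts_def)
    then show ?thesis using that wpos[OF that(2)]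
      by (auto simp: K_def field_simps intro!: bexI[of _ c])
  qed
  have YI: "m \<in> Y s" if m: "m \<in> Y t" and s: "0 \<le> s" "\<And>r. r \<in> K t \<Longrightarrow> r \<le> s" for m s t
    unfolding Y
  proof (intro conjI ballI)
    show g: "m \<in> group_pts Z y" using m by (simp add: Y)
    fix c assume c: "c \<in> C - Z"
    show "c \<bullet> y - s * (c \<bullet> w) \<le> c \<bullet> m"
    proof (cases "c \<bullet> m < c \<bullet> y")
      case True
      then have "(c \<bullet> y - c \<bullet> m) / (c \<bullet> w) \<le> s" using crit[OF g c True] m c s(2) by (simp add: Y)
      then show ?thesis using wpos[OF c] by (simp add: field_simps)
    next
      case False
      then show ?thesis using wpos[OF c] s(1) by (smt (verit) mult_nonneg_nonneg)
    qed
  qed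
  have Ymono: "Y s \<subseteq> Y t" if "s \<le> t" for s t
  proof
    fix m assume m: "m \<in> Y s"
    have "c \<bullet> y - t * (c \<bullet> w) \<le> c \<bullet> y - s * (c \<bullet> w)" if "c \<in> C - Z" for c
      using wpos[OF that] \<open>s \<le> t\<close> by (simp add: mult_right_mono)
    then show "m \<in> Y t" using m unfolding Y by (meson order_trans)
  qed
  have sub: "v + m \<in> Y t" if "v \<in> keys (f j)" "m \<in> Y t" "v + m \<in> group_pts Z y" for v m j t
  proof -
    have "c \<bullet> m \<le> c \<bullet> (v + m)" if "c \<in> C" for c
      using f_cone[OF \<open>v \<in> keys (f j)\<close> that] by (simp add: inner_add_right)
    then show ?thesis using that unfolding Y by (meson DiffD1 order_trans)
  qed
  \<comment> \<open>The points entering at time s. They are the conic set, with the apex of time s,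
    of the normals active at any one of them: by \<open>proportional\<close>, all walls hit at that
    time agree on the span.\<close>
  have level: "exact_at f (on_subsets N {m \<in> Y s. \<exists>c\<in>C - Z. c \<bullet> m = c \<bullet> y - s * (c \<bullet> w)}) (p - 1)"
    if s: "s > 0" for s
  proof (cases "{m \<in> Y s. \<exists>c\<in>C - Z. c \<bullet> m = c \<bullet> y - s * (c \<bullet> w)} = {}")
    case True
    then show ?thesis by (intro exact_at_empty) (simp add: on_subsets_def)
  next
    case False
    let ?Q = "{m \<in> Y s. \<exists>c\<in>C - Z. c \<bullet> m = c \<bullet> y - s * (c \<bullet> w)}"
    obtain m0 c0 where m0: "m0 \<in> Y s" "c0 \<in> C - Z" "c0 \<bullet> m0 = c0 \<bullet> y - s * (c0 \<bullet> w)"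
      using False by blast
    let ?y = "y - s *\<^sub>R w"
    define Z' where "Z' = {c \<in> C. c \<bullet> m0 = c \<bullet> ?y}"
    have m0G: "m0 \<in> group_pts Z y" using m0(1) by (simp add: Y)
    have proportional: "(c \<bullet> w) * (c' \<bullet> x) = (c' \<bullet> w) * (c \<bullet> x)"
      if "m \<in> Y s" "c \<in> C - Z" "c \<bullet> m = c \<bullet> y - s * (c \<bullet> w)"
        "m' \<in> Y s" "c' \<in> C - Z" "c' \<bullet> m' = c' \<bullet> y - s * (c' \<bullet> w)" "x \<in> ?U" for m m' c c' x
    proof -
      have "m \<in> L" "m' \<in> L" using that by (auto simp: Y group_pts_def)
      then have "c \<bullet> m \<in> \<int>" "c' \<bullet> m' \<in> \<int>" using that integral by blast+
      then obtain a a' where a: "c \<bullet> m = real_of_int a" "c' \<bullet> m' = real_of_int a'"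
        by (auto elim!: Ints_cases)
      let ?\<phi> = "(c \<bullet> y - real_of_int a) *\<^sub>R c' - (c' \<bullet> y - real_of_int a') *\<^sub>R c"
      have mem: "?\<phi> \<in> \<Phi>" unfolding \<Phi>_def using that by blast
      have eq: "?\<phi> \<bullet> z = s * ((c \<bullet> w) * (c' \<bullet> z) - (c' \<bullet> w) * (c \<bullet> z))" for z
      proof -
        have "c \<bullet> y - real_of_int a = s * (c \<bullet> w)" "c' \<bullet> y - real_of_int a' = s * (c' \<bullet> w)"
          using that a by linarith+
        then show ?thesis by (simp only: inner_diff_left inner_scaleR_left right_diff_distrib mult.assoc)
      qed
      have "?\<phi> \<bullet> w = 0" unfolding eq by simp
      then have "?\<phi> \<bullet> x = 0" using gen mem that(7) by blast
      then show ?thesis unfolding eq using s by simp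
    qed
    have yU: "m - ?y \<in> ?U" if "m \<in> group_pts Z y" for m
      using that wZ by (simp add: face_span_def group_pts_def inner_diff_right)
    have ZZ': "Z \<subseteq> Z'" using m0G ZC wZ by (auto simp: Z'_def group_pts_def inner_diff_right)
    have c0: "c0 \<in> Z'" using m0 by (simp add: Z'_def inner_diff_right)
    have act: "c \<bullet> m0 = c \<bullet> y - s * (c \<bullet> w)" if "c \<in> Z'" for c
      using that by (simp add: Z'_def inner_diff_right)
    \<comment> \<open>The vector from the apex to the lattice point m0 is itself a witness in the
      relative interior of the new face.\<close>
    have face: "is_face Z'" unfolding is_face_def
    proof (intro conjI exI[of _ "m0 - ?y"] ballI)
      show "Z' \<subseteq> C" by (auto simp: Z'_def)
      show "c \<bullet> (m0 - ?y) = 0" if "c \<in> Z'" for c using that by (simp add: Z'_def inner_diff_right)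
      show "0 < c \<bullet> (m0 - ?y)" if "c \<in> C - Z'" for c
      proof -
        have "c \<in> C - Z" using that ZZ' by auto
        then have "c \<bullet> ?y \<le> c \<bullet> m0" using m0(1) by (simp add: Y inner_diff_right)
        moreover have "c \<bullet> ?y \<noteq> c \<bullet> m0" using that by (auto simp: Z'_def)
        ultimately show ?thesis by (simp add: inner_diff_right)
      qed
    qed
    have Qeq: "?Q = conic_pts Z' ?y"
    proof (intro set_eqI iffI)
      fix m assume "m \<in> ?Q"
      then obtain c where m: "m \<in> Y s" "c \<in> C - Z" "c \<bullet> m = c \<bullet> y - s * (c \<bullet> w)" by blast
      have mG: "m \<in> group_pts Z y" using m by (simp add: Y)
      have "c' \<bullet> m = c' \<bullet> ?y" if c': "c' \<in> Z'" for c'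
      proof (cases "c' \<in> Z")
        case True then show ?thesis using mG wZ by (simp add: group_pts_def inner_diff_right)
      next
        case False
        then have "c' \<in> C - Z" using c' by (auto simp: Z'_def)
        then have "(c \<bullet> w) * (c' \<bullet> (m - ?y)) = (c' \<bullet> w) * (c \<bullet> (m - ?y))"
          using proportional[OF m m0(1) _ act[OF c'] yU[OF mG]] by blast
        also have "c \<bullet> (m - ?y) = 0" using m(3) by (simp add: inner_diff_right)
        finally have "c' \<bullet> (m - ?y) = 0" using wpos[OF m(2)] by simp
        then show ?thesis by (simp add: inner_diff_right)
      qed
      then show "m \<in> conic_pts Z' ?y"
        using m(1) unfolding Y_def conic_pts_def group_pts_def by blast
    next
      fix m assume m: "m \<in> conic_pts Z' ?y"
      then have "m \<in> Y s" using ZZ' unfolding Y_def conic_pts_def group_pts_def by blast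
      moreover have "c0 \<bullet> m = c0 \<bullet> y - s * (c0 \<bullet> w)"
        using m c0 by (auto simp: conic_pts_def group_pts_def inner_diff_right)
      ultimately show "m \<in> ?Q" using m0(2) by blast
    qed
    \<comment> \<open>All normals in Z' are multiples of c0 on the span, so subtracting a multiple
      of w from x achieves all new equations at once. The dimension drops by at most one, which
      matches the drop from p to p - 1.\<close>
    have "?U \<subseteq> span (insert w (face_span Z'))"
    proof
      fix x assume x: "x \<in> ?U"
      define x' where "x' = x - ((c0 \<bullet> x) / (c0 \<bullet> w)) *\<^sub>R w"
      have cw0: "0 < c0 \<bullet> w" using wpos m0(2) by blast
      have "c \<bullet> x' = 0" if c: "c \<in> Z'" for c
      proof (cases "c \<in> Z")
        case True then show ?thesis using x wZ by (simp add: x'_def face_span_def inner_diff_right)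
      next
        case False
        then have "c \<in> C - Z" using c by (auto simp: Z'_def)
        then have "(c \<bullet> w) * (c0 \<bullet> x) = (c0 \<bullet> w) * (c \<bullet> x)"
          using proportional[OF m0(1) _ act[OF c] m0 x] by blast
        then show ?thesis using cw0 by (simp add: x'_def inner_diff_right field_simps)
      qed
      then have "x' \<in> face_span Z'" by (simp add: face_span_def)
      then have "x' + ((c0 \<bullet> x) / (c0 \<bullet> w)) *\<^sub>R w \<in> span (insert w (face_span Z'))"
        by (intro span_add span_scale span_base) auto
      then show "x \<in> span (insert w (face_span Z'))" by (simp add: x'_def)
    qed
    then have "dim ?U \<le> dim (insert w (face_span Z'))" by (rule dim_subset[THEN order_trans]) (simp add: dim_span)
    also have "\<dots> \<le> dim (face_span Z') + 1" by (simp add: dim_insert)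
    finally have "p - 1 < int (dim (face_span Z'))" using p by linarith
    moreover have "Z \<subset> Z'" using ZZ' c0 m0(2) by auto
    ultimately show ?thesis unfolding Qeq using IH[OF face] by blast
  qed
  \<comment> \<open>The apex is moved back across one critical time after another; the measure is
    the number of critical times still ahead.\<close>
  have main: "\<exists>e'. supp_in (on_subsets N (Y 0)) e' \<and> homog (p - 1) e' \<and> (\<forall>A. trunc_d f (on_subsets N (Y 0)) e' A = u A)"
    if "0 \<le> t" "supp_in (on_subsets N (Y t)) e" "homog (p - 1) e" "\<And>A. trunc_d f (on_subsets N (Y t)) e A = u A"
      "supp_in (on_subsets N (Y 0)) u" for t e u
    using that
  proof (induction "card (K t)" arbitrary: t e rule: less_induct)
    case less
    show ?case
    proof (cases "K t = {}")
      case True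
      then have "Y t = Y 0" using YI[of _ t 0] Ymono[of 0 t] less.prems(1) by auto
      then show ?thesis using less.prems by auto
    next
      case False
      define s where "s = Max (K t)"
      have sK: "s \<in> K t" unfolding s_def using False finK by (intro Max_in)
      have s_ge: "r \<le> s" if "r \<in> K t" for r unfolding s_def using finK that by simp
      have s0: "0 < s" "s \<le> t" using sK by (auto simp: K_def)
      have Yts: "Y t = Y s" using YI[of _ t s] s_ge s0 Ymono[of s t] by auto
      \<comment> \<open>The previous critical time, or 0 when there is none.\<close>
      define s' where "s' = Max (insert 0 (K t - {s}))"
      have s'in: "s' \<in> insert 0 (K t - {s})" unfolding s'_def using finK by (intro Max_in) auto
      have s'ge: "r \<le> s'" if "r \<in> insert 0 (K t - {s})" for r unfolding s'_def using finK that by simp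
      have s's: "0 \<le> s'" "s' < s"
        using s'ge[of 0] s'in s_ge s0 by (auto simp: less_le)
      let ?Q = "{m \<in> Y s. \<exists>c\<in>C - Z. c \<bullet> m = c \<bullet> y - s * (c \<bullet> w)}"
      have 1: "Y s = Y s' \<union> ?Q"
      proof (intro set_eqI iffI)
        fix m assume m: "m \<in> Y s"
        show "m \<in> Y s' \<union> ?Q"
        proof (rule ccontr)
          assume n: "m \<notin> Y s' \<union> ?Q"
          have mG: "m \<in> group_pts Z y" using m by (simp add: Y)
          obtain c where c: "c \<in> C - Z" "c \<bullet> m < c \<bullet> y - s' * (c \<bullet> w)"
            using n mG by (auto simp: Y not_le)
          have lt: "c \<bullet> m < c \<bullet> y" using c wpos[OF c(1)] s's by (smt (verit) mult_nonneg_nonneg)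
          let ?r = "(c \<bullet> y - c \<bullet> m) / (c \<bullet> w)"
          have "m \<in> Y t" using m Yts by simp
          then have "?r \<in> K t" using crit[OF mG c(1) lt] c(1) by (simp add: Y)
          moreover have "?r \<noteq> s"
          proof
            assume "?r = s"
            then have "c \<bullet> m = c \<bullet> y - s * (c \<bullet> w)" using wpos[OF c(1)] by (auto simp: field_simps)
            then show False using n m c(1) by blast
          qed
          ultimately have "?r \<le> s'" using s'ge by blast
          then show False using c wpos[OF c(1)] by (simp add: field_simps)
        qed
      qed (use Ymono[of s' s] s's in auto)
      have 2: "Y s' \<inter> ?Q = {}"
      proof -
        have "c \<bullet> y - s * (c \<bullet> w) < c \<bullet> m" if "m \<in> Y s'" "c \<in> C - Z" for m c
        proof -
          have "s' * (c \<bullet> w) < s * (c \<bullet> w)" using wpos[OF that(2)] s's by simp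
          moreover have "c \<bullet> y - s' * (c \<bullet> w) \<le> c \<bullet> m" using that by (simp add: Y)
          ultimately show ?thesis by linarith
        qed
        then show ?thesis by fastforce
      qed
      have "card (K s') < card (K t)"
      proof (rule psubset_card_mono[OF finK])
        have "K s' \<subseteq> K t" using s's s0 by (auto simp: K_def)
        moreover have "s \<notin> K s'" using s's by (simp add: K_def)
        ultimately show "K s' \<subset> K t" using sK by blast
      qed
      moreover obtain e' where "supp_in (on_subsets N (Y s')) e'" "homog (p - 1) e'"
        "\<And>A. trunc_d f (on_subsets N (Y s')) e' A = trunc_d f (on_subsets N (Y s)) e A"
      proof (rule push_down[where f = f and Q = "on_subsets N (Y s)" and ?Q1.0 = "on_subsets N (Y s')"
            and ?Q2.0 = "on_subsets N ?Q" and p = "p - 1" and e = e])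
        show "loc_closed f (on_subsets N (Y s))" unfolding Y_def by (rule loc_closed_conic[OF ZC])
        show "on_subsets N (Y s) A = on_subsets N (Y s') A \<union> on_subsets N ?Q A" for A
          using 1 by (simp add: on_subsets_def)
        show "on_subsets N (Y s') A \<inter> on_subsets N ?Q A = {}" for A
          using 2 by (simp add: on_subsets_def)
        show "v + m \<in> on_subsets N (Y s') (insert j A)"
          if "j \<notin> A" "v \<in> keys (f j)" "m \<in> on_subsets N (Y s') A" "v + m \<in> on_subsets N (Y s) (insert j A)" for A j v m
          using that sub[of v j m s'] by (auto simp: on_subsets_def Y split: if_splits)
        show "exact_at f (on_subsets N ?Q) (p - 1)" by (rule level[OF s0(1)])
        show "supp_in (on_subsets N (Y s)) e" using less.prems(2) Yts by simp
        show "homog (p - 1) e" by (rule less.prems(3))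
        have "trunc_d f (on_subsets N (Y s)) e = u" using less.prems(4) Yts by auto
        moreover have "on_subsets N (Y 0) A \<subseteq> on_subsets N (Y s') A" for A
          using Ymono[OF s's(1)] by (auto simp: on_subsets_def)
        ultimately show "supp_in (on_subsets N (Y s')) (trunc_d f (on_subsets N (Y s)) e)"
          using less.prems(5) unfolding supp_in_def by blast
      qed auto
      ultimately show ?thesis
        using less.hyps[of s' e'] s's less.prems(4,5) Yts by auto
    qed
  qed
  have Y0: "Y 0 = conic_pts Z y" by (simp add: Y_def)
  show ?thesis unfolding exact_at_def
  proof (intro allI impI, elim conjE)
    fix u assume u: "supp_in (on_subsets N (conic_pts Z y)) u" "homog p u"
      "\<forall>A. trunc_d f (on_subsets N (conic_pts Z y)) u A = 0"
    have YG: "on_subsets N (Y t) A \<subseteq> on_subsets N (group_pts Z y) A" for t A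
      by (auto simp: on_subsets_def Y)
    have subG: "v + m \<in> on_subsets N (Y t) (insert j A)"
      if "j \<notin> A" "v \<in> keys (f j)" "m \<in> on_subsets N (Y t) A" "v + m \<in> on_subsets N (group_pts Z y) (insert j A)" for A j v m t
      using that sub[of v j m t] by (auto simp: on_subsets_def split: if_splits)
    have tr: "trunc_d f (on_subsets N (group_pts Z y)) v A = trunc_d f (on_subsets N (Y t)) v A"
      if "supp_in (on_subsets N (Y t)) v" for v A t
      using subG YG that by (rule trunc_d_sub)
    have uG: "supp_in (on_subsets N (group_pts Z y)) u" using u(1) YG[of 0] unfolding Y0 supp_in_def by blast
    moreover have "trunc_d f (on_subsets N (group_pts Z y)) u A = 0" for A
      using tr[of 0 u A] u(1,3) by (simp add: Y0)
    ultimately obtain e where e: "supp_in (on_subsets N (group_pts Z y)) e" "homog (p - 1) e"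
        "\<And>A. trunc_d f (on_subsets N (group_pts Z y)) e A = u A"
      using exact_atD[OF G _ u(2)] by blast
    define M where "M = (\<Union>A. keys (e A))"
    have "finite M" unfolding M_def by (intro finite_UN_I) auto
    \<comment> \<open>By this time the growing cone contains the finite support of the primitive e.
      The inserted 0 keeps the time nonnegative.\<close>
    define T where "T = Max (insert 0 ((\<lambda>(m,c). (c \<bullet> y - c \<bullet> m) / (c \<bullet> w)) ` (M \<times> (C - Z))))"
    have fin: "finite (insert 0 ((\<lambda>(m,c). (c \<bullet> y - c \<bullet> m) / (c \<bullet> w)) ` (M \<times> (C - Z))))"
      using \<open>finite M\<close> finite_C by auto
    have T0: "0 \<le> T" unfolding T_def using fin by (intro Max_ge) auto
    have eY: "supp_in (on_subsets N (Y T)) e" unfolding supp_in_def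
    proof (intro allI subsetI)
      fix A m assume m: "m \<in> keys (e A)"
      then have mG: "m \<in> on_subsets N (group_pts Z y) A" using e(1) by (auto simp: supp_in_def)
      have "c \<bullet> y - T * (c \<bullet> w) \<le> c \<bullet> m" if c: "c \<in> C - Z" for c
      proof -
        have "m \<in> M" using m by (auto simp: M_def)
        then have "(c \<bullet> y - c \<bullet> m) / (c \<bullet> w) \<le> T" unfolding T_def
          using fin c by (intro Max_ge) (auto intro!: image_eqI[of _ _ "(m,c)"])
        then show ?thesis using wpos[OF c] by (simp add: field_simps)
      qed
      then show "m \<in> on_subsets N (Y T) A" using mG by (auto simp: on_subsets_def Y split: if_splits)
    qed
    have "trunc_d f (on_subsets N (Y T)) e A = u A" for A
      using tr[OF eY] e(3) by simp
    then show "\<exists>e. supp_in (on_subsets N (conic_pts Z y)) e \<and> homog (p - 1) e \<and>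
        (\<forall>A. trunc_d f (on_subsets N (conic_pts Z y)) e A = u A)"
      using main[OF T0 eY e(2), of u] u(1) unfolding Y0 by blast
  qed
qed

text \<open>Enlarging Z shrinks the face, so the recursion over faces ends. Dimension 0 is excluded
  from the hypothesis on groups, where exactness would fail; there p < 0 and the claim is void. In
  positive dimension the group supplies the primitive that the sweep pushes down.\<close>

theorem exact_at_conic:
  assumes G: "\<And>Z y p. is_face Z \<Longrightarrow> Z0 \<subseteq> Z \<Longrightarrow> 0 < dim (face_span Z) \<Longrightarrow>
      exact_at f (on_subsets N (group_pts Z y)) p"
    and "is_face Z" "Z0 \<subseteq> Z" "p < int (dim (face_span Z))"
  shows "exact_at f (on_subsets N (conic_pts Z y)) p"
  using assms(2-)
proof (induction "card (C - Z)" arbitrary: Z y p rule: less_induct)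
  case less
  show ?case
  proof (cases "0 \<le> p")
    case True
    show ?thesis
    proof (rule exact_at_conic_step[OF less.prems(1,3)])
      show "exact_at f (on_subsets N (group_pts Z y)) p"
        using less.prems True by (intro G) auto
      fix Z' y q assume Z': "is_face Z'" "Z \<subset> Z'" "q < int (dim (face_span Z'))"
      then have "C - Z' \<subset> C - Z" unfolding is_face_def by blast
      then have "card (C - Z') < card (C - Z)" using finite_C by (intro psubset_card_mono) auto
      then show "exact_at f (on_subsets N (conic_pts Z' y)) q" using less Z' by auto
    qed
  qed (auto intro: exact_at_neg)
qed

end

section \<open>The Nullstellensatz for Laurent polynomials\<close>

abbreviation scal :: "complex \<Rightarrow> ('v::comm_monoid_add \<Rightarrow>\<^sub>0 complex)" where
  "scal c \<equiv> Poly_Mapping.single 0 c"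

lemma lookup_scal_mult [simp]: "lookup (scal c * g) m = c * lookup g m"
  by (simp add: mult_map_scale_conv_mult[symmetric] map.rep_eq when_def)

interpretation pm: vector_space "\<lambda>c (g :: 'v::comm_monoid_add \<Rightarrow>\<^sub>0 complex). scal c * g"
  by standard (rule poly_mapping_eqI, simp add: lookup_add distrib_left distrib_right)+

lemma scal_mult: "scal a * scal b = (scal (a * b) :: 'v::comm_monoid_add \<Rightarrow>\<^sub>0 complex)"
  by (simp add: mult_single)

lemma scal_inverse: "a \<noteq> 0 \<Longrightarrow> scal a * scal (inverse a) = (1 :: 'v::comm_monoid_add \<Rightarrow>\<^sub>0 complex)"
  by (simp add: mult_single)

lemma poly_mapping_expansion: "g = (\<Sum>m\<in>keys g. scal (lookup g m) * Poly_Mapping.single m (1::complex))"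
proof (rule poly_mapping_eqI)
  fix k
  show "lookup g k = lookup (\<Sum>m\<in>keys g. scal (lookup g m) * Poly_Mapping.single m 1) k"
    by (simp add: lookup_sum lookup_single when_def in_keys_iff if_distrib cong: if_cong)
qed

lemma in_span_singles:
  assumes "keys (g :: 'v::comm_monoid_add \<Rightarrow>\<^sub>0 complex) \<subseteq> K"
  shows "g \<in> pm.span ((\<lambda>m. Poly_Mapping.single m 1) ` K)"
  by (subst poly_mapping_expansion, intro pm.span_sum pm.span_scale pm.span_base) (use assms in auto)

lemma dependent_if_few_keys:
  assumes "finite K" "finite S" "card K < card S" "\<And>s. s \<in> S \<Longrightarrow> keys (s :: 'v::comm_monoid_add \<Rightarrow>\<^sub>0 complex) \<subseteq> K"
  shows "pm.dependent S"
proof (rule ccontr)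
  assume "\<not> pm.dependent S"
  moreover have "S \<subseteq> pm.span ((\<lambda>m. Poly_Mapping.single m 1) ` K)"
    using assms(4) in_span_singles by blast
  ultimately have "card S \<le> card ((\<lambda>m. Poly_Mapping.single m (1::complex)) ` K)"
    using pm.independent_span_bound assms(1) by blast
  also have "\<dots> \<le> card K" by (rule card_image_le[OF assms(1)])
  finally show False using assms(3) by simp
qed

section \<open>Ideals and points by counting dimensions\<close>

definition ring_eval :: "('v::comm_monoid_add \<Rightarrow>\<^sub>0 complex) \<Rightarrow> complex poly \<Rightarrow> ('v \<Rightarrow>\<^sub>0 complex)" where
  "ring_eval x p = poly (map_poly scal p) x"

lemma ring_eval_0 [simp]: "ring_eval x 0 = 0"
  by (simp add: ring_eval_def)

lemma ring_eval_pCons [simp]: "ring_eval x (pCons a p) = scal a + x * ring_eval x p"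
  by (simp add: ring_eval_def map_poly_pCons)

lemma ring_eval_add [simp]: "ring_eval x (p + q) = ring_eval x p + ring_eval x q"
proof (induction p arbitrary: q)
  case (pCons a p)
  obtain b r where q: "q = pCons b r" by (cases q)
  show ?case unfolding q by (simp only: add_pCons ring_eval_pCons pCons.IH single_add distrib_left add_ac)
qed simp

lemma ring_eval_smult [simp]: "ring_eval x (smult a p) = scal a * ring_eval x p"
  by (induction p) (simp_all add: scal_mult algebra_simps)

lemma ring_eval_mult [simp]: "ring_eval x (p * q) = ring_eval x p * ring_eval x q"
  by (induction p) (simp_all add: algebra_simps)

lemma ring_eval_sum: "ring_eval x (\<Sum>i\<in>I. p i) = (\<Sum>i\<in>I. ring_eval x (p i))"
  by (induction I rule: infinite_finite_induct) simp_all

lemma ring_eval_prod: "ring_eval x (\<Prod>i\<in>I. p i) = (\<Prod>i\<in>I. ring_eval x (p i))"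
  by (induction I rule: infinite_finite_induct) (simp_all add: one_pCons)

text \<open>Countability of L bounds the dimension of the ring, to be played against the uncountable
  field.\<close>

locale group_ring =
  fixes L :: "'v::ab_group_add set"
  assumes countable_L: "countable L"
    and L_zero: "0 \<in> L" and L_add: "m \<in> L \<Longrightarrow> m' \<in> L \<Longrightarrow> m + m' \<in> L" and L_uminus: "m \<in> L \<Longrightarrow> - m \<in> L"
begin

definition R :: "('v \<Rightarrow>\<^sub>0 complex) set" where
  "R = {g. keys g \<subseteq> L}"

definition is_ideal :: "('v \<Rightarrow>\<^sub>0 complex) set \<Rightarrow> bool" where
  "is_ideal I \<longleftrightarrow> 0 \<in> I \<and> (\<forall>g\<in>I. \<forall>h\<in>I. g + h \<in> I) \<and> (\<forall>r\<in>R. \<forall>g\<in>I. r * g \<in> I)"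

lemma R_add: "g \<in> R \<Longrightarrow> h \<in> R \<Longrightarrow> g + h \<in> R"
  unfolding R_def by (simp add: keys_add_subset)

lemma R_scal [simp]: "scal c \<in> R"
  using L_zero by (simp add: R_def)

lemma R_diff: "g \<in> R \<Longrightarrow> h \<in> R \<Longrightarrow> g - h \<in> R"
  unfolding R_def by (simp add: keys_diff_subset)

lemma R_mult: "g \<in> R \<Longrightarrow> h \<in> R \<Longrightarrow> g * h \<in> R"
  unfolding R_def using L_add by (auto elim!: keys_mult_mem)

lemma R_single: "m \<in> L \<Longrightarrow> Poly_Mapping.single m c \<in> R"
  by (simp add: R_def)

lemma R_one [simp]: "1 \<in> R"
  using R_scal[of 1] by simp

lemma R_zero [simp]: "0 \<in> R"
  by (simp add: R_def)

lemma R_prod: "(\<And>i. i \<in> I \<Longrightarrow> g i \<in> R) \<Longrightarrow> (\<Prod>i\<in>I. g i) \<in> R"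
  by (induction I rule: infinite_finite_induct) (auto intro: R_mult)

lemma R_ring_eval: "x \<in> R \<Longrightarrow> ring_eval x p \<in> R"
  by (induction p) (auto intro: R_add R_mult)

lemma idealD:
  assumes "is_ideal I"
  shows "0 \<in> I" "g \<in> I \<Longrightarrow> h \<in> I \<Longrightarrow> g + h \<in> I" "r \<in> R \<Longrightarrow> g \<in> I \<Longrightarrow> r * g \<in> I"
    "g \<in> I \<Longrightarrow> h \<in> I \<Longrightarrow> g - h \<in> I"
proof -
  show "0 \<in> I" using assms unfolding is_ideal_def by blast
  show add: "g + h \<in> I" if "g \<in> I" "h \<in> I" for g h
    using assms that unfolding is_ideal_def by blast
  show mult: "r * g \<in> I" if "r \<in> R" "g \<in> I" for r g
    using assms that unfolding is_ideal_def by blast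
  show "g - h \<in> I" if "g \<in> I" "h \<in> I" for g h
  proof -
    have "g + scal (- 1) * h \<in> I" using that by (intro add mult) auto
    also have "g + scal (- 1) * h = g - h" by (rule poly_mapping_eqI) (simp add: lookup_add lookup_minus)
    finally show ?thesis .
  qed
qed

lemma ideal_sum:
  assumes "is_ideal I"
  shows "(\<And>i. i \<in> K \<Longrightarrow> g i \<in> I) \<Longrightarrow> (\<Sum>i\<in>K. g i) \<in> I"
  by (induction K rule: infinite_finite_induct) (auto intro: idealD[OF assms])

text \<open>If every \<open>x - a\<close> were invertible modulo \<open>I\<close>, then uncountably many inverses would live in a
  ring of countable dimension; a linear relation between them is a nonzero polynomial in \<open>x\<close>
  lying in \<open>I\<close>, although all its linear factors are invertible.\<close>

lemma exists_proper_extension: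
  assumes I: "is_ideal I" "1 \<notin> I" and x: "x \<in> R"
  obtains a where "1 \<notin> {g + r * (x - scal a) | g r. g \<in> I \<and> r \<in> R}"
proof (rule ccontr)
  assume "\<not> thesis"
  then have "\<forall>a. \<exists>r. r \<in> R \<and> 1 - r * (x - scal a) \<in> I"
    using that by (smt (verit, best) add_diff_cancel_right' mem_Collect_eq)
  then obtain r where r: "\<And>a. r a \<in> R" "\<And>a. 1 - r a * (x - scal a) \<in> I" by metis
  \<comment> \<open>Linear factors can be cancelled one by one, being invertible modulo I; a nonzero
    constant in I would remain.\<close>
  have no_root: False if "p \<noteq> 0" "ring_eval x p \<in> I" for p
    using that
  proof (induction "degree p" arbitrary: p)
    case 0
    then obtain c where c: "p = [:c:]" by (metis degree_0_id)
    then have "scal (inverse c) * scal c \<in> I" using 0 by (intro idealD[OF I(1)]) auto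
    moreover have "scal c * scal (inverse c) = (1 :: 'v \<Rightarrow>\<^sub>0 complex)" using c 0 by (intro scal_inverse) auto
    ultimately show False using I(2) by (metis mult.commute)
  next
    case (Suc n)
    then have "\<not> constant (poly p)" by (simp add: constant_degree)
    then obtain a where "poly p a = 0" using fundamental_theorem_of_algebra by blast
    then obtain q where q: "p = [:- a, 1:] * q" by (metis dvdE poly_eq_0_iff_dvd)
    have q0: "q \<noteq> 0" using q Suc.prems by auto
    then have "degree p = Suc (degree q)" unfolding q by (subst degree_mult_eq) auto
    then have dq: "n = degree q" using Suc by simp
    have "ring_eval x p = (x - scal a) * ring_eval x q"
      unfolding q ring_eval_mult by (simp add: single_uminus)
    then have "r a * ((x - scal a) * ring_eval x q) \<in> I"
      using idealD(3)[OF I(1) r(1) Suc.prems(2)] by simp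
    moreover have "ring_eval x q * (1 - r a * (x - scal a)) \<in> I"
      using r(2) R_ring_eval[OF x] by (intro idealD(3)[OF I(1)])
    ultimately have "r a * ((x - scal a) * ring_eval x q) + ring_eval x q * (1 - r a * (x - scal a)) \<in> I"
      by (rule idealD(2)[OF I(1)])
    then have "ring_eval x q \<in> I" by (simp add: algebra_simps)
    then show False using Suc.hyps(1)[OF dq q0] by blast
  qed
  \<comment> \<open>A common inverse r of x - a and x - b gives r (a - b) in I, hence r in I and
    then 1 in I.\<close>
  have "inj r"
  proof (rule injI, rule ccontr)
    fix a b assume ab: "r a = r b" "a \<noteq> b"
    have "(1 - r a * (x - scal a)) - (1 - r b * (x - scal b)) \<in> I"
      by (rule idealD(4)[OF I(1) r(2) r(2)])
    also have "(1 - r a * (x - scal a)) - (1 - r b * (x - scal b)) = r a * scal (a - b)"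
      using ab by (simp add: single_diff algebra_simps)
    finally have "r a * scal (a - b) \<in> I" .
    moreover have "scal (inverse (a - b)) * (x - scal a) \<in> R"
      using x by (intro R_mult R_diff) auto
    ultimately have "(scal (inverse (a - b)) * (x - scal a)) * (r a * scal (a - b)) \<in> I"
      by (rule idealD(3)[OF I(1), rotated])
    also have "(scal (inverse (a - b)) * (x - scal a)) * (r a * scal (a - b)) = r a * (x - scal a) * (scal (a - b) * scal (inverse (a - b)))"
      by (simp add: mult_ac)
    also have "scal (a - b) * scal (inverse (a - b)) = (1 :: 'v \<Rightarrow>\<^sub>0 complex)"
      using ab by (intro scal_inverse) simp
    also have "r a * (x - scal a) * 1 = r a * (x - scal a)" by simp
    finally have "(1 - r a * (x - scal a)) + r a * (x - scal a) \<in> I"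
      by (rule idealD(2)[OF I(1) r(2)])
    then show False using I(2) by simp
  qed
  \<comment> \<open>The finite subsets of L are countably many, so some K is the support of inverses
    for uncountably many a. Any \<open>card K + 1\<close> of these are linearly dependent.\<close>
  have "countable {K. finite K \<and> K \<subseteq> L}"
    using countable_L by (rule countable_Collect_finite_subset)
  moreover have "UNIV = (\<Union>K\<in>{K. finite K \<and> K \<subseteq> L}. {a. keys (r a) = K})"
    using r(1) by (auto simp: R_def)
  ultimately have "\<exists>K\<in>{K. finite K \<and> K \<subseteq> L}. uncountable {a. keys (r a) = K}"
    using uncountable_UNIV_complex by (metis (no_types, lifting) countable_UN)
  then obtain K where K: "finite K" "uncountable {a. keys (r a) = K}" by blast
  then have "infinite {a. keys (r a) = K}" using countable_finite by blast
  then obtain S where S: "finite S" "card S = Suc (card K)" "S \<subseteq> {a. keys (r a) = K}"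
    by (metis infinite_arbitrarily_large)
  have "card (r ` S) = Suc (card K)" using S \<open>inj r\<close> by (simp add: card_image inj_on_subset)
  then have "pm.dependent (r ` S)" using K(1) S by (intro dependent_if_few_keys[of K]) auto
  then obtain u where u: "\<exists>v\<in>r ` S. u v \<noteq> 0" "(\<Sum>v\<in>r ` S. scal (u v) * v) = 0"
    using pm.dependent_finite[of "r ` S"] S(1) by blast
  define c where "c a = u (r a)" for a
  have c: "(\<Sum>a\<in>S. scal (c a) * r a) = 0"
    using u(2) \<open>inj r\<close> by (simp add: sum.reindex inj_on_subset c_def)
  obtain a0 where a0: "a0 \<in> S" "c a0 \<noteq> 0" using u(1) by (auto simp: c_def)
  \<comment> \<open>The numerator of the sum of c_a / (x - a) over the common denominator. At a0
    only the term of a0 survives, so p is not zero.\<close>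
  define p where "p = (\<Sum>a\<in>S. smult (c a) (\<Prod>b\<in>S - {a}. [:- b, 1:]))"
  have "poly p a0 = c a0 * (\<Prod>b\<in>S - {a0}. a0 - b)"
  proof -
    have "(\<Prod>b\<in>S - {a}. a0 - b) = 0" if "a \<in> S - {a0}" for a
      by (rule prod_zero) (use that a0 S(1) in auto)
    then have "(\<Sum>a\<in>S - {a0}. c a * (\<Prod>b\<in>S - {a}. a0 - b)) = 0" by (intro sum.neutral) auto
    then show ?thesis unfolding p_def
      by (simp add: poly_sum poly_prod sum.remove[OF S(1) a0(1)])
  qed
  also have "\<dots> \<noteq> 0" using a0 S(1) by simp
  finally have "p \<noteq> 0" by auto
  moreover have "ring_eval x p \<in> I"
  proof -
    let ?P = "\<lambda>a. \<Prod>b\<in>S - {a}. x - scal b"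
    have "ring_eval x p = (\<Sum>a\<in>S. scal (c a) * ?P a)"
      unfolding p_def ring_eval_sum by (simp add: ring_eval_prod single_uminus)
    \<comment> \<open>Modulo I the product without the factor x - a is \<open>r a\<close> times the
      full product. The full product then multiplies the vanishing linear relation.\<close>
    also have "\<dots> = (\<Sum>a\<in>S. scal (c a) * ?P a * (1 - r a * (x - scal a)) + scal (c a) * r a * (\<Prod>b\<in>S. x - scal b))"
    proof (rule sum.cong[OF refl])
      fix a assume "a \<in> S"
      then have eq: "(\<Prod>b\<in>S. x - scal b) = (x - scal a) * ?P a" using S(1) by (simp add: prod.remove)
      have "u * P = u * P * (1 - v * y) + u * v * (y * P)" for u P v y :: "'v \<Rightarrow>\<^sub>0 complex"
        by (simp add: algebra_simps)
      then show "scal (c a) * ?P a = scal (c a) * ?P a * (1 - r a * (x - scal a)) + scal (c a) * r a * (\<Prod>b\<in>S. x - scal b)"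
        unfolding eq .
    qed
    also have "\<dots> = (\<Sum>a\<in>S. scal (c a) * ?P a * (1 - r a * (x - scal a))) + (\<Sum>a\<in>S. scal (c a) * r a) * (\<Prod>b\<in>S. x - scal b)"
      by (simp add: sum.distrib sum_distrib_right)
    also have "\<dots> = (\<Sum>a\<in>S. scal (c a) * ?P a * (1 - r a * (x - scal a)))" by (simp add: c)
    also have "\<dots> \<in> I"
    proof (intro ideal_sum[OF I(1)] idealD(3)[OF I(1) _ r(2)])
      show "scal (c a) * ?P a \<in> R" for a using x by (intro R_mult R_prod R_diff) auto
    qed
    finally show ?thesis .
  qed
  ultimately show False by (rule no_root)
qed

lemma ideal_extension:
  assumes I: "is_ideal I" and x: "x \<in> R"
  shows "is_ideal {g + r * (x - scal a) | g r. g \<in> I \<and> r \<in> R}" (is "is_ideal ?I'")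
    and "I \<subseteq> {g + r * (x - scal a) | g r. g \<in> I \<and> r \<in> R}"
    and "x - scal a \<in> {g + r * (x - scal a) | g r. g \<in> I \<and> r \<in> R}"
proof -
  show "is_ideal ?I'" unfolding is_ideal_def
  proof (intro conjI ballI)
    show "0 \<in> ?I'" using idealD(1)[OF I] by (intro CollectI exI[of _ 0]) auto
    fix g h assume "g \<in> ?I'" "h \<in> ?I'"
    then obtain g' r h' s where *: "g = g' + r * (x - scal a)" "h = h' + s * (x - scal a)" "g' \<in> I" "h' \<in> I" "r \<in> R" "s \<in> R" by blast
    have "g + h = (g' + h') + (r + s) * (x - scal a)" by (simp add: * algebra_simps)
    then show "g + h \<in> ?I'" using * idealD(2)[OF I] R_add by blast
  next
    fix q g assume "q \<in> R" "g \<in> ?I'"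
    then obtain g' r where *: "g = g' + r * (x - scal a)" "g' \<in> I" "r \<in> R" by blast
    have "q * g = q * g' + (q * r) * (x - scal a)" by (simp add: * algebra_simps)
    then show "q * g \<in> ?I'" using * \<open>q \<in> R\<close> idealD(3)[OF I] R_mult by blast
  qed
  show "I \<subseteq> ?I'"
  proof
    fix g assume "g \<in> I"
    then show "g \<in> ?I'" by (intro CollectI exI[of _ g] exI[of _ 0]) auto
  qed
  show "x - scal a \<in> ?I'" using idealD(1)[OF I] by (intro CollectI exI[of _ 0] exI[of _ 1]) auto
qed

text \<open>Coordinates are specialised one at a time while the ideal stays proper. Modulo the
  result every \<open>x k\<close> is a scalar, which is what a point amounts to.\<close>

lemma exists_maximal_point:
  assumes I: "is_ideal I" "1 \<notin> I" and "finite V" "\<And>k. k \<in> V \<Longrightarrow> x k \<in> R"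
  shows "\<exists>I' z. is_ideal I' \<and> 1 \<notin> I' \<and> I \<subseteq> I' \<and> (\<forall>k\<in>V. x k - scal (z k) \<in> I')"
  using assms(3,4)
proof (induction V)
  case empty then show ?case using I by blast
next
  case (insert k V)
  then obtain I' z where I': "is_ideal I'" "1 \<notin> I'" "I \<subseteq> I'" "\<forall>k\<in>V. x k - scal (z k) \<in> I'" by auto
  have xk: "x k \<in> R" using insert by simp
  obtain a where a: "1 \<notin> {g + r * (x k - scal a) | g r. g \<in> I' \<and> r \<in> R}"
    using exists_proper_extension[OF I'(1,2) xk] by blast
  let ?J = "{g + r * (x k - scal a) | g r. g \<in> I' \<and> r \<in> R}"
  have "is_ideal ?J" "I' \<subseteq> ?J" "x k - scal a \<in> ?J" using ideal_extension[OF I'(1) xk] by blast+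
  moreover have "\<forall>i\<in>insert k V. x i - scal ((z(k := a)) i) \<in> ?J"
    using calculation I'(4) insert.hyps by auto
  ultimately show ?case using a I'(3) by (intro exI[of _ ?J] exI[of _ "z(k := a)"]) blast
qed

end

section \<open>Laurent polynomials and points of the torus\<close>

definition int_lattice :: "(real ^ 'i::finite) set" where
  "int_lattice = {x. \<forall>k. x $ k \<in> \<int>}"

text \<open>Exponent vectors are real vectors here; on \<open>int_lattice\<close> the floor just
  recovers the integer exponent.\<close>

definition laurent_char :: "('i::finite \<Rightarrow> complex) \<Rightarrow> real ^ 'i \<Rightarrow> complex" where
  "laurent_char z m = (\<Prod>k\<in>UNIV. z k powi \<lfloor>m $ k\<rfloor>)"

definition laurent_eval :: "('i::finite \<Rightarrow> complex) \<Rightarrow> ((real ^ 'i) \<Rightarrow>\<^sub>0 complex) \<Rightarrow> complex" where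
  "laurent_eval z g = (\<Sum>m\<in>keys g. lookup g m * laurent_char z m)"

lemma countable_int_lattice: "countable (int_lattice :: (real ^ 'i::finite) set)"
proof -
  have "int_lattice = (\<lambda>a :: 'i \<Rightarrow> int. \<chi> k. real_of_int (a k)) ` UNIV" (is "_ = ?R")
  proof (intro set_eqI iffI)
    fix x :: "real ^ 'i" assume "x \<in> int_lattice"
    then have "x = (\<lambda>a. \<chi> k. real_of_int (a k)) (\<lambda>k. \<lfloor>x $ k\<rfloor>)"
      by (simp add: int_lattice_def vec_eq_iff)
    then show "x \<in> ?R" by (rule range_eqI[where x = "\<lambda>k. \<lfloor>x $ k\<rfloor>" and f = "\<lambda>a. \<chi> k. real_of_int (a k)"])
  qed (auto simp: int_lattice_def)
  moreover have "countable (UNIV :: ('i \<Rightarrow> int) set)"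
    using countable_PiE[of "UNIV :: 'i set" "\<lambda>_. UNIV :: int set"] by (simp add: PiE_UNIV_domain)
  ultimately show ?thesis by (metis countable_image)
qed

interpretation laurent: group_ring "int_lattice :: (real ^ 'i::finite) set"
  by standard (rule countable_int_lattice, auto simp: int_lattice_def)

text \<open>A proper ideal extends to a proper I' modulo which each coordinate monomial is a scalar
  z_k. Multiplicativity spreads this to all Laurent monomials, so F_j is congruent to its value at
  z. Some value is nonzero, and this puts a nonzero constant into I'.\<close>

theorem laurent_nullstellensatz:
  fixes F :: "'j \<Rightarrow> ((real ^ 'i::finite) \<Rightarrow>\<^sub>0 complex)"
  assumes N: "finite N" and F: "\<And>j. j \<in> N \<Longrightarrow> keys (F j) \<subseteq> int_lattice"
    and nz: "\<And>z. (\<And>k. z k \<noteq> 0) \<Longrightarrow> \<exists>j\<in>N. laurent_eval z (F j) \<noteq> 0"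
  obtains g where "\<And>j. keys (g j) \<subseteq> int_lattice" "(\<Sum>j\<in>N. F j * g j) = 1"
proof (rule ccontr)
  assume no: "\<not> thesis"
  let ?R = "laurent.R :: ((real ^ 'i) \<Rightarrow>\<^sub>0 complex) set"
  define I where "I = {\<Sum>j\<in>N. F j * g j | g. \<forall>j. g j \<in> ?R}"
  have I: "laurent.is_ideal I" unfolding laurent.is_ideal_def
  proof (intro conjI ballI)
    show "0 \<in> I" unfolding I_def by (auto intro!: exI[of _ "\<lambda>_. 0"])
    fix g h assume "g \<in> I" "h \<in> I"
    then obtain a b where *: "g = (\<Sum>j\<in>N. F j * a j)" "h = (\<Sum>j\<in>N. F j * b j)" "\<forall>j. a j \<in> ?R" "\<forall>j. b j \<in> ?R"
      unfolding I_def by blast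
    have "g + h = (\<Sum>j\<in>N. F j * (a j + b j))" by (simp add: * sum.distrib distrib_left)
    moreover have "\<forall>j. a j + b j \<in> ?R" using * by (simp add: laurent.R_add)
    ultimately show "g + h \<in> I" unfolding I_def by (intro CollectI exI[of _ "\<lambda>j. a j + b j"] conjI)
  next
    fix r g assume "r \<in> ?R" "g \<in> I"
    then obtain a where *: "g = (\<Sum>j\<in>N. F j * a j)" "\<forall>j. a j \<in> ?R"
      unfolding I_def by blast
    have "r * g = (\<Sum>j\<in>N. F j * (r * a j))" by (simp add: * sum_distrib_left mult_ac)
    moreover have "\<forall>j. r * a j \<in> ?R" using * \<open>r \<in> ?R\<close> by (simp add: laurent.R_mult)
    ultimately show "r * g \<in> I" unfolding I_def by (intro CollectI exI[of _ "\<lambda>j. r * a j"] conjI)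
  qed
  have "1 \<notin> I"
  proof
    assume "1 \<in> I"
    then obtain g where "1 = (\<Sum>j\<in>N. F j * g j)" "\<forall>j. g j \<in> ?R" unfolding I_def by blast
    then show False using no that[of g] by (simp add: laurent.R_def)
  qed
  define x where "x k = Poly_Mapping.single (axis k 1 :: real ^ 'i) (1::complex)" for k
  have ax: "axis k 1 \<in> int_lattice" for k :: 'i by (simp add: int_lattice_def axis_def)
  have "\<exists>I' z. laurent.is_ideal I' \<and> 1 \<notin> I' \<and> I \<subseteq> I' \<and> (\<forall>k\<in>UNIV. x k - scal (z k) \<in> I')"
    by (rule laurent.exists_maximal_point[OF I \<open>1 \<notin> I\<close>]) (auto simp: x_def intro: laurent.R_single ax)
  then obtain I' z where I': "laurent.is_ideal I'" "1 \<notin> I'" "I \<subseteq> I'" "\<And>k. x k - scal (z k) \<in> I'" by auto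
  note ideal = laurent.idealD[OF I'(1)]
  define P where "P m c \<longleftrightarrow> m \<in> int_lattice \<and> Poly_Mapping.single m 1 - scal c \<in> I'" for m c
  \<comment> \<open>A zero coordinate would put an invertible monomial into I'.\<close>
  have z0: "z k \<noteq> 0" for k
  proof
    assume "z k = 0"
    then have "Poly_Mapping.single (- axis k 1) 1 * x k \<in> I'"
      using I'(4)[of k] ax by (intro ideal(3) laurent.R_single laurent.L_uminus) auto
    then show False using I'(2) by (simp add: x_def mult_single)
  qed
  have Padd: "P (m + m') (c * c')" if "P m c" "P m' c'" for m m' c c'
  proof -
    have "Poly_Mapping.single m' 1 * (Poly_Mapping.single m 1 - scal c) + scal c * (Poly_Mapping.single m' 1 - scal c') \<in> I'"
      using that unfolding P_def by (intro ideal(2,3)) (auto intro: laurent.R_single)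
    also have "Poly_Mapping.single m' 1 * (Poly_Mapping.single m 1 - scal c) + scal c * (Poly_Mapping.single m' 1 - scal c')
      = Poly_Mapping.single (m + m') 1 - scal (c * c')"
      by (simp add: algebra_simps mult_single)
    finally show ?thesis using that by (auto simp: P_def intro: laurent.L_add)
  qed
  have Puminus: "P (- m) (inverse c)" if "P m c" "c \<noteq> 0" for m c
  proof -
    have "(scal (- inverse c) * Poly_Mapping.single (- m) 1) * (Poly_Mapping.single m 1 - scal c) \<in> I'"
      using that unfolding P_def by (intro ideal(3) laurent.R_mult laurent.R_scal laurent.R_single laurent.L_uminus) auto
    also have "(scal (- inverse c) * Poly_Mapping.single (- m) 1) * (Poly_Mapping.single m 1 - scal c)
      = Poly_Mapping.single (- m) 1 - scal (inverse c)"
      using that by (simp add: algebra_simps mult_single single_uminus)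
    finally show ?thesis using that by (auto simp: P_def intro: laurent.L_uminus)
  qed
  have P0: "P 0 1" using ideal(1) by (simp add: P_def laurent.L_zero)
  have Pnat: "P (real n *\<^sub>R axis k 1) (z k ^ n)" for n k
  proof (induction n)
    case (Suc n)
    have "P (axis k 1) (z k)" using I'(4)[of k] ax by (simp add: P_def x_def)
    from Padd[OF this Suc] show ?case by (simp add: scaleR_left_distrib)
  qed (simp add: P0)
  have Pint: "P (real_of_int a *\<^sub>R axis k 1) (z k powi a)" for a k
  proof (cases "a \<ge> 0")
    case True then show ?thesis using Pnat[of "nat a" k] by (simp add: power_int_def)
  next
    case False
    then have "P (- (real (nat (- a)) *\<^sub>R axis k 1)) (inverse (z k ^ nat (- a)))"
      using z0 by (intro Puminus Pnat) auto
    then show ?thesis using False by (simp add: power_int_def power_inverse)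
  qed
  have Pchar: "P m (laurent_char z m)" if m: "m \<in> int_lattice" for m
  proof -
    have "P (\<Sum>k\<in>V. real_of_int \<lfloor>m $ k\<rfloor> *\<^sub>R axis k 1) (\<Prod>k\<in>V. z k powi \<lfloor>m $ k\<rfloor>)" if "finite V" for V
      using that by (induction V) (auto simp: P0 intro!: Padd Pint)
    from this[OF finite_class.finite_UNIV] have "P (\<Sum>k\<in>UNIV. real_of_int \<lfloor>m $ k\<rfloor> *\<^sub>R axis k 1) (laurent_char z m)"
      by (simp add: laurent_char_def)
    moreover have "(\<Sum>k\<in>UNIV. real_of_int \<lfloor>m $ k\<rfloor> *\<^sub>R axis k 1) = m"
      using m by (simp add: vec_eq_iff int_lattice_def axis_def if_distrib cong: if_cong)
    ultimately show ?thesis by simp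
  qed
  obtain j where j: "j \<in> N" "laurent_eval z (F j) \<noteq> 0" using nz z0 by blast
  let ?c = "laurent_eval z (F j)"
  have "F j - scal ?c = (\<Sum>m\<in>keys (F j). scal (lookup (F j) m) * (Poly_Mapping.single m 1 - scal (laurent_char z m)))"
  proof -
    have "scal ?c = (\<Sum>m\<in>keys (F j). scal (lookup (F j) m) * scal (laurent_char z m))"
      unfolding laurent_eval_def scal_mult by (rule poly_mapping_eqI) (simp add: lookup_sum lookup_single when_def)
    then show ?thesis by (subst (1) poly_mapping_expansion) (simp add: right_diff_distrib sum_subtractf)
  qed
  also have "\<dots> \<in> I'"
    using F[OF j(1)] Pchar by (intro laurent.ideal_sum[OF I'(1)] ideal(3)) (auto simp: P_def)
  finally have "F j - scal ?c \<in> I'" .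
  moreover have "F j \<in> I'"
  proof -
    have "F j = (\<Sum>i\<in>N. F i * (if i = j then 1 else 0))" using N j(1) by (simp add: if_distrib cong: if_cong)
    then have "F j \<in> I" unfolding I_def by (intro CollectI exI[of _ "\<lambda>i. if i = j then 1 else 0"]) auto
    then show ?thesis using I'(3) by blast
  qed
  ultimately have "F j - (F j - scal ?c) \<in> I'" by (rule ideal(4)[rotated])
  then have "scal ?c \<in> I'" by simp
  then have "scal (inverse ?c) * scal ?c \<in> I'" by (intro ideal(3)) auto
  moreover have "scal ?c * scal (inverse ?c) = (1 :: (real ^ 'i) \<Rightarrow>\<^sub>0 complex)" using j(2) by (rule scal_inverse)
  ultimately show False using I'(2) by (simp add: mult.commute)
qed

section \<open>Newton polytopes\<close>

definition coord_space :: "'n set \<Rightarrow> (real ^ 'n::finite) set" where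
  "coord_space J = {x. \<forall>i. i \<notin> J \<longrightarrow> x $ i = 0}"

lemma subspace_coord_space: "subspace (coord_space J)"
  by (auto simp: subspace_def coord_space_def)

lemma dim_coord_space: "dim (coord_space J :: (real ^ 'n::finite) set) = card J"
proof -
  have "coord_space J = {x :: real ^ 'n. \<forall>b\<in>Basis. b \<notin> (\<lambda>i. axis i 1) ` J \<longrightarrow> x \<bullet> b = 0}"
    by (auto simp: coord_space_def Basis_vec_def inner_axis axis_eq_axis)
  moreover have "card ((\<lambda>i. axis i (1::real)) ` J) = card J"
    by (intro card_image inj_onI) (auto simp: axis_eq_axis)
  ultimately show ?thesis
    using dim_substandard[of "(\<lambda>i. axis i (1::real)) ` J"] by (auto simp: Basis_vec_def)
qed

text \<open>Rational solutions of a solvable rational linear system arise by applying to the coordinates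
  of a real solution a \<open>\<rat>\<close>-linear map \<open>\<real> \<rightarrow> \<rat>\<close> that fixes \<open>1\<close>.\<close>

lemma rational_retraction:
  obtains g :: "real \<Rightarrow> rat" where "\<And>x y. g (x + y) = g x + g y" "\<And>q x. g (of_rat q * x) = q * g x" "g 1 = 1"
proof -
  interpret vector_space_pair "\<lambda>q (x::real). of_rat q * x" "(*) :: rat \<Rightarrow> rat \<Rightarrow> rat"
    by standard (auto simp: algebra_simps of_rat_add of_rat_mult)
  have "vs1.independent {1::real}" by simp
  then obtain g :: "real \<Rightarrow> rat" where g: "Vector_Spaces.linear (\<lambda>q (x::real). of_rat q * x) (*) g" "\<forall>x\<in>{1}. g x = 1"
    using linear_independent_extend[of "{1}" "\<lambda>_. 1"] by blast
  interpret g: Vector_Spaces.linear "\<lambda>q (x::real). of_rat q * x" "(*) :: rat \<Rightarrow> rat \<Rightarrow> rat" g by (rule g(1))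
  show ?thesis using that[of g] g(2) g.add g.scale by auto
qed

text \<open>With T the integral points whose hull is a facet, this produces the rational vector that
  \<open>facet_vec\<close> chooses.\<close>

lemma rational_solution:
  fixes u :: "real ^ 'n::finite"
  assumes T: "\<And>t. t \<in> T \<Longrightarrow> t \<in> int_lattice \<and> u \<bullet> t = 1" and u: "u \<in> coord_space J"
  obtains v :: "'n \<Rightarrow> rat" where "\<And>i. i \<notin> J \<Longrightarrow> v i = 0" "\<And>t. t \<in> T \<Longrightarrow> (\<chi> i. of_rat (v i)) \<bullet> t = (1::real)"
proof -
  obtain g :: "real \<Rightarrow> rat" where g: "\<And>x y. g (x + y) = g x + g y" "\<And>q x. g (of_rat q * x) = q * g x" "g 1 = 1"
    using rational_retraction by blast
  have g0: "g 0 = 0" using g(1)[of 0 0] by simp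
  have gsum: "g (\<Sum>i\<in>S. h i) = (\<Sum>i\<in>S. g (h i))" for S and h :: "'n \<Rightarrow> real"
    by (induction S rule: infinite_finite_induct) (auto simp: g g0)
  show ?thesis
  proof (rule that[of "\<lambda>i. g (u $ i)"])
    show "g (u $ i) = 0" if "i \<notin> J" for i using that u g0 by (simp add: coord_space_def)
    fix t assume t: "t \<in> T"
    have ti: "t $ i = of_rat (of_int \<lfloor>t $ i\<rfloor>)" for i using T[OF t] by (simp add: int_lattice_def)
    have "1 = g (u \<bullet> t)" using T[OF t] g(3) by simp
    also have "u \<bullet> t = (\<Sum>i\<in>UNIV. of_rat (of_int \<lfloor>t $ i\<rfloor>) * u $ i)"
      unfolding inner_vec_def by (intro sum.cong refl) (metis inner_real_def mult.commute ti)
    finally have "1 = (\<Sum>i\<in>UNIV. of_int \<lfloor>t $ i\<rfloor> * g (u $ i))" by (simp only: gsum g(2))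
    then have "(1::real) = of_rat (\<Sum>i\<in>UNIV. of_int \<lfloor>t $ i\<rfloor> * g (u $ i))" by (metis of_rat_1)
    also have "\<dots> = (\<Sum>i\<in>UNIV. of_rat (g (u $ i)) * t $ i)"
      using ti by (simp add: of_rat_sum of_rat_mult mult.commute)
    finally show "(\<chi> i. of_rat (g (u $ i))) \<bullet> t = (1::real)" by (simp add: inner_vec_def)
  qed
qed

definition facet_normal :: "'n::finite set \<Rightarrow> (real ^ 'n) set \<Rightarrow> (real ^ 'n) set \<Rightarrow> real ^ 'n" where
  "facet_normal J P F = (\<chi> i. of_rat (facet_vec J P F i))"

lemma point_add: "point (a + b) = point a + point b"
  by (simp add: point_def vec_eq_iff lookup_add)

lemma point_zero [simp]: "point 0 = 0"
  by (simp add: point_def vec_eq_iff)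

lemma point_nonneg: "0 \<le> point m $ i"
  by (simp add: point_def)

lemma point_in_lattice: "point m \<in> int_lattice"
  by (simp add: point_def int_lattice_def)

lemma point_in_coord_space: "point m \<in> coord_space J \<longleftrightarrow> keys m \<subseteq> J"
  by (auto simp: point_def coord_space_def in_keys_iff)

lemma point_inj: "point a = point b \<Longrightarrow> a = b"
  by (rule poly_mapping_eqI) (simp add: point_def vec_eq_iff)

lemma point_single: "point (Poly_Mapping.single i k) = real k *\<^sub>R axis i 1"
  by (simp add: point_def vec_eq_iff lookup_single axis_def when_def)

section \<open>The Newton polytope of a convenient polynomial\<close>

locale convenient_on =
  fixes J :: "'n::finite set" and h :: "'n mpoly" and P :: "(real ^ 'n) set"
  assumes J: "J \<noteq> {}" and h: "h \<in> polys_in J"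
    and conv: "\<And>i. i \<in> J \<Longrightarrow> \<exists>k\<ge>1. Poly_Mapping.lookup h (Poly_Mapping.single i k) \<noteq> 0"
  defines "P \<equiv> newton_polytope h"
begin

lemma P_eq: "P = convex hull (insert 0 (point ` keys h))"
  by (simp add: P_def newton_polytope_def)

lemma polytope_P: "polytope P"
  unfolding P_eq by (intro polytope_convex_hull) simp

lemma compact_P: "compact P"
  using polytope_P by (rule polytope_imp_compact)

lemma convex_P: "convex P"
  by (simp add: P_eq)

lemma zero_in_P: "0 \<in> P"
  unfolding P_eq by (simp add: hull_inc)

lemma P_sub: "P \<subseteq> coord_space J" "x \<in> P \<Longrightarrow> 0 \<le> x $ i"
proof -
  have k: "point ` keys h \<subseteq> coord_space J"
    using h by (auto simp: polys_in_def point_in_coord_space)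
  have "convex (coord_space J)" by (simp add: subspace_coord_space subspace_imp_convex)
  then show "P \<subseteq> coord_space J"
    unfolding P_eq using k by (intro hull_minimal) (auto simp: coord_space_def)
  have "convex {x :: real ^ 'n. 0 \<le> x $ i}"
    using convex_halfspace_ge[where a = "axis i (1::real)" and b = 0] by (simp add: inner_axis')
  then have "P \<subseteq> {x. 0 \<le> x $ i}"
    unfolding P_eq by (intro hull_minimal) (auto simp: point_nonneg)
  then show "x \<in> P \<Longrightarrow> 0 \<le> x $ i" by blast
qed

lemma axis_in_P: "i \<in> J \<Longrightarrow> \<exists>k>0. k *\<^sub>R axis i 1 \<in> P"
proof -
  assume "i \<in> J"
  then obtain k where k: "k \<ge> 1" "lookup h (Poly_Mapping.single i k) \<noteq> 0" using conv by blast
  then have "point (Poly_Mapping.single i k) \<in> P"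
    unfolding P_eq by (intro hull_inc) (auto simp: in_keys_iff)
  then show ?thesis using k(1) by (intro exI[of _ "real k"]) (simp add: point_single)
qed

lemma span_P: "span P = coord_space J"
proof
  show "span P \<subseteq> coord_space J" by (intro span_minimal P_sub subspace_coord_space)
  show "coord_space J \<subseteq> span P"
  proof
    fix x assume x: "x \<in> coord_space J"
    have "axis i 1 \<in> span P" if i: "i \<in> J" for i
    proof -
      obtain k where "k > 0" "k *\<^sub>R axis i 1 \<in> P" using axis_in_P[OF i] by blast
      then have "inverse k *\<^sub>R (k *\<^sub>R axis i 1) \<in> span P" by (intro span_scale span_base)
      then show ?thesis using \<open>k > 0\<close> by simp
    qed
    then have "(\<Sum>i\<in>J. x $ i *\<^sub>R axis i 1) \<in> span P" by (intro span_sum span_scale)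
    also have "(\<Sum>i\<in>J. x $ i *\<^sub>R axis i 1) = x"
      using x by (auto simp: vec_eq_iff coord_space_def axis_def if_distrib cong: if_cong)
    finally show "x \<in> span P" .
  qed
qed

lemma affine_hull_P: "affine hull P = coord_space J"
  using affine_hull_span_0[of P] zero_in_P span_P by (simp add: hull_inc)

lemma aff_dim_P: "aff_dim P = int (card J)"
proof -
  have "aff_dim P = int (dim P)" using zero_in_P by (intro aff_dim_zero) (simp add: hull_inc)
  then show ?thesis using dim_span[of P] span_P dim_coord_space[of J] by simp
qed

lemma boundary_facetsD:
  assumes "F \<in> boundary_facets J P"
  shows "F face_of P" "F \<noteq> {}" "0 \<notin> F" "aff_dim F = int (card J) - 1"
  using assms by (auto simp: boundary_facets_def boundary_faces_def newton_boundary_def)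

lemma finite_boundary_facets: "finite (boundary_facets J P)"
  by (rule finite_subset[OF _ finite_polytope_faces[OF polytope_P]])
    (auto simp: boundary_facets_def boundary_faces_def)

text \<open>The hyperplane on which v is 1 contains F and misses the origin, so F together with 0
  has full dimension in \<open>coord_space J\<close>. Thus F spans that space and determines a
  functional on it.\<close>

lemma agree_on_facet:
  assumes F: "F \<in> boundary_facets J P"
    and v: "\<And>x. x \<in> F \<Longrightarrow> v \<bullet> x = 1" and w: "\<And>x. x \<in> F \<Longrightarrow> w \<bullet> x = 1" and x: "x \<in> coord_space J"
  shows "v \<bullet> x = w \<bullet> x"
proof -
  have FJ: "F \<subseteq> coord_space J"
    using boundary_facetsD(1)[OF F] P_sub(1) face_of_imp_subset by blast
  have "affine hull F \<subseteq> {x. v \<bullet> x = 1}"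
    using v by (intro hull_minimal affine_hyperplane) auto
  then have "0 \<notin> affine hull F" by auto
  then have "aff_dim (insert 0 F) = int (card J)"
    using boundary_facetsD(4)[OF F] by (simp add: aff_dim_insert)
  moreover have "aff_dim (insert 0 F) = int (dim (insert 0 F))"
    by (intro aff_dim_zero) (simp add: hull_inc)
  moreover have "dim (insert 0 F) = dim F" by (metis dim_span span_insert_0)
  ultimately have "dim F = card J" by simp
  then have "span F = coord_space J"
    using FJ dim_coord_space[of J] subspace_coord_space[of J]
    by (intro subspace_dim_equal) (auto simp: dim_span intro: span_minimal[THEN subsetD])
  moreover have "span F \<subseteq> {x. (v - w) \<bullet> x = 0}"
    using v w by (intro span_minimal subspace_hyperplane) (auto simp: inner_diff_left)
  ultimately show ?thesis using x by (auto simp: inner_diff_left)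
qed

text \<open>A supporting inequality a x \<le> b has b > 0, since 0 lies in P but not on the face.
  Dividing by b and deleting the coordinates outside J, which vanish on P, gives the normal
  form.\<close>

lemma face_normal_exists:
  assumes F: "F face_of P" "0 \<notin> F"
  obtains u where "u \<in> coord_space J" "F = P \<inter> {x. u \<bullet> x = 1}" "\<And>x. x \<in> P \<Longrightarrow> u \<bullet> x \<le> 1"
proof -
  have "F exposed_face_of P"
    using F(1) exposed_face_of_polyhedron polytope_imp_polyhedron[OF polytope_P] by blast
  then obtain a b where ab: "P \<subseteq> {x. a \<bullet> x \<le> b}" "F = P \<inter> {x. a \<bullet> x = b}"
    unfolding exposed_face_of_def by blast
  have "0 < b" using ab F(2) zero_in_P by (auto simp: less_le)
  define u where "u = (\<chi> i. if i \<in> J then a $ i / b else 0)"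
  have u: "u \<bullet> x = (a \<bullet> x) / b" if "x \<in> P" for x
  proof -
    have "x $ i = 0" if "i \<notin> J" for i using P_sub(1) \<open>x \<in> P\<close> that by (auto simp: coord_space_def)
    then have "(if i \<in> J then a $ i / b else 0) * x $ i = a $ i * x $ i / b" for i by auto
    then show ?thesis by (simp add: u_def inner_vec_def sum_divide_distrib)
  qed
  show ?thesis
  proof (rule that)
    show "u \<in> coord_space J" by (simp add: u_def coord_space_def)
    show "F = P \<inter> {x. u \<bullet> x = 1}" using ab(2) u \<open>0 < b\<close> by auto
    show "u \<bullet> x \<le> 1" if "x \<in> P" for x using ab(1) u[OF that] that \<open>0 < b\<close> by auto
  qed
qed

text \<open>A face of a hull is the hull of some of the generators, here integral points, so a
  rational normal exists and the choice in \<open>facet_vec\<close> is meaningful.\<close>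

lemma facet_normal:
  assumes F: "F \<in> boundary_facets J P"
  shows "facet_normal J P F \<in> coord_space J" "F = P \<inter> {x. facet_normal J P F \<bullet> x = 1}"
    "\<And>i. i \<notin> J \<Longrightarrow> facet_vec J P F i = 0"
proof -
  obtain u where u: "u \<in> coord_space J" "F = P \<inter> {x. u \<bullet> x = 1}" "\<And>x. x \<in> P \<Longrightarrow> u \<bullet> x \<le> 1"
    using face_normal_exists boundary_facetsD[OF F] by metis
  obtain T where T: "T \<subseteq> insert 0 (point ` keys h)" "F = convex hull T"
    using face_of_convex_hull_subset[of "insert 0 (point ` keys h)" F] boundary_facetsD(1)[OF F]
    unfolding P_eq by (metis finite.insertI finite_imageI finite_imp_compact finite_keys)
  have TF: "T \<subseteq> F" using T(2) by (simp add: hull_subset)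
  have "t \<in> int_lattice \<and> u \<bullet> t = 1" if "t \<in> T" for t
    using that T(1) TF u(2) by (auto simp: point_in_lattice laurent.L_zero)
  then obtain v :: "'n \<Rightarrow> rat" where v: "\<And>i. i \<notin> J \<Longrightarrow> v i = 0" "\<And>t. t \<in> T \<Longrightarrow> (\<chi> i. of_rat (v i)) \<bullet> t = (1::real)"
    using rational_solution[OF _ u(1)] by metis
  have sum: "(\<Sum>i\<in>J. of_rat (c i) * x $ i) = (\<chi> i. of_rat (c i)) \<bullet> x"
    if "\<And>i. i \<notin> J \<Longrightarrow> c i = 0" for c :: "'n \<Rightarrow> rat" and x
    using that unfolding inner_vec_def by (intro sum.mono_neutral_cong_left) auto
  have "F \<subseteq> {x. (\<chi> i. of_rat (v i)) \<bullet> x = (1::real)}"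
    unfolding T(2) using v(2) by (intro hull_minimal affine_imp_convex affine_hyperplane) auto
  then have "(\<chi> i. of_rat (v i)) \<bullet> x = u \<bullet> x" if "x \<in> P" for x
    using agree_on_facet[OF F, of "\<chi> i. of_rat (v i)" u x] u(2) P_sub(1) that by blast
  then have "F = P \<inter> {x. (\<chi> i. of_rat (v i)) \<bullet> x = 1}" using u(2) by auto
  then have "\<exists>c. (\<forall>i. i \<notin> J \<longrightarrow> c i = 0) \<and> F = P \<inter> {x. (\<Sum>i\<in>J. of_rat (c i) * x $ i) = 1}"
    using v(1) sum[OF v(1)] by (intro exI[of _ v]) simp
  then have "(\<forall>i. i \<notin> J \<longrightarrow> facet_vec J P F i = 0) \<and> F = P \<inter> {x. (\<Sum>i\<in>J. of_rat (facet_vec J P F i) * x $ i) = 1}"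
    unfolding facet_vec_def by (rule someI_ex)
  then show z: "\<And>i. i \<notin> J \<Longrightarrow> facet_vec J P F i = 0" and "F = P \<inter> {x. facet_normal J P F \<bullet> x = 1}"
    using sum[of "facet_vec J P F"] unfolding facet_normal_def by auto
  show "facet_normal J P F \<in> coord_space J" using z by (simp add: facet_normal_def coord_space_def)
qed

lemma facet_normal_le: "F \<in> boundary_facets J P \<Longrightarrow> x \<in> P \<Longrightarrow> facet_normal J P F \<bullet> x \<le> 1"
proof -
  assume F: "F \<in> boundary_facets J P" and x: "x \<in> P"
  obtain u where u: "u \<in> coord_space J" "F = P \<inter> {x. u \<bullet> x = 1}" "\<And>x. x \<in> P \<Longrightarrow> u \<bullet> x \<le> 1"
    using face_normal_exists boundary_facetsD[OF F] by metis
  have "facet_normal J P F \<bullet> x = u \<bullet> x"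
    using agree_on_facet[OF F, of "facet_normal J P F" u x] facet_normal(2)[OF F] u(2) P_sub(1) x by blast
  then show ?thesis using u(3)[OF x] by simp
qed

text \<open>A facet through the origin has a normal with nonpositive entries on J, because P
  contains points on every axis of J. It cannot separate a point of the orthant, so the facets away
  from the origin suffice there.\<close>

lemma in_P_if_facets:
  assumes x: "x \<in> coord_space J" "\<And>i. 0 \<le> x $ i"
    and le: "\<And>F. F \<in> boundary_facets J P \<Longrightarrow> facet_normal J P F \<bullet> x \<le> 1"
  shows "x \<in> P"
proof (rule ccontr)
  assume nP: "x \<notin> P"
  have "polyhedron P" by (rule polytope_imp_polyhedron[OF polytope_P])
  \<comment> \<open>The description is irredundant, so the violated half-space H cuts out a genuine
    facet.\<close>
  then obtain \<F> where \<F>: "finite \<F>" "P = affine hull P \<inter> \<Inter>\<F>"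
      "\<forall>h\<in>\<F>. \<exists>a b. a \<noteq> 0 \<and> h = {x. a \<bullet> x \<le> b}" "\<And>F'. F' \<subset> \<F> \<Longrightarrow> P \<subset> affine hull P \<inter> \<Inter>F'"
    unfolding polyhedron_Int_affine_minimal by blast
  then obtain a b where ab: "\<And>h. h \<in> \<F> \<Longrightarrow> a h \<noteq> 0 \<and> h = {x. a h \<bullet> x \<le> b h}" by metis
  have "x \<in> affine hull P" using x(1) by (simp add: affine_hull_P)
  then obtain H where H: "H \<in> \<F>" "x \<notin> H" using nP \<F>(2) by blast
  have PH: "a H \<bullet> y \<le> b H" if "y \<in> P" for y
    using that H(1) ab[OF H(1)] \<F>(2) by blast
  have xH: "b H < a H \<bullet> x" using H ab[OF H(1)] by auto
  define F where "F = P \<inter> {y. a H \<bullet> y = b H}"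
  have facet: "F facet_of P"
    using facet_of_polyhedron_explicit[OF \<F>(1,2) ab \<F>(4), of F] H(1) unfolding F_def by blast
  have b0: "0 < b H"
  proof (rule ccontr)
    assume "\<not> 0 < b H"
    moreover have "0 \<le> b H" using PH[OF zero_in_P] by simp
    ultimately have bz: "b H = 0" by simp
    have "a H $ i \<le> 0" if "i \<in> J" for i
    proof -
      obtain k where k: "k > 0" "k *\<^sub>R axis i 1 \<in> P" using axis_in_P[OF \<open>i \<in> J\<close>] by blast
      then have "k * (a H $ i) \<le> 0" using PH[OF k(2)] bz by (simp add: inner_axis)
      then show ?thesis using k(1) by (simp add: mult_le_0_iff)
    qed
    then have "a H $ i * x $ i \<le> 0" for i
      using x by (cases "i \<in> J") (auto simp: coord_space_def mult_le_0_iff)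
    then have "a H \<bullet> x \<le> 0" by (simp add: inner_vec_def sum_nonpos)
    then show False using xH bz by simp
  qed
  have "0 \<notin> F" using b0 by (auto simp: F_def)
  then have F: "F \<in> boundary_facets J P"
    using facet unfolding boundary_facets_def boundary_faces_def newton_boundary_def facet_of_def
    by (auto simp: aff_dim_P)
  have "((1 / b H) *\<^sub>R a H) \<bullet> x = facet_normal J P F \<bullet> x"
  proof (rule agree_on_facet[OF F _ _ x(1)])
    show "((1 / b H) *\<^sub>R a H) \<bullet> y = 1" if "y \<in> F" for y using that b0 by (simp add: F_def)
    show "facet_normal J P F \<bullet> y = 1" if "y \<in> F" for y using that facet_normal(2)[OF F] by blast
  qed
  moreover have "1 < ((1 / b H) *\<^sub>R a H) \<bullet> x" using b0 xH by (simp add: field_simps)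
  ultimately have "1 < facet_normal J P F \<bullet> x" by simp
  then show False using le[OF F] by simp
qed

lemma in_P_iff: "x \<in> P \<longleftrightarrow> x \<in> coord_space J \<and> (\<forall>i. 0 \<le> x $ i) \<and> (\<forall>F\<in>boundary_facets J P. facet_normal J P F \<bullet> x \<le> 1)"
  using in_P_if_facets facet_normal_le P_sub by blast

text \<open>Otherwise P would contain a whole half-axis. This gives meaning to the
  \<open>Max\<close> in \<open>newton_fun\<close>.\<close>

lemma boundary_facets_nonempty: "boundary_facets J P \<noteq> {}"
proof
  assume e: "boundary_facets J P = {}"
  obtain i where i: "i \<in> J" using J by blast
  have unbounded_P: "k *\<^sub>R axis i 1 \<in> P" if "k \<ge> 0" for k :: real
    using that i e by (auto simp: in_P_iff coord_space_def axis_def)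
  obtain B where B: "\<And>x. x \<in> P \<Longrightarrow> norm x \<le> B"
    using compact_imp_bounded[OF compact_P] bounded_iff by metis
  have "0 \<le> B" using B[OF zero_in_P] by simp
  then have "norm ((B + 1) *\<^sub>R (axis i 1 :: real ^ 'n)) \<le> B" by (intro B unbounded_P) simp
  then show False using \<open>0 \<le> B\<close> by (simp add: norm_axis_1)
qed

lemma newton_fun_le_iff:
  assumes m: "keys m \<subseteq> J"
  shows "of_rat (newton_fun J h m) \<le> (r::real) \<longleftrightarrow> (\<forall>F\<in>boundary_facets J P. facet_normal J P F \<bullet> point m \<le> r)"
proof -
  let ?s = "\<lambda>F. \<Sum>i\<in>J. facet_vec J P F i * of_nat (lookup m i)"
  have s: "of_rat (?s F) = facet_normal J P F \<bullet> point m" if "F \<in> boundary_facets J P" for F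
    using facet_normal(3)[OF that] unfolding facet_normal_def inner_vec_def point_def of_rat_sum
    by (intro sum.mono_neutral_cong_left) (auto simp: of_rat_mult)
  have fin: "finite (?s ` boundary_facets J P)" "?s ` boundary_facets J P \<noteq> {}"
    using finite_boundary_facets boundary_facets_nonempty by auto
  have nf: "newton_fun J h m = Max (?s ` boundary_facets J P)"
    by (simp add: newton_fun_def Let_def P_def)
  show ?thesis
  proof
    assume le: "of_rat (newton_fun J h m) \<le> r"
    show "\<forall>F\<in>boundary_facets J P. facet_normal J P F \<bullet> point m \<le> r"
    proof
      fix F assume F: "F \<in> boundary_facets J P"
      then have "?s F \<le> newton_fun J h m" unfolding nf using fin by (intro Max_ge) auto
      then have "(of_rat (?s F) :: real) \<le> of_rat (newton_fun J h m)" by (simp add: of_rat_less_eq)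
      then show "facet_normal J P F \<bullet> point m \<le> r" using le s[OF F] by simp
    qed
  next
    assume le: "\<forall>F\<in>boundary_facets J P. facet_normal J P F \<bullet> point m \<le> r"
    have "newton_fun J h m \<in> ?s ` boundary_facets J P" unfolding nf using fin by (rule Max_in)
    then obtain F where "F \<in> boundary_facets J P" "newton_fun J h m = ?s F" by blast
    then show "of_rat (newton_fun J h m) \<le> r" using le s by metis
  qed
qed

text \<open>So \<open>newton_fun\<close> is the gauge of P on the orthant. In this form it can be
  compared across coordinate subspaces without matching facets.\<close>

lemma newton_fun_le_iff_in_P:
  assumes m: "keys m \<subseteq> J" and r: "0 < (r::real)"
  shows "of_rat (newton_fun J h m) \<le> r \<longleftrightarrow> (1 / r) *\<^sub>R point m \<in> P"
  unfolding newton_fun_le_iff[OF m] in_P_iff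
  using m r point_nonneg[of m] by (auto simp: point_in_coord_space[symmetric] coord_space_def field_simps)

text \<open>The ray through x would stay inside P, which is bounded.\<close>

lemma zero_if_nonpos:
  assumes "x \<in> coord_space J" "\<And>i. 0 \<le> x $ i" "\<And>F. F \<in> boundary_facets J P \<Longrightarrow> facet_normal J P F \<bullet> x \<le> 0"
  shows "x = 0"
proof (rule ccontr)
  assume x0: "x \<noteq> 0"
  obtain B where B: "\<And>x. x \<in> P \<Longrightarrow> norm x \<le> B"
    using compact_imp_bounded[OF compact_P] bounded_iff by metis
  have "0 \<le> B" using B[OF zero_in_P] by simp
  define k where "k = (B + 1) / norm x"
  have k: "0 < k" using x0 \<open>0 \<le> B\<close> by (simp add: k_def)
  have "k *\<^sub>R x \<in> P" unfolding in_P_iff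
    using assms k by (auto simp: coord_space_def) (smt (verit) mult_nonneg_nonpos)
  then have "norm (k *\<^sub>R x) \<le> B" by (rule B)
  then show False using x0 \<open>0 \<le> B\<close> by (simp add: k_def)
qed

lemma newton_fun_zero: "newton_fun J h 0 = 0"
proof -
  have "(\<lambda>F. \<Sum>i\<in>J. facet_vec J P F i * of_nat (lookup (0 :: 'n \<Rightarrow>\<^sub>0 nat) i)) ` boundary_facets J P = {0}"
    using boundary_facets_nonempty by auto
  then show ?thesis by (simp add: newton_fun_def Let_def P_def[symmetric])
qed

lemma newton_fun_nonneg:
  assumes m: "keys m \<subseteq> J"
  shows "0 \<le> newton_fun J h m"
proof (rule ccontr)
  assume n: "\<not> 0 \<le> newton_fun J h m"
  then have "of_rat (newton_fun J h m) \<le> (0::real)" by simp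
  then have "point m = 0"
    using m point_nonneg unfolding newton_fun_le_iff[OF m]
    by (intro zero_if_nonpos) (auto simp: point_in_coord_space)
  then have "m = 0" using point_inj[of m 0] by simp
  then show False using n newton_fun_zero by simp
qed

text \<open>Sublevel sets lie in dilates of the bounded P; \<open>max 1\<close> in r keeps the
  factor positive whatever the sign of \<alpha>.\<close>

lemma finite_newton_fun_le: "finite {m. keys m \<subseteq> J \<and> newton_fun J h m \<le> \<alpha>}"
proof -
  define r :: real where "r = max 1 (of_rat \<alpha>)"
  have r: "0 < r" by (simp add: r_def)
  obtain B where B: "\<And>x. x \<in> P \<Longrightarrow> norm x \<le> B"
    using compact_imp_bounded[OF compact_P] bounded_iff by metis
  have "{m. keys m \<subseteq> J \<and> newton_fun J h m \<le> \<alpha>} \<subseteq> {m. \<forall>i. lookup m i \<le> nat \<lceil>r * B\<rceil>}"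
  proof
    fix m assume "m \<in> {m. keys m \<subseteq> J \<and> newton_fun J h m \<le> \<alpha>}"
    then have m: "keys m \<subseteq> J" "newton_fun J h m \<le> \<alpha>" by auto
    have "(of_rat (newton_fun J h m) :: real) \<le> of_rat \<alpha>" using m(2) by (simp add: of_rat_less_eq)
    then have "of_rat (newton_fun J h m) \<le> r" by (simp add: r_def)
    then have "norm ((1 / r) *\<^sub>R point m) \<le> B" using newton_fun_le_iff_in_P[OF m(1) r] B by blast
    then have n: "norm (point m) \<le> r * B" using r by (simp add: field_simps)
    have "lookup m i \<le> nat \<lceil>r * B\<rceil>" for i
    proof -
      have "real (lookup m i) \<le> norm (point m)" using component_le_norm_cart[of "point m" i] by (simp add: point_def)
      then show ?thesis using n by linarith
    qed
    then show "m \<in> {m. \<forall>i. lookup m i \<le> nat \<lceil>r * B\<rceil>}" by blast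
  qed
  moreover have "finite {m :: 'n \<Rightarrow>\<^sub>0 nat. \<forall>i. lookup m i \<le> nat \<lceil>r * B\<rceil>}"
  proof (rule finite_imageD)
    have "lookup ` {m :: 'n \<Rightarrow>\<^sub>0 nat. \<forall>i. lookup m i \<le> nat \<lceil>r * B\<rceil>} \<subseteq> PiE UNIV (\<lambda>_. {..nat \<lceil>r * B\<rceil>})"
      by auto
    then show "finite (lookup ` {m :: 'n \<Rightarrow>\<^sub>0 nat. \<forall>i. lookup m i \<le> nat \<lceil>r * B\<rceil>})"
      by (rule finite_subset) (intro finite_PiE; simp)
    show "inj_on lookup {m :: 'n \<Rightarrow>\<^sub>0 nat. \<forall>i. lookup m i \<le> nat \<lceil>r * B\<rceil>}"
      by (intro inj_onI poly_mapping_eqI) simp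
  qed
  ultimately show ?thesis by (rule finite_subset)
qed

end

section \<open>Restriction of polynomials to coordinate subspaces\<close>

lemma monomial_part_eq: "monomial_part A g = part A g"
proof (rule poly_mapping_eqI)
  fix k show "lookup (monomial_part A g) k = lookup (part A g) k"
    unfolding monomial_part_def
    by (auto simp: lookup_sum lookup_single when_def lookup_part in_keys_iff if_distrib cong: if_cong)
qed

lemma set_zero_eq: "set_zero I g = part {m. keys m \<subseteq> - I} g"
proof -
  have "{m. \<forall>i\<in>I. lookup m i = 0} = {m. keys m \<subseteq> - I}" by (auto simp: in_keys_iff subset_iff)
  then show ?thesis unfolding set_zero_def monomial_part_eq by (rule arg_cong)
qed

lemma convenient_on_UNIV: "convenient f \<Longrightarrow> convenient_on UNIV f"
  by unfold_locales (auto simp: convenient_def polys_in_def)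

lemma convenient_on_set_zero:
  assumes "convenient f" "J \<noteq> {}"
  shows "convenient_on J (set_zero (- J) f)"
proof
  show "set_zero (- J) f \<in> polys_in J" by (auto simp: polys_in_def set_zero_eq)
  fix i assume "i \<in> J"
  obtain k where k: "k \<ge> 1" "lookup f (Poly_Mapping.single i k) \<noteq> 0"
    using assms(1) unfolding convenient_def by blast
  then show "\<exists>k\<ge>1. lookup (set_zero (- J) f) (Poly_Mapping.single i k) \<noteq> 0"
    using \<open>i \<in> J\<close> by (intro exI[of _ k]) (simp add: set_zero_eq lookup_part)
qed (rule assms(2))

text \<open>All coordinates are nonnegative on the polytope, so \<open>coord_space J\<close> meets
  it in a face, and that face is the hull of the generators it contains.\<close>

lemma newton_polytope_set_zero:
  fixes f :: "'n::finite mpoly"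
  shows "newton_polytope (set_zero (- J) f) = newton_polytope f \<inter> coord_space J"
proof
  have k: "keys (set_zero (- J) f) = keys f \<inter> {m. keys m \<subseteq> J}" by (simp add: set_zero_eq)
  have "convex (coord_space J :: (real ^ 'n) set)" by (simp add: subspace_coord_space subspace_imp_convex)
  then have "newton_polytope (set_zero (- J) f) \<subseteq> coord_space J"
    unfolding newton_polytope_def k by (intro hull_minimal) (auto simp: point_in_coord_space coord_space_def[of J, THEN arg_cong[where f="\<lambda>X. 0 \<in> X"]])
  moreover have "newton_polytope (set_zero (- J) f) \<subseteq> newton_polytope f"
    unfolding newton_polytope_def k by (intro hull_mono) auto
  ultimately show "newton_polytope (set_zero (- J) f) \<subseteq> newton_polytope f \<inter> coord_space J" by blast
  let ?S = "insert 0 (point ` keys f)"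
  have nn: "0 \<le> x $ i" if "x \<in> convex hull ?S" for x i
  proof -
    have "convex {x :: real ^ 'n. 0 \<le> x $ i}"
      using convex_halfspace_ge[where a = "axis i (1::real)" and b = 0] by (simp add: inner_axis')
    then have "convex hull ?S \<subseteq> {x. 0 \<le> x $ i}"
      by (intro hull_minimal) (auto simp: point_nonneg)
    then show ?thesis using that by blast
  qed
  let ?a = "(\<chi> i. if i \<in> J then 0 else -1) :: real ^ 'n"
  have a: "?a \<bullet> x = - (\<Sum>i\<in>- J. x $ i)" for x
  proof -
    have "?a \<bullet> x = (\<Sum>i\<in>- J. - x $ i)" unfolding inner_vec_def
      by (rule sum.mono_neutral_cong_right) auto
    then show ?thesis by (simp add: sum_negf)
  qed
  have eq: "newton_polytope f \<inter> coord_space J = convex hull ?S \<inter> {x. ?a \<bullet> x = 0}"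
  proof -
    have "x \<in> coord_space J \<longleftrightarrow> ?a \<bullet> x = 0" if "x \<in> convex hull ?S" for x
      unfolding a using nn[OF that] sum_nonneg_eq_0_iff[of "- J" "\<lambda>i. x $ i"] by (auto simp: coord_space_def)
    then show ?thesis by (auto simp: newton_polytope_def)
  qed
  have "convex hull ?S \<inter> {x. ?a \<bullet> x = 0} face_of convex hull ?S"
    by (rule face_of_Int_supporting_hyperplane_le) (auto simp: a intro!: sum_nonneg nn)
  then obtain S' where S': "S' \<subseteq> ?S" "newton_polytope f \<inter> coord_space J = convex hull S'"
    using face_of_convex_hull_subset[of ?S] unfolding eq by (metis finite.insertI finite_imageI finite_imp_compact finite_keys)
  have "S' \<subseteq> coord_space J" using S'(2) hull_subset[of S' convex] by blast
  then have "S' \<subseteq> insert 0 (point ` keys (set_zero (- J) f))"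
    using S'(1) point_in_coord_space unfolding k by fastforce
  then show "newton_polytope f \<inter> coord_space J \<subseteq> newton_polytope (set_zero (- J) f)"
    unfolding S'(2) unfolding newton_polytope_def by (rule hull_mono)
qed

text \<open>Both sides are gauges, one of P and one of P cut by \<open>coord_space J\<close>, so
  they agree at every positive level; being nonnegative, they are equal.\<close>

lemma newton_fun_set_zero:
  fixes f :: "'n::finite mpoly"
  assumes f: "convenient f" and J: "J \<noteq> {}" and m: "keys m \<subseteq> J"
  shows "newton_fun J (set_zero (- J) f) m = newton_fun UNIV f m"
proof -
  interpret U: convenient_on UNIV f "newton_polytope f" by (rule convenient_on_UNIV[OF f])
  interpret J: convenient_on J "set_zero (- J) f" "newton_polytope (set_zero (- J) f)"
    by (rule convenient_on_set_zero[OF f J])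
  have iff: "newton_fun J (set_zero (- J) f) m \<le> r \<longleftrightarrow> newton_fun UNIV f m \<le> r" if "0 < r" for r
  proof -
    have r: "0 < (of_rat r :: real)" using that by simp
    have "(1 / of_rat r) *\<^sub>R point m \<in> coord_space J"
      using m by (intro subspace_scale subspace_coord_space) (simp add: point_in_coord_space)
    then show ?thesis
      using J.newton_fun_le_iff_in_P[OF m r] U.newton_fun_le_iff_in_P[OF subset_UNIV r, of m]
      by (simp add: newton_polytope_set_zero of_rat_less_eq)
  qed
  have nn: "0 \<le> newton_fun J (set_zero (- J) f) m" "0 \<le> newton_fun UNIV f m"
    using J.newton_fun_nonneg[OF m] U.newton_fun_nonneg by auto
  have "\<not> a < b" if "0 \<le> a" "\<And>r. 0 < r \<Longrightarrow> a \<le> r \<Longrightarrow> b \<le> r" for a b :: rat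
  proof
    assume "a < b"
    then have "b \<le> (a + b) / 2" using that(1) by (intro that(2)) (auto simp: field_simps)
    then show False using \<open>a < b\<close> by (simp add: field_simps)
  qed
  from this[OF nn(1)] this[OF nn(2)] show ?thesis using iff by (meson linorder_neqE)
qed

section \<open>Homogenisation\<close>

lemma lookup_toric_deriv: "lookup (var j * pdiff j g) m = of_nat (lookup m j) * lookup g m"
proof -
  \<comment> \<open>Subtraction of exponents is truncated at 0, but where it truncates the
    coefficient is 0.\<close>
  have s: "Poly_Mapping.single (Poly_Mapping.single j 1 + (k - Poly_Mapping.single j 1)) (of_nat (lookup k j) * lookup g k)
      = Poly_Mapping.single k (of_nat (lookup k j) * lookup g k)" for k
  proof (cases "lookup k j = 0")
    case False
    then have "Poly_Mapping.single j 1 + (k - Poly_Mapping.single j 1) = k"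
      by (intro poly_mapping_eqI) (auto simp: lookup_add lookup_minus lookup_single when_def)
    then show ?thesis by simp
  qed simp
  have "var j * pdiff j g = (\<Sum>k\<in>keys g. Poly_Mapping.single k (of_nat (lookup k j) * lookup g k))"
    unfolding var_def pdiff_def sum_distrib_left mult_single by (simp only: mult_1 s)
  then show ?thesis
    by (auto simp: lookup_sum lookup_single when_def in_keys_iff if_distrib cong: if_cong)
qed

lemma keys_toric_deriv: "keys (var j * pdiff j g) = {m \<in> keys g. j \<in> keys m}"
  by (auto simp: in_keys_iff lookup_toric_deriv)

section \<open>The additional coordinate \<open>None\<close>, the exponent of t\<close>

definition lift_vec :: "real ^ 'n::finite \<Rightarrow> real \<Rightarrow> real ^ 'n option" where
  "lift_vec x s = (\<chi> k. case k of None \<Rightarrow> s | Some i \<Rightarrow> x $ i)"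

lemma lift_vec_nth [simp]: "lift_vec x s $ None = s" "lift_vec x s $ Some i = x $ i"
  by (simp_all add: lift_vec_def)

lemma vec_option_eq_iff: "x = y \<longleftrightarrow> x $ None = y $ None \<and> (\<forall>i. x $ Some i = y $ Some i)"
  for x y :: "'a ^ 'n::finite option"
  by (metis (full_types) not_None_eq vec_eq_iff)

lemma sum_option_UNIV: "(\<Sum>k\<in>UNIV. g k) = g None + (\<Sum>i\<in>UNIV. g (Some i))"
  for g :: "'n::finite option \<Rightarrow> 'a::comm_monoid_add"
  by (simp add: UNIV_option_conv sum.reindex)

lemma prod_option_UNIV: "(\<Prod>k\<in>UNIV. g k) = g None * (\<Prod>i\<in>UNIV. g (Some i))"
  for g :: "'n::finite option \<Rightarrow> 'a::comm_monoid_mult"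
  by (simp add: UNIV_option_conv prod.reindex)

lemma inner_vec_option: "x \<bullet> y = x $ None * y $ None + (\<Sum>i\<in>UNIV. x $ Some i * y $ Some i)"
  for x y :: "real ^ 'n::finite option"
  by (simp add: inner_vec_def sum_option_UNIV)

lemma inner_lift_vec: "lift_vec x s \<bullet> lift_vec y t = x \<bullet> y + s * t"
  by (simp add: inner_vec_option) (simp add: inner_vec_def)

definition emb :: "('n::finite \<Rightarrow>\<^sub>0 nat) \<Rightarrow> int \<Rightarrow> real ^ 'n option" where
  "emb m s = lift_vec (point m) (real_of_int s)"

lemma emb_add: "emb a s + emb b r = emb (a + b) (s + r)"
  by (simp add: emb_def vec_option_eq_iff point_add)

lemma emb_inj: "emb a s = emb b r \<longleftrightarrow> a = b \<and> s = r"
  unfolding emb_def using point_inj[of a b] by (auto simp: vec_option_eq_iff vec_eq_iff)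

lemma emb_in_lattice: "emb m s \<in> int_lattice"
proof -
  have "emb m s $ k \<in> \<int>" for k by (cases k) (simp_all add: emb_def point_def)
  then show ?thesis by (simp add: int_lattice_def)
qed

lemma exists_emb:
  assumes x: "x \<in> int_lattice" and s: "x $ None = real_of_int s" and nn: "\<And>i. 0 \<le> x $ Some i"
  obtains m where "x = emb m s"
proof
  define m where "m = Abs_poly_mapping (\<lambda>i. nat \<lfloor>x $ Some i\<rfloor>)"
  have "lookup m i = nat \<lfloor>x $ Some i\<rfloor>" for i by (simp add: m_def)
  then show "x = emb m s"
    using x s nn by (simp add: emb_def vec_option_eq_iff point_def int_lattice_def)
qed

text \<open>This is t^s g: every monomial receives the same exponent s, which records a bound for
  the Newton level rather than a degree.\<close>

definition hom :: "int \<Rightarrow> 'n::finite mpoly \<Rightarrow> ((real ^ 'n option) \<Rightarrow>\<^sub>0 complex)" where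
  "hom s g = (\<Sum>m\<in>keys g. Poly_Mapping.single (emb m s) (lookup g m))"

lemma lookup_hom: "lookup (hom s g) (emb m s) = lookup g m"
  by (auto simp: hom_def lookup_sum lookup_single when_def emb_inj in_keys_iff if_distrib cong: if_cong)

lemma lookup_hom_notin: "(\<And>m. x \<noteq> emb m s) \<Longrightarrow> lookup (hom s g) x = 0"
  unfolding hom_def lookup_sum by (intro sum.neutral) (auto simp: lookup_single when_def)

lemma hom_eqI:
  assumes "\<And>m. lookup G (emb m s) = lookup g m" "\<And>x. (\<And>m. x \<noteq> emb m s) \<Longrightarrow> lookup G x = 0"
  shows "G = hom s g"
proof (rule poly_mapping_eqI)
  fix x show "lookup G x = lookup (hom s g) x"
  proof (cases "\<exists>m. x = emb m s")
    case True then show ?thesis using assms(1) by (auto simp: lookup_hom)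
  next
    case False then show ?thesis using assms(2)[of x] lookup_hom_notin[of x s g] by auto
  qed
qed

lemma hom_add: "hom s g + hom s h = hom s (g + h)"
  by (rule hom_eqI) (auto simp: lookup_add lookup_hom lookup_hom_notin)

lemma hom_uminus: "- hom s h = hom s (- h)"
  by (rule hom_eqI) (auto simp: lookup_hom lookup_hom_notin)

lemma hom_zero [simp]: "hom s 0 = 0"
  by (simp add: hom_def)

lemma hom_sum: "(\<Sum>i\<in>I. hom s (g i)) = hom s (\<Sum>i\<in>I. g i)"
  by (induction I rule: infinite_finite_induct) (simp_all add: hom_add)

lemma hom_single: "hom s (Poly_Mapping.single m c) = Poly_Mapping.single (emb m s) c"
  by (rule hom_eqI[symmetric]) (auto simp: lookup_single when_def emb_inj)

lemma hom_inj: "hom s g = hom s h \<longleftrightarrow> g = h"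
  by (metis lookup_hom poly_mapping_eqI)

lemma keys_hom: "keys (hom s g) = (\<lambda>m. emb m s) ` keys g"
proof (intro set_eqI iffI)
  fix x assume x: "x \<in> keys (hom s g)"
  then obtain m where m: "x = emb m s" by (metis in_keys_iff lookup_hom_notin)
  then show "x \<in> (\<lambda>m. emb m s) ` keys g" using x by (auto simp: in_keys_iff lookup_hom)
qed (auto simp: in_keys_iff lookup_hom)

lemma hom_part: "part Q (hom s g) = hom s (part {m. emb m s \<in> Q} g)"
  by (rule hom_eqI) (auto simp: lookup_part lookup_hom lookup_hom_notin)

lemma hom_mult: "hom s g * hom r h = hom (s + r) (g * h)"
proof -
  have e: "(\<Sum>m\<in>keys p. Poly_Mapping.single m (lookup p m)) = p" for p :: "'a mpoly"
    by (subst (4) poly_mapping_expansion) (simp add: mult_single)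
  have "hom (s + r) (g * h) = hom (s + r) ((\<Sum>a\<in>keys g. Poly_Mapping.single a (lookup g a)) * (\<Sum>b\<in>keys h. Poly_Mapping.single b (lookup h b)))"
    by (simp add: e)
  also have "\<dots> = (\<Sum>a\<in>keys g. \<Sum>b\<in>keys h. Poly_Mapping.single (emb a s) (lookup g a) * Poly_Mapping.single (emb b r) (lookup h b))"
    by (simp add: sum_product mult_single hom_sum[symmetric] hom_single emb_add)
  finally show ?thesis by (simp add: hom_def sum_product)
qed

lemma exists_hom:
  assumes "keys G \<subseteq> {emb m s | m. m \<in> X}"
  obtains g where "G = hom s g" "keys g \<subseteq> X"
proof -
  define g where "g = Abs_poly_mapping (\<lambda>m. lookup G (emb m s))"
  have "inj (\<lambda>m. emb m s)" by (simp add: inj_def emb_inj)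
  then have "finite ((\<lambda>m. emb m s) -` keys G)" by (intro finite_vimageI) auto
  then have "finite {m. lookup G (emb m s) \<noteq> 0}" by (simp add: vimage_def in_keys_iff)
  then have l: "lookup g m = lookup G (emb m s)" for m by (simp add: g_def lookup_Abs_poly_mapping)
  show ?thesis
  proof
    show "G = hom s g"
      by (rule hom_eqI) (use assms l in \<open>auto simp: in_keys_iff subset_iff\<close>)
    show "keys g \<subseteq> X"
      using assms l by (auto simp: in_keys_iff subset_iff emb_inj)
  qed
qed

lemma laurent_eval_hom:
  assumes "0 \<le> s"
  shows "laurent_eval z (hom s g) = z None ^ nat s * eval_at (\<lambda>i. z (Some i)) g"
proof -
  have c: "laurent_char z (emb m s) = z None ^ nat s * (\<Prod>i\<in>UNIV. z (Some i) ^ lookup m i)" for m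
    using assms by (simp add: laurent_char_def prod_option_UNIV emb_def point_def power_int_def)
  have "inj_on (\<lambda>m. emb m s) (keys g)" by (simp add: inj_on_def emb_inj)
  then show ?thesis
    unfolding laurent_eval_def keys_hom eval_at_def
    by (simp add: sum.reindex lookup_hom c sum_distrib_left mult_ac)
qed

text \<open>A factor supported in W leaves the class of an exponent modulo W unchanged.\<close>

lemma part_mult_subspace:
  fixes W :: "'v::real_vector set"
  assumes W: "subspace W" and a: "keys (a :: 'v \<Rightarrow>\<^sub>0 complex) \<subseteq> W"
  shows "part W (a * b) = a * part W b"
proof -
  have "keys (a * part W b) \<subseteq> W" using a subspace_add[OF W] by (auto elim!: keys_mult_mem)
  moreover have "keys (a * part (- W) b) \<inter> W = {}"
  proof -
    have "m \<in> W" if "v + m \<in> W" "v \<in> keys a" for v m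
      using subspace_diff[OF W that(1), of v] a that(2) by auto
    then show ?thesis by (auto elim!: keys_mult_mem)
  qed
  moreover have "a * b = a * part W b + a * part (- W) b"
    by (simp flip: distrib_left add: part_compl)
  ultimately show ?thesis by (simp add: part_add part_id part_eq_0)
qed

lemma common_denominator:
  assumes "finite A"
  obtains D :: nat where "0 < D" "\<And>q. q \<in> A \<Longrightarrow> of_nat D * (q::rat) \<in> \<int>"
proof -
  have "\<exists>D>0. \<forall>q\<in>A. of_nat D * q \<in> \<int>"
    using assms
  proof (induction A)
    case empty show ?case by auto
  next
    case (insert q A)
    then obtain D where D: "D > 0" "\<forall>q\<in>A. of_nat D * q \<in> \<int>" by blast
    obtain a b where "quotient_of q = (a, b)" by fastforce
    then have ab: "q = of_int a / of_int b" "b > 0"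
      by (simp_all add: quotient_of_div quotient_of_denom_pos)
    show ?case
    proof (intro exI[of _ "D * nat b"] conjI ballI)
      show "0 < D * nat b" using D ab by simp
      fix x assume "x \<in> insert q A"
      then consider "x = q" | "x \<in> A" by blast
      then show "of_nat (D * nat b) * x \<in> \<int>"
      proof cases
        case 1
        then have "of_nat (D * nat b) * x = of_int (int D * a)" using ab by simp
        then show ?thesis by (metis Ints_of_int)
      next
        case 2
        then have "of_nat (D * nat b) * x = of_nat (nat b) * (of_nat D * x)" by simp
        then show ?thesis using D(2) 2 by (metis Ints_mult Ints_of_nat)
      qed
    qed
  qed
  then show ?thesis using that by blast
qed

section \<open>The cone over the Newton polytope\<close>

locale newton_poly =
  fixes f :: "'n::finite mpoly" and D :: nat
  assumes conv: "convenient f" and nondeg: "nondegenerate f" and D_pos: "0 < D"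
    and denom: "\<And>F i. F \<in> boundary_facets UNIV (newton_polytope f) \<Longrightarrow>
       of_nat D * facet_vec UNIV (newton_polytope f) F i \<in> \<int>"
begin

abbreviation P where "P \<equiv> newton_polytope f"

sublocale convenient_on UNIV f "newton_polytope f"
  by (rule convenient_on_UNIV[OF conv])

abbreviation nu :: "('n \<Rightarrow>\<^sub>0 nat) \<Rightarrow> rat" where "nu \<equiv> newton_fun UNIV f"

definition coord_vec :: "'n \<Rightarrow> real ^ 'n option" where
  "coord_vec i = axis (Some i) 1"

text \<open>Filtration levels are scaled by \<open>D\<close>, which makes all covectors integral.\<close>

definition facet_covec :: "(real ^ 'n) set \<Rightarrow> real ^ 'n option" where
  "facet_covec F = lift_vec (- real D *\<^sub>R facet_normal UNIV P F) 1"

definition C :: "(real ^ 'n option) set" where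
  "C = range coord_vec \<union> facet_covec ` boundary_facets UNIV P"

fun gen :: "'n option \<Rightarrow> 'n mpoly" where
  "gen None = 1"
| "gen (Some j) = var j * pdiff j f"

text \<open>Scaled levels: t shifts by one step, and each u_j df/du_j has exponents in P, hence
  Newton level at most 1, which is D steps.\<close>

fun wt :: "'n option \<Rightarrow> int" where
  "wt None = 1"
| "wt (Some j) = int D"

definition fk :: "'n option \<Rightarrow> ((real ^ 'n option) \<Rightarrow>\<^sub>0 complex)" where
  "fk a = hom (wt a) (gen a)"

lemma coord_vec_inner [simp]: "coord_vec i \<bullet> x = x $ Some i"
  by (simp add: coord_vec_def inner_axis')

lemma facet_covec_inner_lift: "facet_covec F \<bullet> lift_vec x s = s - real D * (facet_normal UNIV P F \<bullet> x)"
  by (simp add: facet_covec_def inner_lift_vec)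

lemma lift_vec_split: "x = lift_vec (\<chi> i. x $ Some i) (x $ None)"
  by (simp add: vec_option_eq_iff)

lemma lift_vec_in_cone:
  "(\<forall>c\<in>C. 0 \<le> c \<bullet> lift_vec x s) \<longleftrightarrow>
    (\<forall>i. 0 \<le> x $ i) \<and> (\<forall>F\<in>boundary_facets UNIV P. real D * (facet_normal UNIV P F \<bullet> x) \<le> s)"
  by (simp add: C_def ball_Un facet_covec_inner_lift)

lemma emb_in_cone: "(\<forall>c\<in>C. 0 \<le> c \<bullet> emb m s) \<longleftrightarrow> of_nat D * nu m \<le> of_int s"
proof -
  have "(\<forall>c\<in>C. 0 \<le> c \<bullet> emb m s) \<longleftrightarrow> (\<forall>F\<in>boundary_facets UNIV P. facet_normal UNIV P F \<bullet> point m \<le> real_of_int s / real D)"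
    unfolding emb_def lift_vec_in_cone using D_pos by (simp add: point_nonneg field_simps)
  also have "\<dots> \<longleftrightarrow> of_rat (nu m) \<le> real_of_int s / real D"
    by (rule newton_fun_le_iff[symmetric]) simp
  also have "\<dots> \<longleftrightarrow> (of_rat (of_nat D * nu m) :: real) \<le> of_rat (of_int s)"
    using D_pos by (simp add: of_rat_mult field_simps)
  finally show ?thesis by (simp only: of_rat_less_eq)
qed

lemma finite_C: "finite C"
  using finite_boundary_facets by (simp add: C_def)

lemma gen_keys_level: "v \<in> keys (gen a) \<Longrightarrow> of_nat D * nu v \<le> of_int (wt a)"
proof (cases a)
  case None
  assume "v \<in> keys (gen a)"
  then show ?thesis using None newton_fun_zero by simp
next
  case (Some j)
  assume "v \<in> keys (gen a)"
  then have "v \<in> keys f" using Some by (simp add: keys_toric_deriv)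
  then have "point v \<in> P" unfolding newton_polytope_def by (intro hull_inc) auto
  then have "of_rat (nu v) \<le> (1::real)" using newton_fun_le_iff_in_P[of v 1] by simp
  then have "nu v \<le> 1" by simp
  then show ?thesis using Some D_pos by (simp add: mult_left_le)
qed

lemma C_integral: "c \<in> C \<Longrightarrow> m \<in> int_lattice \<Longrightarrow> c \<bullet> m \<in> \<int>"
proof -
  assume c: "c \<in> C" and m: "m \<in> int_lattice"
  have "c $ k \<in> \<int>" for k
  proof -
    have "real D * of_rat (facet_vec UNIV P F i) \<in> \<int>" if F: "F \<in> boundary_facets UNIV P" for F i
    proof -
      obtain a where "of_nat D * facet_vec UNIV P F i = of_int a" using denom[OF F] by (auto elim: Ints_cases)
      then have "(of_rat (of_nat D * facet_vec UNIV P F i) :: real) = of_rat (of_int a)" by simp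
      then show ?thesis by (simp add: of_rat_mult)
    qed
    then show ?thesis using c
      by (cases k) (auto simp: C_def coord_vec_def facet_covec_def axis_def facet_normal_def)
  qed
  then have "c $ k * m $ k \<in> \<int>" for k using m by (simp add: int_lattice_def)
  then show ?thesis by (auto simp: inner_vec_def intro!: Ints_sum)
qed

lemma fk_keys:
  assumes "v \<in> keys (fk a)"
  obtains m where "v = emb m (wt a)" "m \<in> keys (gen a)"
  using assms by (auto simp: fk_def keys_hom)

lemma fk_cone: "v \<in> keys (fk a) \<Longrightarrow> c \<in> C \<Longrightarrow> 0 \<le> c \<bullet> v"
  using emb_in_cone gen_keys_level by (metis fk_keys)

lemma fk_lattice: "v \<in> keys (fk a) \<Longrightarrow> v \<in> int_lattice"
  by (metis fk_keys emb_in_lattice)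

sublocale K: lattice_cone fk C int_lattice N for N :: "'n option set"
  by standard (auto simp: finite_C C_integral fk_cone fk_lattice laurent.L_add)

section \<open>Faces of the cone and nondegeneracy\<close>

definition idx :: "'n set \<Rightarrow> 'n option set" where
  "idx J = insert None (Some ` J)"

definition coord_face :: "'n set \<Rightarrow> (real ^ 'n option) set" where
  "coord_face J = coord_vec ` (- J)"

lemma face_span_coord: "K.face_span (coord_face J) = {x. \<forall>i. i \<notin> J \<longrightarrow> x $ Some i = 0}"
  by (auto simp: K.face_span_def coord_face_def)

lemma dim_face_span_coord: "dim (K.face_span (coord_face J)) = card J + 1"
proof -
  have "K.face_span (coord_face J) = coord_space (idx J)"
    unfolding face_span_coord coord_space_def idx_def
    by auto
  then show ?thesis by (simp add: dim_coord_space idx_def card_image)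
qed

lemma is_face_coord: "K.is_face (coord_face J)"
proof -
  \<comment> \<open>A point inside the coordinate orthant of J, lifted above every facet bound by
    the choice of s, satisfies the remaining inequalities strictly.\<close>
  define x :: "real ^ 'n" where "x = (\<chi> i. if i \<in> J then 1 else 0)"
  define s where "s = 1 + (\<Sum>F\<in>boundary_facets UNIV P. \<bar>real D * (facet_normal UNIV P F \<bullet> x)\<bar>)"
  have s: "real D * (facet_normal UNIV P F \<bullet> x) < s" if "F \<in> boundary_facets UNIV P" for F
  proof -
    have "\<bar>real D * (facet_normal UNIV P F \<bullet> x)\<bar> \<le> (\<Sum>F\<in>boundary_facets UNIV P. \<bar>real D * (facet_normal UNIV P F \<bullet> x)\<bar>)"
      using that finite_boundary_facets by (intro member_le_sum) auto
    then show ?thesis by (simp add: s_def)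
  qed
  show ?thesis unfolding K.is_face_def
  proof (intro conjI exI[of _ "lift_vec x s"] ballI)
    show "coord_face J \<subseteq> C" by (auto simp: coord_face_def C_def)
    show "c \<bullet> lift_vec x s = 0" if "c \<in> coord_face J" for c using that by (auto simp: coord_face_def x_def)
    show "0 < c \<bullet> lift_vec x s" if "c \<in> C - coord_face J" for c
      using that s by (auto simp: C_def coord_face_def x_def facet_covec_inner_lift)
  qed
qed

text \<open>At height D the cross-section of the cone is P itself, so a face of the cone appears as
  a face of P.\<close>

definition slice :: "(real ^ 'n option) set \<Rightarrow> (real ^ 'n) set" where
  "slice Z = {x \<in> P. \<forall>c\<in>Z. c \<bullet> lift_vec x (real D) = 0}"

lemma cone_nonneg_on_P: "x \<in> P \<Longrightarrow> c \<in> C \<Longrightarrow> 0 \<le> c \<bullet> lift_vec x (real D)"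
  using in_P_iff[of x] D_pos lift_vec_in_cone[of x "real D"] by (auto simp: mult_left_le)

text \<open>The witness of Z, rescaled to height D, shows that the slice is nonempty; the facet
  normal contained in Z keeps the origin out of it.\<close>

lemma slice_in_boundary_faces:
  assumes Z: "K.is_face Z" and d: "0 < dim (K.face_span Z)"
    and F0: "F0 \<in> boundary_facets UNIV P" "facet_covec F0 \<in> Z"
  shows "slice Z \<in> boundary_faces P"
proof -
  obtain w where w: "\<And>c. c \<in> Z \<Longrightarrow> c \<bullet> w = 0" "\<And>c. c \<in> C - Z \<Longrightarrow> 0 < c \<bullet> w" and ZC: "Z \<subseteq> C"
    using Z unfolding K.is_face_def by blast
  have fZ: "finite Z" using ZC finite_C finite_subset by blast
  have wC: "0 \<le> c \<bullet> w" if "c \<in> C" for c using w that by (cases "c \<in> Z") (auto simp: less_imp_le)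
  define x :: "real ^ 'n" where "x = (\<chi> i. w $ Some i)"
  define s where "s = w $ None"
  have w_eq: "w = lift_vec x s" unfolding x_def s_def by (rule lift_vec_split)
  have x0: "0 \<le> x $ i" for i using wC[of "coord_vec i"] by (simp add: C_def x_def)
  have xF: "real D * (facet_normal UNIV P F \<bullet> x) \<le> s" if "F \<in> boundary_facets UNIV P" for F
    using wC[of "facet_covec F"] that by (simp add: C_def w_eq facet_covec_inner_lift)
  \<comment> \<open>At height 0 or below the witness would be 0, so Z would be all of C and the face
    only the apex, contrary to positive dimension.\<close>
  have "0 < s"
  proof (rule ccontr)
    assume s: "\<not> 0 < s"
    have "facet_normal UNIV P F \<bullet> x \<le> 0" if "F \<in> boundary_facets UNIV P" for F
      using xF[OF that] s D_pos by (smt (verit) mult_pos_pos of_nat_0_less_iff)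
    then have "x = 0" using x0 by (intro zero_if_nonpos) (auto simp: coord_space_def)
    moreover have "s = 0" using w(1)[OF F0(2)] \<open>x = 0\<close> by (simp add: w_eq facet_covec_inner_lift)
    ultimately have "w = 0" by (simp add: w_eq vec_option_eq_iff)
    then have "Z = C" using w(2) ZC by fastforce
    have "y = 0" if "y \<in> K.face_span Z" for y
    proof -
      have y: "c \<bullet> y = 0" if "c \<in> C" for c using \<open>y \<in> K.face_span Z\<close> that \<open>Z = C\<close> by (simp add: K.face_span_def)
      have 1: "y $ Some i = 0" for i using y[of "coord_vec i"] by (simp add: C_def)
      then have "y = lift_vec 0 (y $ None)" by (simp add: vec_option_eq_iff)
      then have "facet_covec F0 \<bullet> y = y $ None" by (metis facet_covec_inner_lift inner_zero_right mult_zero_right diff_zero)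
      then have "y $ None = 0" using y[of "facet_covec F0"] F0 by (simp add: C_def)
      then show ?thesis using 1 by (simp add: vec_option_eq_iff)
    qed
    then have "K.face_span Z \<subseteq> {0}" by blast
    then show False using d by (metis dim_eq_0 less_irrefl)
  qed
  define x' where "x' = (real D / s) *\<^sub>R x"
  have x'_lift: "lift_vec x' (real D) = (real D / s) *\<^sub>R w"
    using \<open>0 < s\<close> by (simp add: w_eq x'_def vec_option_eq_iff)
  have "x' \<in> P" unfolding in_P_iff
    using x0 xF \<open>0 < s\<close> D_pos by (auto simp: x'_def coord_space_def field_simps)
  moreover have "c \<bullet> lift_vec x' (real D) = 0" if "c \<in> Z" for c
    using w(1)[OF that] by (simp add: x'_lift)
  ultimately have ne: "slice Z \<noteq> {}" by (auto simp: slice_def)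
  have z: "0 \<notin> slice Z"
    using F0 D_pos by (auto simp: slice_def facet_covec_inner_lift intro!: bexI[of _ "facet_covec F0"])
  \<comment> \<open>Every c in Z is nonnegative on P, so their sum vanishes exactly where all of
    them do and supports the slice by one functional.\<close>
  define q where "q = (\<Sum>c\<in>Z. c)"
  define a :: "real ^ 'n" where "a = (\<chi> i. q $ Some i)"
  have q: "(\<Sum>c\<in>Z. c \<bullet> lift_vec y (real D)) = a \<bullet> y + q $ None * real D" for y
  proof -
    have "(\<Sum>c\<in>Z. c \<bullet> lift_vec y (real D)) = q \<bullet> lift_vec y (real D)" by (simp add: q_def inner_sum_left)
    also have "q = lift_vec a (q $ None)" unfolding a_def by (rule lift_vec_split)
    finally show ?thesis by (simp add: inner_lift_vec)
  qed
  have "slice Z = P \<inter> {y. a \<bullet> y = - (q $ None * real D)}"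
  proof -
    have "(\<forall>c\<in>Z. c \<bullet> lift_vec y (real D) = 0) \<longleftrightarrow> a \<bullet> y = - (q $ None * real D)" if "y \<in> P" for y
    proof -
      have "(\<forall>c\<in>Z. c \<bullet> lift_vec y (real D) = 0) \<longleftrightarrow> (\<Sum>c\<in>Z. c \<bullet> lift_vec y (real D)) = 0"
        using cone_nonneg_on_P[OF that] ZC fZ by (subst sum_nonneg_eq_0_iff) auto
      then show ?thesis unfolding q by linarith
    qed
    then show ?thesis by (auto simp: slice_def)
  qed
  moreover have "- (q $ None * real D) \<le> a \<bullet> y" if "y \<in> P" for y
  proof -
    have "0 \<le> (\<Sum>c\<in>Z. c \<bullet> lift_vec y (real D))"
      using cone_nonneg_on_P[OF that] ZC by (intro sum_nonneg) auto
    then show ?thesis unfolding q by linarith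
  qed
  ultimately have "slice Z face_of P"
    using face_of_Int_supporting_hyperplane_ge[OF convex_P, of "- (q $ None * real D)" a] by simp
  then show ?thesis using ne z by (auto simp: boundary_faces_def newton_boundary_def)
qed

lemma subspace_face_span: "subspace (K.face_span Z)"
  by (rule K.subspace_face_span)

text \<open>If Z contains no facet covector, t lies in the span of the face and is invertible in its
  group ring. Otherwise the parts of the u_j df/du_j on that span are powers of t times their parts
  on a boundary face of P, so a common zero in the torus would contradict nondegeneracy.\<close>

lemma unit_ideal:
  assumes Z: "K.is_face Z" "coord_face J \<subseteq> Z" and d: "0 < dim (K.face_span Z)"
  obtains g where "\<And>a. keys (g a) \<subseteq> int_lattice \<inter> K.face_span Z"
    "(\<Sum>a\<in>idx J. part (K.face_span Z) (fk a) * g a) = 1"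
proof (cases "\<exists>F\<in>boundary_facets UNIV P. facet_covec F \<in> Z")
  case False
  let ?t = "lift_vec 0 1 :: real ^ 'n option"
  have "Z \<subseteq> C" using Z(1) by (simp add: K.is_face_def)
  then have "Z \<subseteq> range coord_vec" using False by (auto simp: C_def)
  then have t: "?t \<in> K.face_span Z" by (auto simp: K.face_span_def subset_iff)
  define g where "g a = (if a = None then Poly_Mapping.single (- ?t) (1::complex) else 0)" for a :: "'n option"
  show ?thesis
  proof (rule that[of g])
    have "- ?t \<in> int_lattice"
    proof -
      have "(- ?t) $ k \<in> \<int>" for k by (cases k) auto
      then show ?thesis by (simp add: int_lattice_def)
    qed
    then show "keys (g a) \<subseteq> int_lattice \<inter> K.face_span Z" for a
      using subspace_neg[OF subspace_face_span t] by (simp add: g_def)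
    have "fk None = Poly_Mapping.single ?t 1"
      unfolding fk_def by (simp add: hom_single[of 1 0 1, simplified] emb_def)
    moreover have "part (K.face_span Z) (Poly_Mapping.single ?t (1::complex)) = Poly_Mapping.single ?t 1"
      using t by (intro part_id) simp
    moreover have "(\<Sum>a\<in>idx J. part (K.face_span Z) (fk a) * g a) = part (K.face_span Z) (fk None) * g None"
      by (subst sum.remove[of _ None]) (auto simp: idx_def g_def intro!: sum.neutral)
    ultimately show "(\<Sum>a\<in>idx J. part (K.face_span Z) (fk a) * g a) = 1"
      by (simp add: g_def mult_single)
  qed
next
  case True
  then obtain F0 where F0: "F0 \<in> boundary_facets UNIV P" "facet_covec F0 \<in> Z" by blast
  have bf: "slice Z \<in> boundary_faces P" by (rule slice_in_boundary_faces[OF Z(1) d F0])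
  let ?F = "\<lambda>a. part (K.face_span Z) (fk a)"
  have nz: "\<exists>a\<in>idx J. laurent_eval z (?F a) \<noteq> 0" if z: "\<And>k. z k \<noteq> 0" for z
  proof (rule ccontr)
    assume no: "\<not> (\<exists>a\<in>idx J. laurent_eval z (?F a) \<noteq> 0)"
    have "eval_at (\<lambda>i. z (Some i)) (face_part (slice Z) (var i * pdiff i f)) = 0" for i
    proof (cases "i \<in> J")
      case True
      have "?F (Some i) = hom (int D) (part {m. emb m (int D) \<in> K.face_span Z} (var i * pdiff i f))"
        by (simp add: fk_def hom_part)
      also have "part {m. emb m (int D) \<in> K.face_span Z} (var i * pdiff i f) = face_part (slice Z) (var i * pdiff i f)"
      proof (rule poly_mapping_eqI)
        fix m
        have "point m \<in> P" if "m \<in> keys (var i * pdiff i f)"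
          using that unfolding newton_polytope_def by (intro hull_inc) (auto simp: keys_toric_deriv)
        then show "lookup (part {m. emb m (int D) \<in> K.face_span Z} (var i * pdiff i f)) m = lookup (face_part (slice Z) (var i * pdiff i f)) m"
          by (auto simp: face_part_def monomial_part_eq lookup_part slice_def emb_def K.face_span_def in_keys_iff)
      qed
      finally have "laurent_eval z (?F (Some i)) = z None ^ D * eval_at (\<lambda>i. z (Some i)) (face_part (slice Z) (var i * pdiff i f))"
        by (simp add: laurent_eval_hom)
      moreover have "laurent_eval z (?F (Some i)) = 0" using no True by (auto simp: idx_def)
      ultimately show ?thesis using z by simp
    next
      case False
      \<comment> \<open>On the slice the coordinate i vanishes, so the i-th equation holds trivially
        and the equations indexed by J give all n of them.\<close>
      then have "coord_vec i \<in> Z" using Z(2) by (auto simp: coord_face_def)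
      have "face_part (slice Z) (var i * pdiff i f) = 0"
        unfolding face_part_def monomial_part_eq
      proof (rule part_eq_0, rule ccontr)
        assume "keys (var i * pdiff i f) \<inter> {m. point m \<in> slice Z} \<noteq> {}"
        then obtain m where m: "i \<in> keys m" "point m \<in> slice Z" by (auto simp: keys_toric_deriv)
        then have "coord_vec i \<bullet> lift_vec (point m) (real D) = 0" using \<open>coord_vec i \<in> Z\<close> by (simp only: slice_def mem_Collect_eq)
        then show False using m(1) by (simp add: point_def in_keys_iff)
      qed
      then show ?thesis by (simp add: eval_at_def)
    qed
    then have "\<exists>y. (\<forall>i. y i \<noteq> 0) \<and> (\<forall>i. eval_at y (face_part (slice Z) (var i * pdiff i f)) = 0)"
      using z by (intro exI[of _ "\<lambda>i. z (Some i)"]) simp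
    moreover note bspec[OF nondeg[unfolded nondegenerate_def] bf]
    ultimately show False by (rule notE[rotated])
  qed
  have "finite (idx J)" and lat: "keys (?F a) \<subseteq> int_lattice" for a using fk_lattice by auto
  then obtain g where g: "\<And>a. keys (g a) \<subseteq> int_lattice" "(\<Sum>a\<in>idx J. ?F a * g a) = 1"
    using laurent_nullstellensatz[OF _ lat nz] by blast
  show ?thesis
  \<comment> \<open>The generators already lie over the span, so projecting the coefficients to it
    preserves the identity.\<close>
  proof (rule that[of "\<lambda>a. part (K.face_span Z) (g a)"])
    show "keys (part (K.face_span Z) (g a)) \<subseteq> int_lattice \<inter> K.face_span Z" for a using g(1) by auto
    have "1 = part (K.face_span Z) (\<Sum>a\<in>idx J. ?F a * g a)"
      unfolding g(2) using subspace_0[OF subspace_face_span] by (intro part_id[symmetric]) simp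
    also have "\<dots> = (\<Sum>a\<in>idx J. ?F a * part (K.face_span Z) (g a))"
      unfolding part_sum by (intro sum.cong refl part_mult_subspace subspace_face_span) simp
    finally show "(\<Sum>a\<in>idx J. ?F a * part (K.face_span Z) (g a)) = 1" by simp
  qed
qed

lemma exact_at_coord:
  assumes "p \<le> int (card J)"
  shows "exact_at fk (on_subsets (idx J) (K.conic_pts (coord_face J) 0)) p"
proof (rule K.exact_at_conic[OF _ is_face_coord order_refl])
  show "p < int (dim (K.face_span (coord_face J)))" using assms by (simp add: dim_face_span_coord)
  fix Z y p assume Z: "K.is_face Z" "coord_face J \<subseteq> Z" "0 < dim (K.face_span Z)"
  obtain g where g: "\<And>a. keys (g a) \<subseteq> int_lattice \<inter> K.face_span Z"
    "(\<Sum>a\<in>idx J. part (K.face_span Z) (fk a) * g a) = 1"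
    using unit_ideal[OF Z] by blast
  have "exact_at fk (\<lambda>A. if A \<subseteq> idx J then K.group_pts Z y else {}) p"
  proof (rule exact_at_unit[OF _ _ g(2)])
    show "v + m \<in> K.group_pts Z y \<longleftrightarrow> v \<in> K.face_span Z"
      if "v \<in> keys (fk a)" "m \<in> K.group_pts Z y" for a v m
      using that fk_lattice[OF that(1)] laurent.L_add[of v m]
      by (auto simp: K.group_pts_def K.face_span_def inner_add_right)
    show "v + m \<in> K.group_pts Z y" if "v \<in> keys (g a)" "m \<in> K.group_pts Z y" for a v m
    proof -
      have "v \<in> int_lattice" "v \<in> K.face_span Z" using g(1)[of a] that(1) by auto
      then show ?thesis using that(2) laurent.L_add[of v m]
        by (auto simp: K.group_pts_def K.face_span_def inner_add_right)
    qed
  qed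
  then show "exact_at fk (on_subsets (idx J) (K.group_pts Z y)) p"
    by (simp add: on_subsets_def[abs_def])
qed

end

section \<open>Regular forms along the coordinate hyperplanes\<close>

context newton_poly
begin

lemma conic_coord:
  "x \<in> K.conic_pts (coord_face J) 0 \<longleftrightarrow>
    x \<in> int_lattice \<and> (\<forall>i. i \<notin> J \<longrightarrow> x $ Some i = 0) \<and> (\<forall>c\<in>C. 0 \<le> c \<bullet> x)"
  by (auto simp: K.conic_pts_def K.group_pts_def coord_face_def)

lemma cone_coord_nonneg: "\<forall>c\<in>C. 0 \<le> c \<bullet> x \<Longrightarrow> 0 \<le> x $ Some i"
  by (auto simp: C_def ball_Un)

lemma fk_coord_ge: "v \<in> keys (fk (Some j)) \<Longrightarrow> 1 \<le> v $ Some j"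
  by (erule fk_keys) (auto simp: emb_def point_def keys_toric_deriv in_keys_iff)

lemma fk_level: "v \<in> keys (fk a) \<Longrightarrow> v $ None = real_of_int (wt a)"
  by (auto elim!: fk_keys simp: emb_def)

text \<open>The Koszul complex of logarithmic forms \<open>du\<^sub>j / u\<^sub>j\<close>, restricted to forms that are regular
  along \<open>u\<^sub>i = 0\<close> for \<open>i \<in> S\<close>.\<close>

definition mixed :: "'n set \<Rightarrow> 'n set \<Rightarrow> 'n option set \<Rightarrow> (real ^ 'n option) set" where
  "mixed S J A = (if A \<subseteq> idx J
     then {x \<in> K.conic_pts (coord_face J) 0. \<forall>i\<in>S. Some i \<in> A \<longrightarrow> 1 \<le> x $ Some i} else {})"

text \<open>Adding e_j asks for one more factor u_j, and u_j df/du_j supplies it.\<close>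

lemma mixed_step:
  assumes m: "\<forall>c\<in>C. 0 \<le> c \<bullet> m" "\<forall>i\<in>S. Some i \<in> A \<longrightarrow> 1 \<le> m $ Some i" and v: "v \<in> keys (fk j)"
  shows "\<forall>c\<in>C. 0 \<le> c \<bullet> (v + m)" "\<forall>i\<in>S. Some i \<in> insert j A \<longrightarrow> 1 \<le> (v + m) $ Some i"
proof -
  show "\<forall>c\<in>C. 0 \<le> c \<bullet> (v + m)" using m(1) fk_cone[OF v] by (simp add: inner_add_right)
  have v0: "0 \<le> v $ Some i" for i using fk_cone[OF v] by (intro cone_coord_nonneg) blast
  have m0: "0 \<le> m $ Some i" for i using m(1) by (rule cone_coord_nonneg)
  show "\<forall>i\<in>S. Some i \<in> insert j A \<longrightarrow> 1 \<le> (v + m) $ Some i"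
  proof (intro ballI impI)
    fix i assume i: "i \<in> S" "Some i \<in> insert j A"
    show "1 \<le> (v + m) $ Some i"
    proof (cases "Some i = j")
      case True
      then have "1 \<le> v $ Some i" using v fk_coord_ge by blast
      then show ?thesis using m0[of i] by simp
    next
      case False
      then have "1 \<le> m $ Some i" using i m(2) by auto
      then show ?thesis using v0[of i] by simp
    qed
  qed
qed

lemma loc_closed_mixed: "loc_closed fk (mixed S J)"
  unfolding loc_closed_def
proof (intro exI conjI allI)
  let ?U = "\<lambda>A. {x \<in> int_lattice. (\<forall>c\<in>C. 0 \<le> c \<bullet> x) \<and> (\<forall>i\<in>S. Some i \<in> A \<longrightarrow> 1 \<le> x $ Some i)}"
  let ?U' = "\<lambda>A. {x \<in> ?U A. \<not> A \<subseteq> idx J \<or> (\<exists>i. i \<notin> J \<and> 0 < x $ Some i)}"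
  show U: "d_closed fk ?U" unfolding d_closed_def
  proof (intro allI impI)
    fix A j v m assume v: "v \<in> keys (fk j)" and m: "m \<in> ?U A"
    show "v + m \<in> ?U (insert j A)"
      using mixed_step[of m S A v j] m v laurent.L_add[OF fk_lattice[OF v]] by simp
  qed
  show "d_closed fk ?U'" unfolding d_closed_def
  proof (intro allI impI)
    fix A j v m assume j: "j \<notin> A" and v: "v \<in> keys (fk j)" and m: "m \<in> ?U' A"
    have "v + m \<in> ?U (insert j A)" using U j v m unfolding d_closed_def by blast
    moreover have "0 \<le> v $ Some i" for i using fk_cone[OF v] by (intro cone_coord_nonneg) blast
    then have "0 < (v + m) $ Some i" if "0 < m $ Some i" for i using that by (simp add: add_nonneg_pos)
    ultimately show "v + m \<in> ?U' (insert j A)" using m by auto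
  qed
  fix A
  have "x $ Some i = 0 \<longleftrightarrow> \<not> 0 < x $ Some i" if "\<forall>c\<in>C. 0 \<le> c \<bullet> x" for x i
    using cone_coord_nonneg[OF that, of i] by linarith
  then show "mixed S J A = ?U A - ?U' A"
    unfolding mixed_def conic_coord by auto
qed

text \<open>Passing from \<open>S\<close> to \<open>S \<union> {i}\<close> divides out the complex of the hyperplane \<open>u\<^sub>i = 0\<close>, shifted
  by one.\<close>

lemma exact_at_mixed:
  assumes "S \<subseteq> J" "p \<le> int (card J)"
  shows "exact_at fk (mixed S J) p"
proof -
  have "finite S" by simp
  then show ?thesis using assms
  proof (induction S arbitrary: J p)
    case empty
    have "mixed {} J = on_subsets (idx J) (K.conic_pts (coord_face J) 0)"
      by (rule ext) (simp add: mixed_def on_subsets_def)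
    then show ?case using exact_at_coord empty by simp
  next
    case (insert i S)
    \<comment> \<open>The forms with an actual pole along u_i = 0: e_i is present and the
      coefficient is not divisible by u_i.\<close>
    define Q2 where "Q2 A = (if Some i \<in> A then mixed S (J - {i}) (A - {Some i}) else {})" for A
    have i: "i \<in> J" "S \<subseteq> J" "S \<subseteq> J - {i}" using insert by auto
    have Q2: "Q2 A = {x \<in> mixed S J A. Some i \<in> A \<and> x $ Some i = 0}" for A
    proof -
      have "A \<subseteq> idx J \<longleftrightarrow> A - {Some i} \<subseteq> idx (J - {i})" if "Some i \<in> A"
        using i by (auto simp: idx_def)
      moreover have "(\<forall>k\<in>S. Some k \<in> A \<longrightarrow> 1 \<le> x $ Some k) \<longleftrightarrow> (\<forall>k\<in>S. Some k \<in> A - {Some i} \<longrightarrow> 1 \<le> x $ Some k)" for x :: "real ^ 'n option"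
        using insert.hyps by auto
      moreover have "x \<in> K.conic_pts (coord_face (J - {i})) 0 \<longleftrightarrow> x \<in> K.conic_pts (coord_face J) 0 \<and> x $ Some i = 0" for x
        using i unfolding conic_coord by auto
      ultimately show ?thesis by (auto simp: Q2_def mixed_def)
    qed
    have split: "x $ Some i = 0 \<or> 1 \<le> x $ Some i" if "x \<in> mixed S J A" for x A
    proof -
      have "x \<in> int_lattice" "0 \<le> x $ Some i"
        using that cone_coord_nonneg by (auto simp: mixed_def conic_coord split: if_splits)
      then obtain k :: int where "x $ Some i = real_of_int k" by (auto simp: int_lattice_def elim: Ints_cases)
      then show ?thesis using \<open>0 \<le> x $ Some i\<close> by auto
    qed
    show ?case
    proof (rule exact_at_sub[OF loc_closed_mixed[of S J], of "mixed (insert i S) J" Q2])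
      show "mixed S J A = mixed (insert i S) J A \<union> Q2 A" for A
      proof -
        have "mixed (insert i S) J A = {x \<in> mixed S J A. Some i \<in> A \<longrightarrow> 1 \<le> x $ Some i}"
          by (auto simp: mixed_def)
        then show ?thesis unfolding Q2 using split by blast
      qed
      show "mixed (insert i S) J A \<inter> Q2 A = {}" for A
        unfolding Q2 by (auto simp: mixed_def split: if_splits)
      show "v + m \<in> mixed (insert i S) J (insert j A)"
        if "j \<notin> A" "v \<in> keys (fk j)" "m \<in> mixed (insert i S) J A" "v + m \<in> mixed S J (insert j A)" for A j v m
      proof -
        have "\<forall>c\<in>C. 0 \<le> c \<bullet> m" "\<forall>k\<in>insert i S. Some k \<in> A \<longrightarrow> 1 \<le> m $ Some k"
          using that(3) by (auto simp: mixed_def conic_coord split: if_splits)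
        from mixed_step(2)[OF this that(2)] show ?thesis
          using that(4) by (auto simp: mixed_def split: if_splits)
      qed
      show "exact_at fk (mixed S J) p" using insert i by simp
      show "exact_at fk Q2 (p - 1)"
      proof (rule exact_at_shift[of Q2 "Some i" "mixed S (J - {i})"])
        show "Q2 A = (if Some i \<in> A then mixed S (J - {i}) (A - {Some i}) else {})" for A by (rule Q2_def)
        show "mixed S (J - {i}) A = {}" if "Some i \<in> A" for A
          using that by (auto simp: mixed_def idx_def)
        have "int (card J) = int (card (J - {i})) + 1" using card_Suc_Diff1[of J i] i by simp
        then have "p - 1 - 1 \<le> int (card (J - {i}))" using insert.prems by linarith
        then show "exact_at fk (mixed S (J - {i})) (p - 1 - 1)" using insert.IH i(3) by blast
      qed
    qed
  qed
qed

text \<open>The differential adds an index a to A and \<open>wt a\<close> to the exponent of t, so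
  the exponent minus the weight of A is invariant; r is its value.\<close>

definition graded :: "'n set \<Rightarrow> 'n set \<Rightarrow> int \<Rightarrow> 'n option set \<Rightarrow> (real ^ 'n option) set" where
  "graded S J r A = {x \<in> mixed S J A. x $ None = real_of_int (r + (\<Sum>a\<in>A. wt a))}"

lemma exact_at_graded:
  assumes "S \<subseteq> J" "p \<le> int (card J)"
  shows "exact_at fk (graded S J r) p"
proof (rule exact_at_summand[OF _ _ exact_at_mixed[OF assms]])
  show "graded S J r A \<subseteq> mixed S J A" for A by (auto simp: graded_def)
  show "m \<in> graded S J r A \<longleftrightarrow> v + m \<in> graded S J r (insert j A)"
    if "j \<notin> A" "v \<in> keys (fk j)" "m \<in> mixed S J A" "v + m \<in> mixed S J (insert j A)" for A j v m
    using that fk_level[OF that(2)] by (auto simp: graded_def)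
qed

section \<open>Relations between t and the toric derivatives\<close>

definition pts :: "'n set \<Rightarrow> 'n set \<Rightarrow> int \<Rightarrow> ('n \<Rightarrow>\<^sub>0 nat) set" where
  "pts S J s = {m. keys m \<subseteq> J \<and> S \<subseteq> keys m \<and> of_nat D * nu m \<le> of_int s}"

lemma pts_mono: "s \<le> s' \<Longrightarrow> pts S J s \<subseteq> pts S J s'"
  unfolding pts_def by (auto intro: order_trans)

text \<open>The variables by which the component of a form at the complement of B must be
  divisible.\<close>

definition drop_idx :: "'n set \<Rightarrow> 'n option set \<Rightarrow> 'n set" where
  "drop_idx S B = {i \<in> S. Some i \<notin> B}"

text \<open>Components are indexed by the complement B of A. The offset places the top component, B
  = {}, at level s, and each index in B lowers the level by its weight.\<close>

lemma emb_in_graded: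
  assumes "S \<subseteq> J" "B \<subseteq> idx J"
  shows "emb m r \<in> graded S J (s - (\<Sum>a\<in>idx J. wt a)) (idx J - B) \<longleftrightarrow>
    m \<in> pts (drop_idx S B) J r \<and> r = s - (\<Sum>a\<in>B. wt a)"
proof -
  have "(\<Sum>a\<in>idx J - B. wt a) = (\<Sum>a\<in>idx J. wt a) - (\<Sum>a\<in>B. wt a)"
    using assms(2) by (intro sum_diff) auto
  then have "emb m r $ None = real_of_int (s - (\<Sum>a\<in>idx J. wt a) + (\<Sum>a\<in>idx J - B. wt a)) \<longleftrightarrow> r = s - (\<Sum>a\<in>B. wt a)"
    unfolding emb_def lift_vec_nth of_int_eq_iff by linarith
  moreover have "emb m r \<in> mixed S J (idx J - B) \<longleftrightarrow> m \<in> pts (drop_idx S B) J r"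
  proof -
    have "(\<forall>i. i \<notin> J \<longrightarrow> emb m r $ Some i = 0) \<longleftrightarrow> keys m \<subseteq> J"
      by (auto simp: emb_def point_def in_keys_iff)
    moreover have "(\<forall>i\<in>S. Some i \<in> idx J - B \<longrightarrow> 1 \<le> emb m r $ Some i) \<longleftrightarrow> drop_idx S B \<subseteq> keys m"
      using assms(1) by (auto simp: emb_def point_def in_keys_iff drop_idx_def idx_def Suc_le_eq)
    ultimately show ?thesis
      by (auto simp: mixed_def conic_coord pts_def emb_in_lattice emb_in_cone)
  qed
  ultimately show ?thesis unfolding graded_def by blast
qed

lemma graded_is_emb:
  assumes "x \<in> graded S J (s - (\<Sum>a\<in>idx J. wt a)) (idx J - B)" "B \<subseteq> idx J"
  shows "\<exists>m. x = emb m (s - (\<Sum>a\<in>B. wt a))"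
proof -
  have e: "(\<Sum>a\<in>idx J - B. wt a) = (\<Sum>a\<in>idx J. wt a) - (\<Sum>a\<in>B. wt a)"
    using assms(2) by (intro sum_diff) auto
  have x: "x \<in> int_lattice" "\<forall>c\<in>C. 0 \<le> c \<bullet> x" "x $ None = real_of_int (s - (\<Sum>a\<in>B. wt a))"
    using assms(1) by (auto simp: graded_def mixed_def conic_coord e split: if_splits)
  show ?thesis using exists_emb[OF x(1,3)] cone_coord_nonneg[OF x(2)] by metis
qed

abbreviation restr :: "'n set \<Rightarrow> 'n mpoly \<Rightarrow> 'n mpoly" where
  "restr J \<equiv> part {m. keys m \<subseteq> J}"

text \<open>Levels add because the cone is closed under addition, and the factor u_b missing from m
  is contributed by the generator.\<close>

lemma gen_mult_keys:
  assumes v: "v \<in> keys (gen b)" and m: "m \<in> pts (drop_idx S {a, b}) J' (r - wt b)" and k: "keys (v + m) \<subseteq> J"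
  shows "v + m \<in> pts (drop_idx S {a}) J r"
proof -
  have kvm: "keys (v + m) = keys v \<union> keys m" by (auto simp: in_keys_iff lookup_add)
  have "\<forall>c\<in>C. 0 \<le> c \<bullet> emb v (wt b)" unfolding emb_in_cone by (rule gen_keys_level[OF v])
  moreover have "\<forall>c\<in>C. 0 \<le> c \<bullet> emb m (r - wt b)" unfolding emb_in_cone using m by (simp add: pts_def)
  moreover have "emb (v + m) r = emb v (wt b) + emb m (r - wt b)" by (simp add: emb_add)
  ultimately have "\<forall>c\<in>C. 0 \<le> c \<bullet> emb (v + m) r" by (simp add: inner_add_right)
  then have "of_nat D * nu (v + m) \<le> of_int r" unfolding emb_in_cone by simp
  moreover have "drop_idx S {a} \<subseteq> keys (v + m)"
  proof
    fix i assume i: "i \<in> drop_idx S {a}"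
    show "i \<in> keys (v + m)"
    proof (cases "Some i = b")
      case True
      then have "i \<in> keys v" using v by (auto simp: keys_toric_deriv)
      then show ?thesis by (simp add: kvm)
    next
      case False
      then have "i \<in> keys m" using i m by (auto simp: pts_def drop_idx_def)
      then show ?thesis by (simp add: kvm)
    qed
  qed
  ultimately show ?thesis using k by (simp add: pts_def)
qed

text \<open>A relation among the \<open>card J + 1\<close> elements is a cocycle of degree
  \<open>card J\<close>. Exactness there gives a primitive, whose components at complements of two
  indices are the antisymmetric coefficients of the trivial relations.\<close>

lemma koszul_relation:
  assumes S: "S \<subseteq> J"
    and x: "\<And>a. a \<in> idx J \<Longrightarrow> keys (x a) \<subseteq> pts (drop_idx S {a}) J (s - wt a)"
    and rel: "restr J (\<Sum>a\<in>idx J. gen a * x a) = 0"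
  obtains c where "\<And>a b. a \<in> idx J \<Longrightarrow> b \<in> idx J \<Longrightarrow> a \<noteq> b \<Longrightarrow>
      keys (c a b) \<subseteq> pts (drop_idx S {a, b}) J (s - wt a - wt b) \<and> c b a = - c a b"
    "\<And>a. a \<in> idx J \<Longrightarrow> x a = restr J (\<Sum>b\<in>idx J - {a}. gen b * c a b)"
proof -
  let ?N = "idx J"
  let ?r = "s - (\<Sum>a\<in>?N. wt a)"
  let ?Q = "graded S J ?r"
  \<comment> \<open>The coefficient of the generator a sits at the complement of a, with the sign
    that turns the top component of the differential into the given sum.\<close>
  define w :: "('n option, real ^ 'n option) cochain" where
    "w A = (\<Sum>a\<in>?N. if A = ?N - {a} then sg a ?N * hom (s - wt a) (x a) else 0)" for A
  have w: "w (?N - {a}) = sg a ?N * hom (s - wt a) (x a)" if "a \<in> ?N" for a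
  proof -
    have "w (?N - {a}) = (\<Sum>b\<in>?N. if b = a then sg b ?N * hom (s - wt b) (x b) else 0)"
      unfolding w_def using that by (intro sum.cong refl) auto
    then show ?thesis using that by simp
  qed
  have w0: "w A = 0" if "\<And>a. a \<in> ?N \<Longrightarrow> A \<noteq> ?N - {a}" for A
    unfolding w_def using that by (intro sum.neutral) auto
  have supp: "supp_in ?Q w" unfolding supp_in_def
  proof
    fix A show "keys (w A) \<subseteq> ?Q A"
    proof (cases "\<exists>a\<in>?N. A = ?N - {a}")
      case True
      then obtain a where a: "a \<in> ?N" "A = ?N - {a}" by blast
      have "emb m (s - wt a) \<in> ?Q A" if "m \<in> keys (x a)" for m
        using emb_in_graded[OF S, of "{a}" m "s - wt a" s] x[OF a(1)] that a by auto
      then show ?thesis unfolding a(2) w[OF a(1)] sg_mult_keys keys_hom using a(2) by auto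
    next
      case False then show ?thesis using w0[of A] by auto
    qed
  qed
  have card_N: "card ?N = Suc (card J)" by (simp add: idx_def card_image)
  have hg: "homog (int (card J)) w" unfolding homog_def
  proof (intro allI impI)
    fix A assume "w A \<noteq> 0"
    then obtain a where "a \<in> ?N" "A = ?N - {a}" using w0 by blast
    then show "int (card A) = int (card J)" using card_N by simp
  qed
  have "trunc_d fk ?Q w A = 0" for A
  proof (cases "A = ?N")
    case True
    have "koszul_d fk w ?N = (\<Sum>a\<in>?N. fk a * hom (s - wt a) (x a))"
      unfolding koszul_d_def using w by (intro sum.cong refl) (simp add: mult.left_commute)
    also have "\<dots> = hom s (\<Sum>a\<in>?N. gen a * x a)" by (simp add: fk_def hom_mult hom_sum)
    finally have "trunc_d fk ?Q w ?N = hom s (part {m. emb m s \<in> ?Q ?N} (\<Sum>a\<in>?N. gen a * x a))"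
      by (simp add: trunc_d_def hom_part)
    also have "part {m. emb m s \<in> ?Q ?N} (\<Sum>a\<in>?N. gen a * x a) = part {m. emb m s \<in> ?Q ?N} (restr J (\<Sum>a\<in>?N. gen a * x a))"
    proof -
      have "{m. emb m s \<in> ?Q ?N} \<subseteq> {m. keys m \<subseteq> J}"
        using emb_in_graded[OF S, of "{}" _ s s] by (auto simp: pts_def)
      then show ?thesis by (simp add: Int_absorb2)
    qed
    finally show ?thesis using True rel by simp
  next
    case False
    show ?thesis
    proof (cases "A \<subseteq> ?N")
      case sub: True
      have "w (A - {j}) = 0" if "j \<in> A" for j
      proof (rule w0)
        fix a assume "a \<in> ?N"
        show "A - {j} \<noteq> ?N - {a}"
        proof
          assume eq: "A - {j} = ?N - {a}"
          then have "j = a" using that sub \<open>a \<in> ?N\<close> by auto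
          then show False using eq that False sub \<open>a \<in> ?N\<close> by auto
        qed
      qed
      then show ?thesis by (simp add: trunc_d_def koszul_d_def)
    next
      case False then show ?thesis by (simp add: trunc_d_def graded_def mixed_def part_eq_0)
    qed
  qed
  then obtain e where e: "supp_in ?Q e" "\<And>A. trunc_d fk ?Q e A = w A"
    using exact_atD[OF exact_at_graded[OF S order_refl] supp hg] by blast
  define c' where "c' a b = sg a ?N * (sg b (?N - {a}) * e (?N - {a, b}))" for a b
  have "\<exists>g. c' a b = hom (s - wt a - wt b) g \<and> keys g \<subseteq> pts (drop_idx S {a, b}) J (s - wt a - wt b)"
    if ab: "a \<in> ?N" "b \<in> ?N" "a \<noteq> b" for a b
  proof -
    have "keys (c' a b) \<subseteq> ?Q (?N - {a, b})" using e(1) by (simp add: c'_def sg_mult_keys supp_in_def)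
    also have "\<dots> \<subseteq> {emb m (s - wt a - wt b) | m. m \<in> pts (drop_idx S {a, b}) J (s - wt a - wt b)}"
    proof
      fix y assume y: "y \<in> ?Q (?N - {a, b})"
      have sum: "s - (\<Sum>a\<in>{a, b}. wt a) = s - wt a - wt b" using ab by simp
      obtain m where m: "y = emb m (s - wt a - wt b)"
        using graded_is_emb[OF y] ab unfolding sum by blast
      then have "m \<in> pts (drop_idx S {a, b}) J (s - wt a - wt b)"
        using emb_in_graded[OF S, of "{a, b}" m "s - wt a - wt b" s] y ab by auto
      then show "y \<in> {emb m (s - wt a - wt b) | m. m \<in> pts (drop_idx S {a, b}) J (s - wt a - wt b)}"
        using m by blast
    qed
    finally obtain g where "c' a b = hom (s - wt a - wt b) g" "keys g \<subseteq> pts (drop_idx S {a, b}) J (s - wt a - wt b)"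
      by (rule exists_hom)
    then show ?thesis by blast
  qed
  note ex = this
  define c where "c a b = (SOME g. c' a b = hom (s - wt a - wt b) g \<and>
      keys g \<subseteq> pts (drop_idx S {a, b}) J (s - wt a - wt b))" for a b
  have c: "c' a b = hom (s - wt a - wt b) (c a b) \<and> keys (c a b) \<subseteq> pts (drop_idx S {a, b}) J (s - wt a - wt b)"
    if "a \<in> ?N" "b \<in> ?N" "a \<noteq> b" for a b
    unfolding c_def by (rule someI_ex) (rule ex[OF that])
  show ?thesis
  proof (rule that)
    fix a b assume ab: "a \<in> ?N" "b \<in> ?N" "a \<noteq> b"
    have "c' b a = - c' a b"
    proof -
      have "sg b ?N * sg a (?N - {b}) = - (sg a ?N * sg b (?N - {a}) :: (real ^ 'n option) \<Rightarrow>\<^sub>0 complex)"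
        using ab by (intro sg_antisym) auto
      then show ?thesis unfolding c'_def by (simp add: insert_commute flip: mult.assoc)
    qed
    then have "hom (s - wt a - wt b) (c b a) = hom (s - wt a - wt b) (- c a b)"
      using c[OF ab] c[OF ab(2,1)] ab(3) by (simp add: hom_uminus algebra_simps)
    then show "keys (c a b) \<subseteq> pts (drop_idx S {a, b}) J (s - wt a - wt b) \<and> c b a = - c a b"
      using c[OF ab] by (simp add: hom_inj)
  next
    fix a assume a: "a \<in> ?N"
    let ?y = "\<Sum>b\<in>?N - {a}. gen b * c a b"
    have 1: "hom (s - wt a) (x a) = part (?Q (?N - {a})) (sg a ?N * koszul_d fk e (?N - {a}))"
      using w[OF a] unfolding e(2)[symmetric] by (simp add: trunc_d_def part_sg)
    have "sg a ?N * koszul_d fk e (?N - {a}) = (\<Sum>b\<in>?N - {a}. fk b * c' a b)"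
    proof -
      have "?N - {a} - {b} = ?N - {a, b}" for b by auto
      then show ?thesis unfolding koszul_d_def c'_def sum_distrib_left
        by (intro sum.cong refl) (simp add: mult_ac)
    qed
    also have "\<dots> = (\<Sum>b\<in>?N - {a}. hom (s - wt a) (gen b * c a b))"
    proof (rule sum.cong[OF refl])
      fix b assume "b \<in> ?N - {a}"
      then have "c' a b = hom (s - wt a - wt b) (c a b)" using c[of a b] a by blast
      then have "fk b * c' a b = hom (wt b + (s - wt a - wt b)) (gen b * c a b)"
        by (simp only: fk_def hom_mult)
      then show "fk b * c' a b = hom (s - wt a) (gen b * c a b)" by simp
    qed
    also have "\<dots> = hom (s - wt a) ?y" by (rule hom_sum)
    finally have 2: "sg a ?N * koszul_d fk e (?N - {a}) = hom (s - wt a) ?y" .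
    have "hom (s - wt a) (x a) = hom (s - wt a) (part {m. emb m (s - wt a) \<in> ?Q (?N - {a})} ?y)"
      unfolding 1 2 by (rule hom_part)
    then have "x a = part {m. emb m (s - wt a) \<in> ?Q (?N - {a})} ?y" by (simp only: hom_inj)
    \<comment> \<open>Truncation removes only monomials involving variables outside J: the others
      satisfy the level and divisibility conditions by \<open>gen_mult_keys\<close>.\<close>
    also have "\<dots> = restr J ?y"
    proof (rule poly_mapping_eqI)
      fix m
      have "emb m (s - wt a) \<in> ?Q (?N - {a}) \<longleftrightarrow> keys m \<subseteq> J" if m: "m \<in> keys ?y"
      proof -
        have "keys ?y \<subseteq> {m. \<exists>b\<in>?N - {a}. m \<in> keys (gen b * c a b)}"
          by (rule keys_sum_subset) auto
        then obtain b where b: "b \<in> ?N - {a}" "m \<in> keys (gen b * c a b)" using m by blast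
        then obtain v m' where vm: "m = v + m'" "v \<in> keys (gen b)" "m' \<in> keys (c a b)"
          by (auto elim: keys_mult_mem)
        have "m' \<in> pts (drop_idx S {a, b}) J (s - wt a - wt b)" using c[of a b] a b vm(3) by blast
        then have "m \<in> pts (drop_idx S {a}) J (s - wt a)" if "keys m \<subseteq> J"
          using gen_mult_keys[OF vm(2)] that unfolding vm(1) by blast
        moreover have "emb m (s - wt a) \<in> ?Q (?N - {a}) \<longleftrightarrow> m \<in> pts (drop_idx S {a}) J (s - wt a)"
          using emb_in_graded[OF S, of "{a}" m "s - wt a" s] a by simp
        ultimately show ?thesis by (auto simp: pts_def)
      qed
      then show "lookup (part {m. emb m (s - wt a) \<in> ?Q (?N - {a})} ?y) m = lookup (restr J ?y) m"
        by (auto simp: lookup_part in_keys_iff)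
    qed
    finally show "x a = restr J ?y" .
  qed
qed

end

section \<open>Dimensions of graded pieces\<close>

lemma complement_coeffs_zero:
  fixes B1 :: "('v::comm_monoid_add \<Rightarrow>\<^sub>0 complex) set"
  assumes B1: "pm.independent B1" "finite B1" "B0 \<subseteq> B1"
    and c: "(\<Sum>s\<in>B1 - B0. scal (c s) * s) \<in> pm.span B0" and s: "s \<in> B1 - B0"
  shows "c s = 0"
proof -
  have fB0: "finite B0" using B1 finite_subset by blast
  obtain d where d: "(\<Sum>s\<in>B1 - B0. scal (c s) * s) = (\<Sum>b\<in>B0. scal (d b) * b)"
    using c pm.span_finite[OF fB0] by auto
  let ?u = "\<lambda>v. if v \<in> B0 then - d v else c v"
  have "(\<Sum>v\<in>B1. scal (?u v) * v) = (\<Sum>v\<in>B1 - B0. scal (?u v) * v) + (\<Sum>v\<in>B0. scal (?u v) * v)"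
    using B1 by (intro sum.subset_diff) auto
  also have "(\<Sum>v\<in>B1 - B0. scal (?u v) * v) = (\<Sum>s\<in>B1 - B0. scal (c s) * s)"
    by (intro sum.cong) auto
  also have "(\<Sum>v\<in>B0. scal (?u v) * v) = - (\<Sum>b\<in>B0. scal (d b) * b)"
    unfolding sum_negf[symmetric] by (intro sum.cong refl) (simp add: single_uminus)
  finally have z: "(\<Sum>v\<in>B1. scal (?u v) * v) = 0" by (simp add: d)
  have "?u s = 0" by (rule pm.independentD[OF B1(1,2) order_refl z]) (use s in blast)
  then show ?thesis using s by simp
qed

lemma adapted_basis:
  fixes U :: "('v::comm_monoid_add \<Rightarrow>\<^sub>0 complex) set"
  assumes "W \<subseteq> U" "finite T" "U \<subseteq> pm.span T"
  obtains B0 B1 where "B0 \<subseteq> B1" "B0 \<subseteq> W" "W \<subseteq> pm.span B0" "B1 \<subseteq> U" "U \<subseteq> pm.span B1"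
    "pm.independent B1" "finite B1" "pm.dim W = card B0" "pm.dim U = card B1"
proof -
  obtain B0 where B0: "B0 \<subseteq> W" "pm.independent B0" "W \<subseteq> pm.span B0" "card B0 = pm.dim W"
    by (rule pm.basis_exists)
  then obtain B1 where B1: "B0 \<subseteq> B1" "B1 \<subseteq> U" "pm.independent B1" "U \<subseteq> pm.span B1"
    using pm.maximal_independent_subset_extend[of B0 U] assms(1) by blast
  have "finite B1" using pm.independent_span_bound[OF assms(2) B1(3)] B1(2) assms(3) by blast
  moreover have "card B1 = pm.dim U" using B1 by (intro pm.basis_card_eq_dim)
  ultimately show ?thesis using that B0 B1 by metis
qed

text \<open>A basis of the kernel is extended to one of U; the images of the added vectors form a
  basis of the image.\<close>

lemma dim_kernel_plus_image:
  fixes \<phi> :: "('v::comm_monoid_add \<Rightarrow>\<^sub>0 complex) \<Rightarrow> ('w::comm_monoid_add \<Rightarrow>\<^sub>0 complex)"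
  assumes U: "pm.subspace U" "finite T" "U \<subseteq> pm.span T"
    and add: "\<And>x y. \<phi> (x + y) = \<phi> x + \<phi> y" and scale: "\<And>c x. \<phi> (scal c * x) = scal c * \<phi> x"
  shows "pm.dim U = pm.dim {x \<in> U. \<phi> x = 0} + pm.dim (\<phi> ` U)"
proof -
  let ?W = "{x \<in> U. \<phi> x = 0}"
  obtain B0 B1 where B: "B0 \<subseteq> B1" "B0 \<subseteq> ?W" "?W \<subseteq> pm.span B0" "B1 \<subseteq> U" "U \<subseteq> pm.span B1"
      "pm.independent B1" "finite B1" "pm.dim ?W = card B0" "pm.dim U = card B1"
    using adapted_basis[OF _ U(2,3), of ?W] by blast
  let ?S = "B1 - B0"
  have zero: "\<phi> 0 = 0" using scale[of 0 0] by simp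
  have sum: "\<phi> (\<Sum>s\<in>X. scal (c s) * s) = (\<Sum>s\<in>X. scal (c s) * \<phi> s)" for X c
    by (induction X rule: infinite_finite_induct) (simp_all add: add scale zero)
  have fam: "c s = 0" if "(\<Sum>s\<in>?S. scal (c s) * \<phi> s) = 0" "s \<in> ?S" for c s
  proof (rule complement_coeffs_zero[OF B(6,7,1) _ that(2)])
    have "(\<Sum>s\<in>?S. scal (c s) * s) \<in> U"
      using U(1) B(4) by (intro pm.subspace_sum pm.subspace_scale) auto
    moreover have "\<phi> (\<Sum>s\<in>?S. scal (c s) * s) = 0" unfolding sum by (rule that(1))
    ultimately show "(\<Sum>s\<in>?S. scal (c s) * s) \<in> pm.span B0" using B(3) by blast
  qed
  have inj: "inj_on \<phi> ?S"
  proof (rule inj_onI, rule ccontr)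
    fix s t assume st: "s \<in> ?S" "t \<in> ?S" "\<phi> s = \<phi> t" "s \<noteq> t"
    let ?c = "\<lambda>v. if v = s then 1 else if v = t then - 1 else (0::complex)"
    have "(\<Sum>v\<in>?S. scal (?c v) * \<phi> v) = (\<Sum>v\<in>{s, t}. scal (?c v) * \<phi> v)"
      using st B(7) by (intro sum.mono_neutral_right) auto
    also have "\<dots> = 0" using st by (simp add: single_uminus)
    finally have "?c s = 0" by (rule fam) (rule st(1))
    then show False by simp
  qed
  have "pm.independent (\<phi> ` ?S)"
  proof
    assume "pm.dependent (\<phi> ` ?S)"
    then obtain u where u: "\<exists>v\<in>\<phi> ` ?S. u v \<noteq> 0" "(\<Sum>v\<in>\<phi> ` ?S. scal (u v) * v) = 0"
      using pm.dependent_finite[of "\<phi> ` ?S"] B(7) by blast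
    then have "(\<Sum>s\<in>?S. scal (u (\<phi> s)) * \<phi> s) = 0" by (simp add: sum.reindex[OF inj])
    then show False using fam[of "\<lambda>s. u (\<phi> s)"] u(1) by blast
  qed
  moreover have "\<phi> ` U \<subseteq> pm.span (\<phi> ` ?S)"
  proof
    fix y assume "y \<in> \<phi> ` U"
    then obtain x where x: "x \<in> pm.span B1" "y = \<phi> x" using B(5) by blast
    then obtain c where c: "x = (\<Sum>s\<in>B1. scal (c s) * s)" using pm.span_finite[OF B(7)] by auto
    have "\<phi> s \<in> pm.span (\<phi> ` ?S)" if "s \<in> B1" for s
    proof (cases "s \<in> B0")
      case True
      then have "\<phi> s = 0" using B(2) by blast
      then show ?thesis by (simp add: pm.span_zero)
    next
      case False then show ?thesis using that by (intro pm.span_base) blast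
    qed
    then show "y \<in> pm.span (\<phi> ` ?S)" unfolding x(2) c sum by (intro pm.span_sum pm.span_scale)
  qed
  moreover have "\<phi> ` ?S \<subseteq> \<phi> ` U" using B(4) by blast
  ultimately have "pm.dim (\<phi> ` U) = card (\<phi> ` ?S)" using pm.basis_card_eq_dim by metis
  also have "\<dots> = card ?S" by (rule card_image[OF inj])
  also have "\<dots> = card B1 - card B0" using B(1,7) by (intro card_Diff_subset) (auto intro: finite_subset)
  finally show ?thesis using B(1,7,8,9) card_mono[OF B(7,1)] by simp
qed

lemma residue_class_eq_iff:
  assumes K: "pm.subspace K"
  shows "residue_class K g = residue_class K h \<longleftrightarrow> g - h \<in> K"
proof
  assume "residue_class K g = residue_class K h"
  moreover have "g + 0 \<in> residue_class K g" unfolding residue_class_def using pm.subspace_0[OF K] by blast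
  ultimately have "g \<in> residue_class K h" by simp
  then show "g - h \<in> K" by (auto simp: residue_class_def)
next
  assume d: "g - h \<in> K"
  have "g + k \<in> residue_class K h" if "k \<in> K" for k
  proof -
    have "g + k = h + ((g - h) + k)" by simp
    then show ?thesis unfolding residue_class_def using pm.subspace_add[OF K d that] by blast
  qed
  moreover have "h + k \<in> residue_class K g" if "k \<in> K" for k
  proof -
    have "h + k = g + (k - (g - h))" by simp
    then show ?thesis unfolding residue_class_def using pm.subspace_diff[OF K that d] by blast
  qed
  ultimately show "residue_class K g = residue_class K h" unfolding residue_class_def by blast
qed

text \<open>\<open>gr_dim\<close> counts an arbitrarily chosen basis. One exists, namely
  \<open>B1 - B0\<close>, and any choice together with the basis B0 of B is a basis of
  \<open>F \<alpha>\<close>, so its size is forced.\<close>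

lemma gr_dim_eq:
  fixes F :: "rat \<Rightarrow> 'n mpoly set"
  assumes F: "\<And>\<beta>. pm.subspace (F \<beta>)" and mono: "\<And>\<beta> \<gamma>. \<beta> \<le> \<gamma> \<Longrightarrow> F \<beta> \<subseteq> F \<gamma>" and K: "pm.subspace K"
    and fin: "finite T" "F \<alpha> \<subseteq> pm.span T"
  defines "B \<equiv> {g \<in> F \<alpha>. \<exists>\<beta><\<alpha>. \<exists>g'\<in>F \<beta>. g - g' \<in> K}"
  shows "int (gr_dim F K \<alpha>) = int (pm.dim (F \<alpha>)) - int (pm.dim B)"
proof -
  have less: "residue_class K g \<in> quot_filt_less F K \<alpha> \<longleftrightarrow> g \<in> B" if "g \<in> F \<alpha>" for g
  proof -
    have "residue_class K g \<in> quot_filt_less F K \<alpha> \<longleftrightarrow> (\<exists>\<beta><\<alpha>. \<exists>g'\<in>F \<beta>. residue_class K g = residue_class K g')"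
      by (auto simp: quot_filt_less_def quot_filt_def)
    then show ?thesis using that by (simp add: residue_class_eq_iff[OF K] B_def)
  qed
  have subB: "pm.subspace B"
  proof (rule pm.subspaceI)
    have "\<alpha> - 1 < \<alpha>" by simp
    then show "0 \<in> B" unfolding B_def using pm.subspace_0[OF F] pm.subspace_0[OF K]
      by (auto intro!: exI[of _ "\<alpha> - 1"] bexI[of _ 0])
    fix x y assume "x \<in> B" "y \<in> B"
    then obtain \<beta> \<gamma> x' y' where *: "x \<in> F \<alpha>" "y \<in> F \<alpha>" "\<beta> < \<alpha>" "\<gamma> < \<alpha>" "x' \<in> F \<beta>" "y' \<in> F \<gamma>" "x - x' \<in> K" "y - y' \<in> K"
      unfolding B_def by blast
    have "x' \<in> F (max \<beta> \<gamma>)" "y' \<in> F (max \<beta> \<gamma>)" using * mono[of \<beta> "max \<beta> \<gamma>"] mono[of \<gamma> "max \<beta> \<gamma>"] by auto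
    then have "x' + y' \<in> F (max \<beta> \<gamma>)" by (intro pm.subspace_add[OF F])
    moreover have "x + y - (x' + y') \<in> K" using pm.subspace_add[OF K *(7,8)] by (simp add: algebra_simps)
    moreover have "x + y \<in> F \<alpha>" using * by (intro pm.subspace_add[OF F])
    moreover have "max \<beta> \<gamma> < \<alpha>" using * by simp
    ultimately show "x + y \<in> B" unfolding B_def by blast
  next
    fix c x assume "x \<in> B"
    then obtain \<beta> x' where *: "x \<in> F \<alpha>" "\<beta> < \<alpha>" "x' \<in> F \<beta>" "x - x' \<in> K" unfolding B_def by blast
    have "scal c * x - scal c * x' \<in> K" using pm.subspace_scale[OF K *(4), of c] by (simp add: algebra_simps)
    then show "scal c * x \<in> B" unfolding B_def using * pm.subspace_scale[OF F] by blast
  qed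
  have BF: "B \<subseteq> F \<alpha>" by (auto simp: B_def)
  obtain B0 B1 where B: "B0 \<subseteq> B1" "B0 \<subseteq> B" "B \<subseteq> pm.span B0" "B1 \<subseteq> F \<alpha>" "F \<alpha> \<subseteq> pm.span B1"
      "pm.independent B1" "finite B1" "pm.dim B = card B0" "pm.dim (F \<alpha>) = card B1"
    by (rule adapted_basis[OF BF fin])
  have fB0: "finite B0" using B(1,7) finite_subset by blast
  have spanB0: "pm.span B0 = B" using B(2,3) subB pm.span_minimal by blast
  have sumF: "(\<Sum>s\<in>S. scal (c s) * s) \<in> F \<alpha>" if "S \<subseteq> F \<alpha>" for S c
    using that by (intro pm.subspace_sum[OF F] pm.subspace_scale[OF F]) auto
  have basis: "gr_basis F K \<alpha> S \<longleftrightarrow> finite S \<and> S \<subseteq> F \<alpha> \<and>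
     (\<forall>g\<in>F \<alpha>. \<exists>c. g - (\<Sum>s\<in>S. scal (c s) * s) \<in> B) \<and>
     (\<forall>c. (\<Sum>s\<in>S. scal (c s) * s) \<in> B \<longrightarrow> (\<forall>s\<in>S. c s = 0))" for S
  proof -
    have "S \<subseteq> F \<alpha> \<Longrightarrow> g \<in> F \<alpha> \<Longrightarrow> g - (\<Sum>s\<in>S. scal (c s) * s) \<in> F \<alpha>" for g c
      using sumF by (intro pm.subspace_diff[OF F])
    then show ?thesis unfolding gr_basis_def cst_def using less sumF by (auto 4 3)
  qed
  have card: "card S + card B0 = card B1" if S: "gr_basis F K \<alpha> S" for S
  proof -
    have S: "finite S" "S \<subseteq> F \<alpha>" "\<And>g. g \<in> F \<alpha> \<Longrightarrow> \<exists>c. g - (\<Sum>s\<in>S. scal (c s) * s) \<in> B"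
        "\<And>c s. (\<Sum>s\<in>S. scal (c s) * s) \<in> B \<Longrightarrow> s \<in> S \<Longrightarrow> c s = 0"
      using S unfolding basis by blast+
    have disj: "S \<inter> B0 = {}"
    proof (rule ccontr)
      assume "S \<inter> B0 \<noteq> {}"
      then obtain s where s: "s \<in> S" "s \<in> B" using B(2) by blast
      have "(\<Sum>v\<in>S. scal (if v = s then 1 else 0) * v) = s"
        using s(1) S(1) by (simp add: if_distrib if_distribR cong: if_cong)
      then have "(\<Sum>v\<in>S. scal (if v = s then 1 else 0) * v) \<in> B" using s by simp
      from S(4)[OF this s(1)] show False by simp
    qed
    have indep: "pm.independent (S \<union> B0)"
    proof
      assume "pm.dependent (S \<union> B0)"
      then obtain u where u: "\<exists>v\<in>S \<union> B0. u v \<noteq> 0" "(\<Sum>v\<in>S \<union> B0. scal (u v) * v) = 0"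
        using pm.dependent_finite[of "S \<union> B0"] S(1) fB0 by blast
      have e: "(\<Sum>v\<in>S. scal (u v) * v) + (\<Sum>v\<in>B0. scal (u v) * v) = 0"
        using u(2) unfolding sum.union_disjoint[OF S(1) fB0 disj] .
      have "(\<Sum>v\<in>B0. scal (u v) * v) \<in> B"
        using B(2) by (intro pm.subspace_sum[OF subB] pm.subspace_scale[OF subB]) auto
      then have "- (\<Sum>v\<in>B0. scal (u v) * v) \<in> B" by (rule pm.subspace_neg[OF subB])
      moreover have "(\<Sum>v\<in>S. scal (u v) * v) = - (\<Sum>v\<in>B0. scal (u v) * v)"
        using e by (simp add: eq_neg_iff_add_eq_0)
      ultimately have inB: "(\<Sum>v\<in>S. scal (u v) * v) \<in> B" by simp
      have uS: "u v = 0" if "v \<in> S" for v by (rule S(4)[OF inB that])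
      then have z: "(\<Sum>v\<in>B0. scal (u v) * v) = 0" using e by simp
      have "u v = 0" if "v \<in> B0" for v by (rule pm.independentD[OF B(6) fB0 B(1) z that])
      then show False using u(1) uS by blast
    qed
    have "F \<alpha> \<subseteq> pm.span (S \<union> B0)"
    proof
      fix g assume "g \<in> F \<alpha>"
      then obtain c where "g - (\<Sum>s\<in>S. scal (c s) * s) \<in> pm.span B0" using S(3) spanB0 by blast
      then have "g - (\<Sum>s\<in>S. scal (c s) * s) \<in> pm.span (S \<union> B0)" using pm.span_mono[of B0 "S \<union> B0"] by blast
      moreover have "(\<Sum>s\<in>S. scal (c s) * s) \<in> pm.span (S \<union> B0)"
        by (intro pm.span_sum pm.span_scale pm.span_base) auto
      ultimately have "g - (\<Sum>s\<in>S. scal (c s) * s) + (\<Sum>s\<in>S. scal (c s) * s) \<in> pm.span (S \<union> B0)"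
        by (rule pm.span_add)
      then show "g \<in> pm.span (S \<union> B0)" by simp
    qed
    moreover have "S \<union> B0 \<subseteq> F \<alpha>" using S(2) B(2) BF by blast
    ultimately have "card (S \<union> B0) = pm.dim (F \<alpha>)" using indep by (intro pm.basis_card_eq_dim)
    then show ?thesis using card_Un_disjoint[OF S(1) fB0 disj] B(9) by simp
  qed
  have ex: "gr_basis F K \<alpha> (B1 - B0)" unfolding basis
  proof (intro conjI ballI allI impI)
    show "finite (B1 - B0)" "B1 - B0 \<subseteq> F \<alpha>" using B by auto
    fix g assume "g \<in> F \<alpha>"
    then obtain c where c: "g = (\<Sum>s\<in>B1. scal (c s) * s)" using B(5) pm.span_finite[OF B(7)] by auto
    have "g = (\<Sum>s\<in>B1 - B0. scal (c s) * s) + (\<Sum>s\<in>B0. scal (c s) * s)"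
      unfolding c using B(1,7) by (intro sum.subset_diff) auto
    moreover have "(\<Sum>s\<in>B0. scal (c s) * s) \<in> B"
      using B(2) by (intro pm.subspace_sum[OF subB] pm.subspace_scale[OF subB]) auto
    ultimately show "\<exists>c. g - (\<Sum>s\<in>B1 - B0. scal (c s) * s) \<in> B" by (intro exI[of _ c]) simp
  next
    fix c s assume "(\<Sum>s\<in>B1 - B0. scal (c s) * s) \<in> B" "s \<in> B1 - B0"
    then show "c s = 0" using complement_coeffs_zero[OF B(6,7,1)] spanB0 by blast
  qed
  then have "gr_dim F K \<alpha> = card (SOME S. gr_basis F K \<alpha> S)" unfolding gr_dim_def by auto
  moreover have "gr_basis F K \<alpha> (SOME S. gr_basis F K \<alpha> S)" using ex by (rule someI)
  ultimately have "gr_dim F K \<alpha> + card B0 = card B1" using card by metis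
  then show ?thesis using B(8,9) by linarith
qed

section \<open>Restriction to a coordinate hyperplane\<close>

lemma keys_scal: "keys (scal c * g) \<subseteq> keys g"
  by (auto simp: in_keys_iff)

lemma subspace_keys: "pm.subspace {g :: 'v::comm_monoid_add \<Rightarrow>\<^sub>0 complex. keys g \<subseteq> X}"
proof (rule pm.subspaceI)
  show "scal c * x \<in> {g. keys g \<subseteq> X}" if "x \<in> {g. keys g \<subseteq> X}" for c x
    using that keys_scal[of c x] by blast
qed (simp_all add: keys_add_subset)

lemma part_scal: "part X (scal c * g) = scal c * part X g"
  by (rule poly_mapping_eqI) (simp add: lookup_part)

lemma keys_add_nat: "keys (a + b) = keys a \<union> keys (b :: 'n \<Rightarrow>\<^sub>0 nat)"
  by (auto simp: in_keys_iff lookup_add)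

context newton_poly
begin

section \<open>Graded pieces of the modules between the toric and the Jacobian quotient\<close>

definition V :: "'n set \<Rightarrow> 'n set \<Rightarrow> int \<Rightarrow> 'n mpoly set" where
  "V S J s = {g. keys g \<subseteq> pts S J s}"

abbreviation tder :: "'n \<Rightarrow> 'n mpoly" where "tder j \<equiv> var j * pdiff j f"

text \<open>The elements of V that vanish in the graded piece, with coefficients of the relations
  bounded by the expected level s - D. The bounded form is finite dimensional and suits the
  comparison along a hyperplane.\<close>

definition B :: "'n set \<Rightarrow> 'n set \<Rightarrow> int \<Rightarrow> 'n mpoly set" where
  "B S J s = {h + restr J (\<Sum>j\<in>J. tder j * a j) | h a. h \<in> V S J (s - 1) \<and> (\<forall>j\<in>J. a j \<in> V (S - {j}) J (s - int D))}"

lemma B_I: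
  "h \<in> V S J (s - 1) \<Longrightarrow> (\<And>j. j \<in> J \<Longrightarrow> a j \<in> V (S - {j}) J (s - int D)) \<Longrightarrow>
    h + restr J (\<Sum>j\<in>J. tder j * a j) \<in> B S J s"
  unfolding B_def by blast

lemma subspace_V: "pm.subspace (V S J s)"
  unfolding V_def by (rule subspace_keys)

lemma V_mono: "s \<le> s' \<Longrightarrow> g \<in> V S J s \<Longrightarrow> g \<in> V S J s'"
  unfolding V_def using pts_mono by blast

lemma finite_pts: "finite (pts S J s)"
proof (rule finite_subset)
  show "finite {m. keys m \<subseteq> UNIV \<and> nu m \<le> of_int s / of_nat D}" by (rule finite_newton_fun_le)
  show "pts S J s \<subseteq> {m. keys m \<subseteq> UNIV \<and> nu m \<le> of_int s / of_nat D}"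
    using D_pos by (auto simp: pts_def field_simps)
qed

lemma V_span:
  obtains T where "finite T" "V S J s \<subseteq> pm.span T"
proof
  show "finite ((\<lambda>m. Poly_Mapping.single m (1::complex)) ` pts S J s)" by (simp add: finite_pts)
  show "V S J s \<subseteq> pm.span ((\<lambda>m. Poly_Mapping.single m (1::complex)) ` pts S J s)"
    unfolding V_def using in_span_singles by blast
qed

lemma restr_restr: "restr J (restr J' g) = restr (J \<inter> J') g"
  unfolding part_part by (rule arg_cong[where f = "\<lambda>X. part X g"]) auto

text \<open>The monomials involving a variable outside J span an ideal.\<close>

lemma restr_mult: "restr J (g * restr J h) = restr J (g * h)"
proof -
  have "keys (g * part (- {m. keys m \<subseteq> J}) h) \<inter> {m. keys m \<subseteq> J} = {}"
    by (auto elim!: keys_mult_mem simp: keys_add_nat)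
  then have "restr J (g * part (- {m. keys m \<subseteq> J}) h) = 0" by (rule part_eq_0)
  moreover have "restr J (g * h) = restr J (g * restr J h) + restr J (g * part (- {m. keys m \<subseteq> J}) h)"
    by (simp flip: part_add distrib_left add: part_compl)
  ultimately show ?thesis by simp
qed

lemma drop_idx_simps [simp]: "drop_idx S {None} = S" "drop_idx S {Some j} = S - {j}"
  "drop_idx S {None, Some j} = S - {j}" "drop_idx S {Some j, None} = S - {j}"
  "drop_idx S {Some j, Some k} = S - {j, k}"
  by (auto simp: drop_idx_def)

lemma sum_idx: "(\<Sum>a\<in>idx J. g a) = g None + (\<Sum>j\<in>J. g (Some j))"
proof -
  have "None \<notin> Some ` J" by auto
  then show ?thesis by (simp add: idx_def sum.reindex)
qed

lemma tder_mult_V: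
  assumes "a \<in> V (S - {j}) J' (s - int D)"
  shows "restr J (tder j * a) \<in> V S J s"
  unfolding V_def
proof (intro CollectI subsetI)
  fix m assume "m \<in> keys (restr J (tder j * a))"
  then have m: "m \<in> keys (tder j * a)" "keys m \<subseteq> J" by auto
  then obtain v m' where vm: "m = v + m'" "v \<in> keys (gen (Some j))" "m' \<in> keys a"
    by (auto elim: keys_mult_mem)
  have "m' \<in> pts (drop_idx S {None, Some j}) J' (s - wt (Some j))" using assms vm(3) by (auto simp: V_def)
  from gen_mult_keys[OF vm(2) this] show "m \<in> pts S J s" using m(2) by (simp add: vm(1))
qed

lemma restr_V: "a \<in> V S J s \<Longrightarrow> restr J a = a"
  by (intro part_id) (auto simp: V_def pts_def)

lemma B_subset_V: "B S J s \<subseteq> V S J s"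
proof
  fix y assume "y \<in> B S J s"
  then obtain h a where y: "y = h + restr J (\<Sum>j\<in>J. tder j * a j)" "h \<in> V S J (s - 1)"
      "\<forall>j\<in>J. a j \<in> V (S - {j}) J (s - int D)" unfolding B_def by blast
  have "h \<in> V S J s" using y(2) by (rule V_mono[rotated]) simp
  moreover have "restr J (\<Sum>j\<in>J. tder j * a j) \<in> V S J s"
    unfolding part_sum using y(3) tder_mult_V by (intro pm.subspace_sum[OF subspace_V]) blast
  ultimately show "y \<in> V S J s" unfolding y(1) by (rule pm.subspace_add[OF subspace_V])
qed

lemma subspace_B: "pm.subspace (B S J s)"
proof (rule pm.subspaceI)
  show "0 \<in> B S J s" unfolding B_def using pm.subspace_0[OF subspace_V]
    by (intro CollectI exI[of _ 0] exI[of _ "\<lambda>_. 0"]) simp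
  fix x y assume "x \<in> B S J s" "y \<in> B S J s"
  then obtain h a k b where *: "x = h + restr J (\<Sum>j\<in>J. tder j * a j)" "h \<in> V S J (s - 1)"
      "\<forall>j\<in>J. a j \<in> V (S - {j}) J (s - int D)" "y = k + restr J (\<Sum>j\<in>J. tder j * b j)" "k \<in> V S J (s - 1)"
      "\<forall>j\<in>J. b j \<in> V (S - {j}) J (s - int D)" unfolding B_def by blast
  have e: "x + y = (h + k) + restr J (\<Sum>j\<in>J. tder j * (a j + b j))"
    unfolding * by (simp add: part_add sum.distrib distrib_left)
  show "x + y \<in> B S J s"
    unfolding e using * by (intro B_I pm.subspace_add[OF subspace_V]) auto
next
  fix c x assume "x \<in> B S J s"
  then obtain h a where *: "x = h + restr J (\<Sum>j\<in>J. tder j * a j)" "h \<in> V S J (s - 1)"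
      "\<forall>j\<in>J. a j \<in> V (S - {j}) J (s - int D)" unfolding B_def by blast
  have e: "scal c * x = scal c * h + restr J (\<Sum>j\<in>J. tder j * (scal c * a j))"
    unfolding * by (simp add: distrib_left part_scal[symmetric] sum_distrib_left mult_ac)
  show "scal c * x \<in> B S J s"
    unfolding e using * by (intro B_I pm.subspace_scale[OF subspace_V]) auto
qed

text \<open>A combination k that drops one level yields a relation in which t has coefficient -k. In
  its Koszul form, pairs with t contribute b, one level lower, and the remaining pairs contribute
  the antisymmetric d, which cancels from the sum.\<close>

lemma relation_reduce:
  assumes S: "S \<subseteq> J" and a: "\<And>j. j \<in> J \<Longrightarrow> a j \<in> V (S - {j}) J (s - int D)"
    and k: "restr J (\<Sum>j\<in>J. tder j * a j) \<in> V S J (s - 1)"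
  obtains b d where "\<And>j. j \<in> J \<Longrightarrow> b j \<in> V (S - {j}) J (s - 1 - int D)"
    "restr J (\<Sum>j\<in>J. tder j * a j) = restr J (\<Sum>j\<in>J. tder j * b j)"
    "\<And>j l. j \<in> J \<Longrightarrow> l \<in> J \<Longrightarrow> j \<noteq> l \<Longrightarrow> d j l \<in> V (S - {j, l}) J (s - 2 * int D) \<and> d l j = - d j l"
    "\<And>j. j \<in> J \<Longrightarrow> a j = b j + restr J (\<Sum>l\<in>J - {j}. tder l * d j l)"
proof -
  let ?k = "restr J (\<Sum>j\<in>J. tder j * a j)"
  define x where "x c = (case c of None \<Rightarrow> - ?k | Some j \<Rightarrow> a j)" for c
  have xk: "keys (x c) \<subseteq> pts (drop_idx S {c}) J (s - wt c)" if "c \<in> idx J" for c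
  proof (cases c)
    case None
    have "keys (- ?k) = keys ?k" by simp
    also have "\<dots> \<subseteq> pts S J (s - 1)" using k by (simp add: V_def)
    finally show ?thesis using None by (simp add: x_def)
  next
    case (Some j)
    then show ?thesis using a[of j] that by (auto simp: x_def idx_def V_def)
  qed
  have "(\<Sum>c\<in>idx J. gen c * x c) = (\<Sum>j\<in>J. tder j * a j) - ?k"
    by (simp add: sum_idx x_def)
  then have "restr J (\<Sum>c\<in>idx J. gen c * x c) = 0" by (simp add: part_diff)
  then obtain c where c: "\<And>p q. p \<in> idx J \<Longrightarrow> q \<in> idx J \<Longrightarrow> p \<noteq> q \<Longrightarrow>
      keys (c p q) \<subseteq> pts (drop_idx S {p, q}) J (s - wt p - wt q) \<and> c q p = - c p q"
    "\<And>p. p \<in> idx J \<Longrightarrow> x p = restr J (\<Sum>q\<in>idx J - {p}. gen q * c p q)"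
    using koszul_relation[OF S xk] by blast
  have mem: "None \<in> idx J" "j \<in> J \<Longrightarrow> Some j \<in> idx J" for j by (auto simp: idx_def)
  define b where "b j = c (Some j) None" for j
  define d where "d j l = c (Some j) (Some l)" for j l
  have b_anti: "c None (Some j) = - b j" if "j \<in> J" for j
    using c(1)[OF mem(2)[OF that] mem(1)] by (simp add: b_def)
  have b: "b j \<in> V (S - {j}) J (s - 1 - int D)" if "j \<in> J" for j
    using c(1)[OF mem(2)[OF that] mem(1)] by (simp add: b_def V_def algebra_simps)
  show ?thesis
  proof (rule that[of b d])
    show "b j \<in> V (S - {j}) J (s - 1 - int D)" if "j \<in> J" for j by (rule b[OF that])
    have "- ?k = restr J (\<Sum>q\<in>idx J - {None}. gen q * c None q)"
      using c(2)[OF mem(1)] by (simp add: x_def)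
    also have "idx J - {None} = Some ` J" by (auto simp: idx_def)
    also have "(\<Sum>q\<in>Some ` J. gen q * c None q) = - (\<Sum>j\<in>J. tder j * b j)"
      by (simp add: sum.reindex b_anti sum_negf)
    also have "restr J (- (\<Sum>j\<in>J. tder j * b j)) = - restr J (\<Sum>j\<in>J. tder j * b j)"
      by (rule poly_mapping_eqI) (simp add: lookup_part)
    finally show "?k = restr J (\<Sum>j\<in>J. tder j * b j)" by simp
    show "d j l \<in> V (S - {j, l}) J (s - 2 * int D) \<and> d l j = - d j l" if "j \<in> J" "l \<in> J" "j \<noteq> l" for j l
      using c(1)[OF mem(2)[OF that(1)] mem(2)[OF that(2)]] that(3) by (simp add: d_def V_def algebra_simps)
    show "a j = b j + restr J (\<Sum>l\<in>J - {j}. tder l * d j l)" if j: "j \<in> J" for j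
    proof -
      have "a j = restr J (\<Sum>q\<in>idx J - {Some j}. gen q * c (Some j) q)"
        using c(2)[OF mem(2)[OF j]] by (simp add: x_def)
      also have "idx J - {Some j} = idx (J - {j})" by (auto simp: idx_def)
      also have "(\<Sum>q\<in>idx (J - {j}). gen q * c (Some j) q) = b j + (\<Sum>l\<in>J - {j}. tder l * d j l)"
        by (simp add: sum_idx b_def d_def)
      also have "restr J (b j + (\<Sum>l\<in>J - {j}. tder l * d j l)) = b j + restr J (\<Sum>l\<in>J - {j}. tder l * d j l)"
        unfolding part_add using restr_V[OF b[OF j]] by simp
      finally show ?thesis .
    qed
  qed
qed

text \<open>Repeated reduction lowers the level s' one step at a time without changing the
  sum.\<close>

lemma relation_strict:
  assumes S: "S \<subseteq> J" and a: "\<And>j. j \<in> J \<Longrightarrow> a j \<in> V (S - {j}) J (s' - int D)"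
    and k: "restr J (\<Sum>j\<in>J. tder j * a j) \<in> V S J s"
  shows "\<exists>b. (\<forall>j\<in>J. b j \<in> V (S - {j}) J (s - int D)) \<and>
    restr J (\<Sum>j\<in>J. tder j * a j) = restr J (\<Sum>j\<in>J. tder j * b j)"
  using a k
proof (induction "nat (s' - s)" arbitrary: s' a rule: less_induct)
  case less
  show ?case
  proof (cases "s' \<le> s")
    case True
    then have "s' - int D \<le> s - int D" by simp
    then have "\<forall>j\<in>J. a j \<in> V (S - {j}) J (s - int D)" using less.prems(1) V_mono by blast
    then show ?thesis by blast
  next
    case False
    then have "s \<le> s' - 1" by simp
    then have k: "restr J (\<Sum>j\<in>J. tder j * a j) \<in> V S J (s' - 1)"
      using less.prems(2) by (rule V_mono)
    obtain b d where b: "\<And>j. j \<in> J \<Longrightarrow> b j \<in> V (S - {j}) J (s' - 1 - int D)"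
        "restr J (\<Sum>j\<in>J. tder j * a j) = restr J (\<Sum>j\<in>J. tder j * b j)"
        "\<And>j l. j \<in> J \<Longrightarrow> l \<in> J \<Longrightarrow> j \<noteq> l \<Longrightarrow> d j l \<in> V (S - {j, l}) J (s' - 2 * int D) \<and> d l j = - d j l"
        "\<And>j. j \<in> J \<Longrightarrow> a j = b j + restr J (\<Sum>l\<in>J - {j}. tder l * d j l)"
      using relation_reduce[OF S less.prems(1) k] by blast
    show ?thesis unfolding b(2)
    proof (rule less.hyps)
      show "nat (s' - 1 - s) < nat (s' - s)" using False by simp
      show "restr J (\<Sum>j\<in>J. tder j * b j) \<in> V S J s" using less.prems(2) by (simp add: b(2))
    qed (rule b(1))
  qed
qed

lemma V_restr_image: "restr (J - {i}) ` V S J s = V S (J - {i}) s"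
proof
  show "restr (J - {i}) ` V S J s \<subseteq> V S (J - {i}) s" by (auto simp: V_def pts_def)
  show "V S (J - {i}) s \<subseteq> restr (J - {i}) ` V S J s"
  proof
    fix g assume g: "g \<in> V S (J - {i}) s"
    then have "g = restr (J - {i}) g" by (simp add: restr_V)
    moreover have "g \<in> V S J s" using g by (auto simp: V_def pts_def)
    ultimately show "g \<in> restr (J - {i}) ` V S J s" by blast
  qed
qed

lemma V_restr_zero_iff:
  assumes "i \<in> J"
  shows "g \<in> V S J s \<and> restr (J - {i}) g = 0 \<longleftrightarrow> g \<in> V (insert i S) J s"
proof -
  have "restr (J - {i}) g = 0 \<longleftrightarrow> keys g \<inter> {m. keys m \<subseteq> J - {i}} = {}"
    unfolding keys_eq_empty[symmetric] by simp
  then show ?thesis by (auto simp: V_def pts_def)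
qed

lemma restr_tder_self: "restr (J - {i}) (tder i * g) = 0"
proof (rule part_eq_0, rule ccontr)
  assume "keys (tder i * g) \<inter> {m. keys m \<subseteq> J - {i}} \<noteq> {}"
  then obtain m where m: "m \<in> keys (tder i * g)" "keys m \<subseteq> J - {i}" by blast
  from m(1) obtain v m' where "m = v + m'" "v \<in> keys (tder i)" by (rule keys_mult_mem)
  then have "i \<in> keys m" by (simp add: keys_toric_deriv keys_add_nat)
  then show False using m(2) by blast
qed

text \<open>The i-th derivative is divisible by u_i and disappears on the hyperplane.\<close>

lemma restr_relation:
  assumes "i \<in> J"
  shows "restr (J - {i}) (restr J (\<Sum>j\<in>J. tder j * a j)) = restr (J - {i}) (\<Sum>j\<in>J - {i}. tder j * restr (J - {i}) (a j))"
proof -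
  have "restr (J - {i}) (restr J (\<Sum>j\<in>J. tder j * a j)) = restr (J - {i}) (\<Sum>j\<in>J. tder j * a j)"
    unfolding restr_restr by (simp add: Int_absorb2)
  also have "\<dots> = restr (J - {i}) (tder i * a i) + restr (J - {i}) (\<Sum>j\<in>J - {i}. tder j * a j)"
    using assms by (simp add: sum.remove part_add)
  also have "\<dots> = restr (J - {i}) (\<Sum>j\<in>J - {i}. tder j * a j)" by (simp add: restr_tder_self)
  also have "\<dots> = restr (J - {i}) (\<Sum>j\<in>J - {i}. tder j * restr (J - {i}) (a j))"
    unfolding part_sum by (intro sum.cong refl restr_mult[symmetric])
  finally show ?thesis .
qed

lemma B_restr_image:
  assumes i: "i \<in> J" "i \<notin> S"
  shows "restr (J - {i}) ` B S J s = B S (J - {i}) s"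
proof
  show "restr (J - {i}) ` B S J s \<subseteq> B S (J - {i}) s"
  proof
    fix y assume "y \<in> restr (J - {i}) ` B S J s"
    then obtain h a where y: "y = restr (J - {i}) (h + restr J (\<Sum>j\<in>J. tder j * a j))" "h \<in> V S J (s - 1)"
      "\<forall>j\<in>J. a j \<in> V (S - {j}) J (s - int D)" unfolding B_def by blast
    have e: "y = restr (J - {i}) h + restr (J - {i}) (\<Sum>j\<in>J - {i}. tder j * restr (J - {i}) (a j))"
      unfolding y part_add restr_relation[OF i(1)] ..
    show "y \<in> B S (J - {i}) s"
      unfolding e using y(2,3) V_restr_image by (intro B_I) blast+
  qed
  show "B S (J - {i}) s \<subseteq> restr (J - {i}) ` B S J s"
  proof
    fix y assume "y \<in> B S (J - {i}) s"
    then obtain h a where y: "y = h + restr (J - {i}) (\<Sum>j\<in>J - {i}. tder j * a j)" "h \<in> V S (J - {i}) (s - 1)"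
      "\<forall>j\<in>J - {i}. a j \<in> V (S - {j}) (J - {i}) (s - int D)" unfolding B_def by blast
    define a' where "a' j = (if j = i then 0 else a j)" for j
    have V_sub: "V S' (J - {i}) r \<subseteq> V S' J r" for S' r by (auto simp: V_def pts_def)
    have "a' j \<in> V (S - {j}) J (s - int D)" if "j \<in> J" for j
      using y(3) V_sub that pm.subspace_0[OF subspace_V] by (cases "j = i") (auto simp: a'_def)
    moreover have "h \<in> V S J (s - 1)" using y(2) V_sub by blast
    ultimately have "h + restr J (\<Sum>j\<in>J. tder j * a' j) \<in> B S J s" by (intro B_I)
    moreover have "restr (J - {i}) (h + restr J (\<Sum>j\<in>J. tder j * a' j)) = y"
    proof -
      have "restr (J - {i}) (\<Sum>j\<in>J - {i}. tder j * restr (J - {i}) (a' j)) = restr (J - {i}) (\<Sum>j\<in>J - {i}. tder j * a j)"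
      proof (intro arg_cong[where f = "restr (J - {i})"] sum.cong refl)
        fix j assume "j \<in> J - {i}"
        then have "a j \<in> V (S - {j}) (J - {i}) (s - int D)" "a' j = a j" using y(3) by (auto simp: a'_def)
        then have "restr (J - {i}) (a j) = a j" "a' j = a j" by (simp_all add: restr_V)
        then show "tder j * restr (J - {i}) (a' j) = tder j * a j" by simp
      qed
      then show ?thesis unfolding part_add restr_relation[OF i(1)] y(1) by (simp add: restr_V[OF y(2)])
    qed
    ultimately show "y \<in> restr (J - {i}) ` B S J s" by blast
  qed
qed

text \<open>On u_i = 0 the relation part of y equals minus the restriction of h, so it has level s -
  1. \<open>relation_reduce\<close> then writes the restricted coefficients as b plus Koszul terms
  e. Subtracting both makes the coefficients divisible by u_i; b is absorbed into h, and the Koszul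
  terms cancel.\<close>

lemma B_restr_kernel:
  assumes i: "i \<in> J" and S: "S \<subseteq> J - {i}"
  shows "{y \<in> B S J s. restr (J - {i}) y = 0} = B (insert i S) J s"
proof
  have iS: "i \<notin> S" using S by auto
  show "B (insert i S) J s \<subseteq> {y \<in> B S J s. restr (J - {i}) y = 0}"
  proof
    fix y assume y: "y \<in> B (insert i S) J s"
    have "restr (J - {i}) y = 0" using B_subset_V y V_restr_zero_iff[OF i] by blast
    moreover have "V (insert i S) J r \<subseteq> V S J r" "V (insert i S - {j}) J r \<subseteq> V (S - {j}) J r" for j r
      by (auto simp: V_def pts_def)
    then have "y \<in> B S J s" using y unfolding B_def by blast
    ultimately show "y \<in> {y \<in> B S J s. restr (J - {i}) y = 0}" by blast
  qed
  show "{y \<in> B S J s. restr (J - {i}) y = 0} \<subseteq> B (insert i S) J s"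
  proof
    fix y assume "y \<in> {y \<in> B S J s. restr (J - {i}) y = 0}"
    then obtain h a where y: "y = h + restr J (\<Sum>j\<in>J. tder j * a j)" "h \<in> V S J (s - 1)"
      "\<And>j. j \<in> J \<Longrightarrow> a j \<in> V (S - {j}) J (s - int D)" and y0: "restr (J - {i}) y = 0" unfolding B_def by blast
    let ?J = "J - {i}"
    let ?a = "\<lambda>j. restr ?J (a j)"
    let ?k = "restr ?J (\<Sum>j\<in>?J. tder j * ?a j)"
    have k0: "restr ?J h + ?k = 0"
      using y0 unfolding y(1) part_add restr_relation[OF i] .
    have hJ: "restr ?J h \<in> V S ?J (s - 1)" using y(2) V_restr_image by blast
    have "?k = - restr ?J h" using k0 by (simp add: eq_neg_iff_add_eq_0 add.commute)
    then have kV: "?k \<in> V S ?J (s - 1)" using pm.subspace_neg[OF subspace_V hJ] by simp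
    have aV: "?a j \<in> V (S - {j}) ?J (s - int D)" if "j \<in> ?J" for j
      using y(3)[of j] that V_restr_image by blast
    obtain b d where b: "\<And>j. j \<in> ?J \<Longrightarrow> b j \<in> V (S - {j}) ?J (s - 1 - int D)"
        "?k = restr ?J (\<Sum>j\<in>?J. tder j * b j)"
        "\<And>j l. j \<in> ?J \<Longrightarrow> l \<in> ?J \<Longrightarrow> j \<noteq> l \<Longrightarrow> d j l \<in> V (S - {j, l}) ?J (s - 2 * int D) \<and> d l j = - d j l"
        "\<And>j. j \<in> ?J \<Longrightarrow> ?a j = b j + restr ?J (\<Sum>l\<in>?J - {j}. tder l * d j l)"
      using relation_reduce[OF S aV kV] by blast
    have V_sub: "g \<in> V S' ?J r \<Longrightarrow> g \<in> V S' J r" for g S' r by (auto simp: V_def pts_def)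
    define h' where "h' = h + restr J (\<Sum>j\<in>?J. tder j * b j)"
    define e where "e j = restr J (\<Sum>l\<in>?J - {j}. tder l * d j l)" for j
    define a' where "a' j = (if j = i then a j else a j - b j - e j)" for j
    have restr_sub: "restr ?J (restr J g) = restr ?J g" for g unfolding restr_restr by (simp add: Int_absorb2)
    have "h' \<in> V (insert i S) J (s - 1)"
    proof -
      have "restr J (\<Sum>j\<in>?J. tder j * b j) \<in> V S J (s - 1)"
        unfolding part_sum using b(1) by (intro pm.subspace_sum[OF subspace_V] tder_mult_V[where J' = ?J])
      then have "h' \<in> V S J (s - 1)" unfolding h'_def by (rule pm.subspace_add[OF subspace_V y(2)])
      moreover have "restr ?J h' = 0" unfolding h'_def part_add restr_sub using k0 b(2) by simp
      ultimately show ?thesis using V_restr_zero_iff[OF i] by blast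
    qed
    \<comment> \<open>For j = i no divisibility by u_i is demanded, since
      \<open>insert i S - {i}\<close> is S; this is why a_i is kept as it is.\<close>
    moreover have "a' j \<in> V (insert i S - {j}) J (s - int D)" if j: "j \<in> J" for j
    proof (cases "j = i")
      case True
      then show ?thesis using y(3)[OF j] iS by (simp add: a'_def)
    next
      case False
      then have jJ: "j \<in> ?J" using j by simp
      have "e j \<in> V (S - {j}) J (s - int D)" unfolding e_def part_sum
      proof (intro pm.subspace_sum[OF subspace_V] tder_mult_V[where J' = ?J])
        fix l assume "l \<in> ?J - {j}"
        then have "d j l \<in> V (S - {j, l}) ?J (s - 2 * int D)" using b(3)[of j l] jJ by blast
        moreover have "S - {j} - {l} = S - {j, l}" by auto
        ultimately show "d j l \<in> V (S - {j} - {l}) ?J (s - int D - int D)" by (simp add: algebra_simps)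
      qed
      moreover have "b j \<in> V (S - {j}) J (s - int D)"
        by (rule V_mono[OF _ V_sub[OF b(1)[OF jJ]]]) simp
      ultimately have "a' j \<in> V (S - {j}) J (s - int D)"
        unfolding a'_def using False y(3)[OF j] by (auto intro!: pm.subspace_diff[OF subspace_V])
      moreover have "restr ?J (a' j) = 0"
      proof -
        have "restr ?J (a' j) = ?a j - restr ?J (b j) - restr ?J (e j)"
          using False by (simp only: a'_def if_False part_diff)
        moreover have "restr ?J (e j) = restr ?J (\<Sum>l\<in>?J - {j}. tder l * d j l)"
          unfolding e_def by (rule restr_sub)
        ultimately show ?thesis using b(4)[OF jJ] restr_V[OF b(1)[OF jJ]] by simp
      qed
      moreover have "insert i S - {j} = insert i (S - {j})" using False by auto
      ultimately show ?thesis using V_restr_zero_iff[OF i] by auto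
    qed
    moreover have "y = h' + restr J (\<Sum>j\<in>J. tder j * a' j)"
    proof -
      \<comment> \<open>The Koszul terms were obtained on the hyperplane, but d is antisymmetric as
        a family of polynomials, so they cancel over J as well.\<close>
      have cancel: "(\<Sum>j\<in>?J. restr J (tder j * e j)) = 0"
      proof -
        have "restr J (tder j * e j) = (\<Sum>l\<in>?J - {j}. restr J (tder j * (tder l * d j l)))" for j
          unfolding e_def restr_mult by (simp add: sum_distrib_left part_sum)
        then have "(\<Sum>j\<in>?J. restr J (tder j * e j)) = (\<Sum>j\<in>?J. \<Sum>l\<in>?J - {j}. restr J (tder j * (tder l * d j l)))" by simp
        also have "\<dots> = 0"
        proof (rule sum_antisym)
          fix j l assume jl: "j \<in> ?J" "l \<in> ?J" "j \<noteq> l"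
          have "tder l * (tder j * d l j) = - (tder j * (tder l * d j l))"
            using b(3)[OF jl] by (simp only: mult_minus_right mult.left_commute)
          then show "restr J (tder l * (tder j * d l j)) = - restr J (tder j * (tder l * d j l))"
            by (simp only:) (rule poly_mapping_eqI, simp add: lookup_part)
        qed
        finally show ?thesis .
      qed
      have "restr J (\<Sum>j\<in>J. tder j * a' j) = restr J (tder i * a i) + (\<Sum>j\<in>?J. restr J (tder j * (a j - b j - e j)))"
        using i by (simp add: sum.remove a'_def part_add part_sum)
      also have "(\<Sum>j\<in>?J. restr J (tder j * (a j - b j - e j))) =
          (\<Sum>j\<in>?J. restr J (tder j * a j)) - (\<Sum>j\<in>?J. restr J (tder j * b j)) - (\<Sum>j\<in>?J. restr J (tder j * e j))"
        by (simp only: right_diff_distrib part_diff sum_subtractf)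
      finally have "h' + restr J (\<Sum>j\<in>J. tder j * a' j) = h + (restr J (tder i * a i) + (\<Sum>j\<in>?J. restr J (tder j * a j)))"
        unfolding cancel h'_def part_sum by (simp add: algebra_simps)
      also have "restr J (tder i * a i) + (\<Sum>j\<in>?J. restr J (tder j * a j)) = restr J (\<Sum>j\<in>J. tder j * a j)"
        unfolding part_sum using i by (simp add: sum.remove)
      finally show ?thesis by (simp add: y(1))
    qed
    ultimately show "y \<in> B (insert i S) J s" by (simp add: B_I)
  qed
qed

definition T :: "'n set \<Rightarrow> 'n set \<Rightarrow> int \<Rightarrow> int" where
  "T S J s = int (pm.dim (V S J s)) - int (pm.dim (B S J s))"

text \<open>Rank and nullity of the restriction to u_i = 0, once on V and once on B.\<close>

lemma T_insert:
  assumes i: "i \<in> J" and S: "S \<subseteq> J - {i}"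
  shows "T (insert i S) J s = T S J s - T S (J - {i}) s"
proof -
  obtain Tb where Tb: "finite Tb" "V S J s \<subseteq> pm.span Tb" by (rule V_span)
  have iS: "i \<notin> S" using S by auto
  have "pm.dim (V S J s) = pm.dim {g \<in> V S J s. restr (J - {i}) g = 0} + pm.dim (restr (J - {i}) ` V S J s)"
    by (rule dim_kernel_plus_image[OF subspace_V Tb]) (auto simp: part_add part_scal)
  also have "{g \<in> V S J s. restr (J - {i}) g = 0} = V (insert i S) J s" using V_restr_zero_iff[OF i] by blast
  finally have 1: "pm.dim (V S J s) = pm.dim (V (insert i S) J s) + pm.dim (V S (J - {i}) s)"
    unfolding V_restr_image .
  have BT: "B S J s \<subseteq> pm.span Tb" using B_subset_V Tb(2) by (rule order_trans)
  have "pm.dim (B S J s) = pm.dim {g \<in> B S J s. restr (J - {i}) g = 0} + pm.dim (restr (J - {i}) ` B S J s)"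
    by (rule dim_kernel_plus_image[OF subspace_B Tb(1) BT]) (auto simp: part_add part_scal)
  then have 2: "pm.dim (B S J s) = pm.dim (B (insert i S) J s) + pm.dim (B S (J - {i}) s)"
    unfolding B_restr_kernel[OF i S] B_restr_image[OF i iS] .
  show ?thesis using 1 2 by (simp add: T_def)
qed

text \<open>Each element of S either stays in J or is removed from it at the cost of a sign.\<close>

lemma T_expand:
  assumes "S \<subseteq> J"
  shows "T S J s = (\<Sum>I\<in>Pow S. (-1) ^ card I * T {} (J - I) s)"
proof -
  have "finite S" by simp
  then show ?thesis using assms
  proof (induction S arbitrary: J)
    case (insert i S)
    have i: "i \<in> J" "S \<subseteq> J - {i}" "S \<subseteq> J" using insert by auto
    have inj: "inj_on (insert i) (Pow S)" using insert.hyps by (auto simp: inj_on_def)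
    have "(\<Sum>I\<in>insert i ` Pow S. (-1) ^ card I * T {} (J - I) s)
        = (\<Sum>I\<in>Pow S. - ((-1) ^ card I * T {} (J - {i} - I) s))"
      unfolding sum.reindex[OF inj] comp_def
    proof (rule sum.cong[OF refl])
      fix I assume "I \<in> Pow S"
      then have "card (insert i I) = Suc (card I)" using insert.hyps by (subst card_insert_disjoint) auto
      moreover have "J - insert i I = J - {i} - I" by auto
      ultimately show "(-1) ^ card (insert i I) * T {} (J - insert i I) s = - ((-1) ^ card I * T {} (J - {i} - I) s)"
        by simp
    qed
    also have "\<dots> = - T S (J - {i}) s" using insert.IH[OF i(2)] by (simp add: sum_negf)
    finally have 1: "(\<Sum>I\<in>insert i ` Pow S. (-1) ^ card I * T {} (J - I) s) = - T S (J - {i}) s" .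
    have "Pow S \<inter> insert i ` Pow S = {}" using insert.hyps by auto
    then have "(\<Sum>I\<in>Pow (insert i S). (-1) ^ card I * T {} (J - I) s) = T S J s - T S (J - {i}) s"
      unfolding Pow_insert using 1 insert.IH[OF i(3)] by (subst sum.union_disjoint) auto
    then show ?case using T_insert[OF i(1,2)] by simp
  qed simp
qed

end

section \<open>Spectra\<close>

definition ones :: "'n::finite set \<Rightarrow> ('n \<Rightarrow>\<^sub>0 nat)" where
  "ones A = (\<Sum>i\<in>A. Poly_Mapping.single i 1)"

lemma lookup_ones: "lookup (ones A) i = (if i \<in> A then 1 else 0)"
  by (simp add: ones_def lookup_sum lookup_single when_def)

lemma keys_ones [simp]: "keys (ones A) = A"
  by (auto simp: in_keys_iff lookup_ones split: if_splits)

lemma prod_var: "(\<Prod>i\<in>A. var i) = Poly_Mapping.single (ones A) 1" if "finite A"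
  using that by (induction A) (simp_all add: ones_def var_def mult_single)

lemma mult_single_expand:
  "g * Poly_Mapping.single c 1 = (\<Sum>k\<in>keys g. Poly_Mapping.single (k + c) (lookup g k))"
  for g :: "'n mpoly"
proof -
  have "g * Poly_Mapping.single c 1 = (\<Sum>k\<in>keys g. scal (lookup g k) * Poly_Mapping.single k 1) * Poly_Mapping.single c 1"
    by (subst (1) poly_mapping_expansion[of g]) (rule refl)
  then show ?thesis by (simp add: sum_distrib_right mult_single)
qed

lemma lookup_mult_single: "lookup (g * Poly_Mapping.single c 1) (m + c) = lookup g m" for g :: "'n mpoly"
  by (simp add: mult_single_expand lookup_sum lookup_single when_def in_keys_iff if_distrib cong: if_cong)

lemma keys_mult_single: "keys (g * Poly_Mapping.single c 1) = (\<lambda>m. m + c) ` keys g" for g :: "'n mpoly"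
proof (intro set_eqI iffI)
  fix x assume x: "x \<in> keys (g * Poly_Mapping.single c 1)"
  then obtain v where "x = v + c" by (auto elim!: keys_mult_mem)
  then show "x \<in> (\<lambda>m. m + c) ` keys g" using x by (auto simp: in_keys_iff lookup_mult_single)
qed (auto simp: in_keys_iff lookup_mult_single)

lemma mult_single_inj: "g * Poly_Mapping.single c 1 = 0 \<Longrightarrow> g = 0" for g :: "'n mpoly"
  by (rule poly_mapping_eqI) (metis lookup_mult_single lookup_zero)

lemma divisible_by_ones:
  fixes G :: "'n::finite mpoly"
  assumes "\<And>m. m \<in> keys G \<Longrightarrow> A \<subseteq> keys m"
  obtains g where "G = g * Poly_Mapping.single (ones A) 1"
proof
  have e: "m - ones A + ones A = m" if "m \<in> keys G" for m
  proof (rule poly_mapping_eqI)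
    fix i show "lookup (m - ones A + ones A) i = lookup m i"
      using assms[OF that] by (auto simp: lookup_add lookup_minus lookup_ones in_keys_iff subset_iff Suc_le_eq)
  qed
  have "G = (\<Sum>m\<in>keys G. Poly_Mapping.single m (lookup G m))"
    by (subst (1) poly_mapping_expansion) (simp add: mult_single)
  also have "\<dots> = (\<Sum>m\<in>keys G. Poly_Mapping.single (m - ones A) (lookup G m)) * Poly_Mapping.single (ones A) 1"
    by (simp add: sum_distrib_right mult_single e)
  finally show "G = (\<Sum>m\<in>keys G. Poly_Mapping.single (m - ones A) (lookup G m)) * Poly_Mapping.single (ones A) 1" .
qed

lemma polys_in_eq: "polys_in J = {g. keys g \<subseteq> {m. keys m \<subseteq> J}}"
  unfolding polys_in_def by blast

lemma subspace_polys_in: "pm.subspace (polys_in J)"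
  unfolding polys_in_eq by (rule subspace_keys)

lemma subspace_ideal_gen: "pm.subspace (ideal_gen J h)"
proof (rule pm.subspaceI)
  note p = subspace_polys_in[of J]
  show "0 \<in> ideal_gen J h" unfolding ideal_gen_def
    using pm.subspace_0[OF p] by (intro CollectI exI[of _ "\<lambda>_. 0"]) simp
  fix x y assume "x \<in> ideal_gen J h" "y \<in> ideal_gen J h"
  then obtain a b where *: "x = (\<Sum>j\<in>J. a j * h j)" "\<forall>j\<in>J. a j \<in> polys_in J" "y = (\<Sum>j\<in>J. b j * h j)" "\<forall>j\<in>J. b j \<in> polys_in J"
    unfolding ideal_gen_def by blast
  then show "x + y \<in> ideal_gen J h" unfolding ideal_gen_def
    using pm.subspace_add[OF p] by (intro CollectI exI[of _ "\<lambda>j. a j + b j"]) (simp add: distrib_right sum.distrib)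
next
  note p = subspace_polys_in[of J]
  fix c x assume "x \<in> ideal_gen J h"
  then obtain a where *: "x = (\<Sum>j\<in>J. a j * h j)" "\<forall>j\<in>J. a j \<in> polys_in J"
    unfolding ideal_gen_def by blast
  then show "scal c * x \<in> ideal_gen J h" unfolding ideal_gen_def
    using pm.subspace_scale[OF p] by (intro CollectI exI[of _ "\<lambda>j. scal c * a j"]) (simp add: sum_distrib_left mult.assoc)
qed

context newton_poly
begin

lemma D_nu_int: "of_nat D * nu m \<in> \<int>"
proof -
  let ?s = "\<lambda>F. \<Sum>i\<in>UNIV. facet_vec UNIV P F i * of_nat (lookup m i)"
  have "nu m = Max (?s ` boundary_facets UNIV P)" by (simp add: newton_fun_def Let_def)
  also have "\<dots> \<in> ?s ` boundary_facets UNIV P"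
    using finite_boundary_facets boundary_facets_nonempty by (intro Max_in) auto
  finally obtain F where F: "F \<in> boundary_facets UNIV P" "nu m = ?s F" by blast
  have "of_nat D * nu m = (\<Sum>i\<in>UNIV. (of_nat D * facet_vec UNIV P F i) * of_nat (lookup m i))"
    unfolding F(2) by (simp add: sum_distrib_left mult.assoc)
  also have "\<dots> \<in> \<int>" by (rule Ints_sum) (rule Ints_mult[OF denom[OF F(1)] Ints_of_nat])
  finally show ?thesis .
qed

lemma D_nu_less_iff: "of_nat D * nu m < of_int s \<longleftrightarrow> of_nat D * nu m \<le> of_int (s - 1)"
proof -
  obtain k where k: "of_nat D * nu m = of_int k" using D_nu_int by (auto elim: Ints_cases)
  show ?thesis unfolding k of_int_less_iff of_int_le_iff by linarith
qed

definition E :: "'n set \<Rightarrow> 'n set \<Rightarrow> 'n mpoly set" where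
  "E S J = {g. keys g \<subseteq> {m. keys m \<subseteq> J \<and> S \<subseteq> keys m}}"

text \<open>All relations, without a bound on the level of the coefficients, as the ideals defining
  the spectra require.\<close>

definition Lid :: "'n set \<Rightarrow> 'n set \<Rightarrow> 'n mpoly set" where
  "Lid S J = {restr J (\<Sum>j\<in>J. tder j * a j) | a. \<forall>j\<in>J. a j \<in> E (S - {j}) J}"

lemma V_subset_E: "V S J s \<subseteq> E S J"
  by (auto simp: V_def E_def pts_def)

lemma E_level: "g \<in> E S J \<Longrightarrow> \<exists>s. g \<in> V S J s"
proof -
  assume g: "g \<in> E S J"
  define s where "s = Max (insert 0 ((\<lambda>m. \<lceil>of_nat D * nu m\<rceil>) ` keys g))"
  have "of_nat D * nu m \<le> of_int s" if "m \<in> keys g" for m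
  proof -
    have "\<lceil>of_nat D * nu m\<rceil> \<le> s" unfolding s_def using that by (intro Max_ge) auto
    then show ?thesis by (simp add: ceiling_le_iff)
  qed
  then have "g \<in> V S J s" using g by (auto simp: V_def E_def pts_def)
  then show ?thesis by blast
qed

lemma E_level_family:
  assumes "\<And>j. j \<in> J \<Longrightarrow> a j \<in> E (S - {j}) J"
  shows "\<exists>s. \<forall>j\<in>J. a j \<in> V (S - {j}) J s"
proof -
  define t where "t j = (SOME s. a j \<in> V (S - {j}) J s)" for j
  have t: "a j \<in> V (S - {j}) J (t j)" if "j \<in> J" for j
    unfolding t_def by (rule someI_ex[OF E_level[OF assms[OF that]]])
  have m: "t j \<le> Max (insert 0 (t ` J))" if "j \<in> J" for j using that by (intro Max_ge) auto
  show ?thesis by (intro exI[of _ "Max (insert 0 (t ` J))"] ballI) (rule V_mono[OF m t])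
qed

text \<open>The finitely many coefficients of a relation have some common level, which
  \<open>relation_strict\<close> brings down to s - D. This is where the bounded and the unbounded
  description meet.\<close>

lemma B_eq:
  assumes S: "S \<subseteq> J"
  shows "B S J s = {g \<in> V S J s. \<exists>g'\<in>V S J (s - 1). g - g' \<in> Lid S J}"
proof
  show "B S J s \<subseteq> {g \<in> V S J s. \<exists>g'\<in>V S J (s - 1). g - g' \<in> Lid S J}"
  proof
    fix y assume y: "y \<in> B S J s"
    then obtain h a where *: "y = h + restr J (\<Sum>j\<in>J. tder j * a j)" "h \<in> V S J (s - 1)"
      "\<forall>j\<in>J. a j \<in> V (S - {j}) J (s - int D)" unfolding B_def by blast
    have "y - h = restr J (\<Sum>j\<in>J. tder j * a j)" unfolding *(1) by simp
    then have "y - h \<in> Lid S J" unfolding Lid_def using *(3) V_subset_E by blast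
    then show "y \<in> {g \<in> V S J s. \<exists>g'\<in>V S J (s - 1). g - g' \<in> Lid S J}"
      using B_subset_V y *(2) by blast
  qed
  show "{g \<in> V S J s. \<exists>g'\<in>V S J (s - 1). g - g' \<in> Lid S J} \<subseteq> B S J s"
  proof
    fix g assume "g \<in> {g \<in> V S J s. \<exists>g'\<in>V S J (s - 1). g - g' \<in> Lid S J}"
    then obtain g' a where g: "g \<in> V S J s" "g' \<in> V S J (s - 1)" "g - g' = restr J (\<Sum>j\<in>J. tder j * a j)"
      "\<And>j. j \<in> J \<Longrightarrow> a j \<in> E (S - {j}) J" unfolding Lid_def by blast
    obtain t where t: "\<forall>j\<in>J. a j \<in> V (S - {j}) J t" using E_level_family[OF g(4)] by blast
    have t': "\<And>j. j \<in> J \<Longrightarrow> a j \<in> V (S - {j}) J ((t + int D) - int D)" using t by simp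
    have "g' \<in> V S J s" using g(2) by (rule V_mono[rotated]) simp
    then have "restr J (\<Sum>j\<in>J. tder j * a j) \<in> V S J s"
      unfolding g(3)[symmetric] using g(1) by (intro pm.subspace_diff[OF subspace_V])
    then obtain b where b: "\<forall>j\<in>J. b j \<in> V (S - {j}) J (s - int D)"
        "restr J (\<Sum>j\<in>J. tder j * a j) = restr J (\<Sum>j\<in>J. tder j * b j)"
      using relation_strict[OF S t'] by blast
    have "g = g' + restr J (\<Sum>j\<in>J. tder j * b j)" using g(3) b(2) by (simp add: algebra_simps)
    then show "g \<in> B S J s" using B_I[OF g(2), of b] b(1) by simp
  qed
qed

lemma nu_le_iff: "nu m \<le> of_int s / of_nat D \<longleftrightarrow> of_nat D * nu m \<le> of_int s"
  using D_pos by (simp add: field_simps)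

text \<open>D times the Newton function is integral, so lying at some rational level below s/D means
  lying at level at most (s - 1)/D.\<close>

lemma T_eq_gr_dim:
  assumes S: "S \<subseteq> J" and J: "\<And>\<beta>. F \<beta> = {g. keys g \<subseteq> {m. keys m \<subseteq> J \<and> S \<subseteq> keys m \<and> nu m \<le> \<beta>}}"
    and \<alpha>: "\<alpha> = of_int s / of_nat D"
  shows "F \<alpha> = V S J s" "{g \<in> F \<alpha>. \<exists>\<beta><\<alpha>. \<exists>g'\<in>F \<beta>. g - g' \<in> Lid S J} = B S J s"
proof -
  show Fa: "F \<alpha> = V S J s" unfolding J V_def pts_def \<alpha> nu_le_iff ..
  have less: "(\<exists>\<beta><\<alpha>. g' \<in> F \<beta>) \<longleftrightarrow> g' \<in> V S J (s - 1)" for g'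
  proof
    assume "\<exists>\<beta><\<alpha>. g' \<in> F \<beta>"
    then obtain \<beta> where \<beta>: "\<beta> < \<alpha>" "g' \<in> F \<beta>" by blast
    have "of_nat D * nu m \<le> of_int (s - 1)" if "m \<in> keys g'" for m
    proof -
      have "nu m < \<alpha>" using \<beta> that by (auto simp: J)
      then have "of_nat D * nu m < of_int s" using D_pos by (simp add: \<alpha> field_simps)
      then show ?thesis by (simp only: D_nu_less_iff)
    qed
    then show "g' \<in> V S J (s - 1)" using \<beta>(2) by (auto simp: V_def pts_def J)
  next
    assume g': "g' \<in> V S J (s - 1)"
    have "of_int (s - 1) / of_nat D < \<alpha>" using D_pos by (simp add: \<alpha> divide_strict_right_mono)
    moreover have "g' \<in> F (of_int (s - 1) / of_nat D)" using g' unfolding J V_def pts_def nu_le_iff .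
    ultimately show "\<exists>\<beta><\<alpha>. g' \<in> F \<beta>" by blast
  qed
  have "{g \<in> F \<alpha>. \<exists>\<beta><\<alpha>. \<exists>g'\<in>F \<beta>. g - g' \<in> Lid S J} = {g \<in> F \<alpha>. \<exists>g'. (\<exists>\<beta><\<alpha>. g' \<in> F \<beta>) \<and> g - g' \<in> Lid S J}"
    by blast
  also have "\<dots> = {g \<in> V S J s. \<exists>g'\<in>V S J (s - 1). g - g' \<in> Lid S J}" unfolding less Fa by blast
  also have "\<dots> = B S J s" by (rule B_eq[OF S, symmetric])
  finally show "{g \<in> F \<alpha>. \<exists>\<beta><\<alpha>. \<exists>g'\<in>F \<beta>. g - g' \<in> Lid S J} = B S J s" .
qed

text \<open>Toric derivatives act diagonally on monomials and so commute with setting variables to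
  0.\<close>

lemma toric_ideal_eq: "toric_ideal J (set_zero (- J) f) = Lid {} J"
proof -
  have t: "var j * pdiff j (set_zero (- J) f) = restr J (tder j)" for j
    by (rule poly_mapping_eqI) (simp add: lookup_toric_deriv set_zero_eq lookup_part)
  have "a * restr J g = restr J (g * a)" if "a \<in> polys_in J" for a g
  proof -
    have "keys (a * restr J g) \<subseteq> {m. keys m \<subseteq> J}"
    proof
      fix x assume "x \<in> keys (a * restr J g)"
      then obtain v m where "x = v + m" "v \<in> keys a" "m \<in> keys (restr J g)" by (rule keys_mult_mem)
      then show "x \<in> {m. keys m \<subseteq> J}" using that by (simp add: keys_add_nat polys_in_def)
    qed
    then have "a * restr J g = restr J (a * restr J g)" by (rule part_id[symmetric])
    also have "\<dots> = restr J (g * a)" unfolding restr_mult by (simp add: mult.commute)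
    finally show ?thesis .
  qed
  then have s: "(\<Sum>j\<in>J. a j * restr J (tder j)) = restr J (\<Sum>j\<in>J. tder j * a j)" if "\<forall>j\<in>J. a j \<in> polys_in J" for a
    unfolding part_sum using that by (intro sum.cong) auto
  have E: "E ({} - {j}) J = polys_in J" for j by (auto simp: E_def polys_in_def)
  show ?thesis unfolding toric_ideal_def ideal_gen_def t Lid_def E using s by (metis (lifting))
qed

lemma toric_spectrum_eq:
  assumes J: "J \<noteq> {}" and \<alpha>: "\<alpha> = of_int s / of_nat D"
  shows "toric_newton_spectrum J (set_zero (- J) f) \<alpha> = T {} J s"
proof -
  let ?F = "newton_filt J (set_zero (- J) f)"
  let ?K = "toric_ideal J (set_zero (- J) f)"
  have F: "?F \<beta> = {g. keys g \<subseteq> {m. keys m \<subseteq> J \<and> {} \<subseteq> keys m \<and> nu m \<le> \<beta>}}" for \<beta>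
    using newton_fun_set_zero[OF conv J] by (auto simp: newton_filt_def polys_in_def)
  note T = T_eq_gr_dim[OF empty_subsetI F \<alpha>]
  obtain Tb where Tb: "finite Tb" "V {} J s \<subseteq> pm.span Tb" by (rule V_span)
  have "int (gr_dim ?F ?K \<alpha>) = int (pm.dim (?F \<alpha>)) - int (pm.dim {g \<in> ?F \<alpha>. \<exists>\<beta><\<alpha>. \<exists>g'\<in>?F \<beta>. g - g' \<in> ?K})"
  proof (rule gr_dim_eq[OF _ _ _ Tb(1)])
    show "pm.subspace (?F \<beta>)" for \<beta> unfolding F by (rule subspace_keys)
    show "?F \<beta> \<subseteq> ?F \<gamma>" if "\<beta> \<le> \<gamma>" for \<beta> \<gamma> unfolding F using that by force
    show "pm.subspace ?K" unfolding toric_ideal_def by (rule subspace_ideal_gen)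
    show "?F \<alpha> \<subseteq> pm.span Tb" unfolding T(1) by (rule Tb(2))
  qed
  then show ?thesis unfolding toric_newton_spectrum_def toric_ideal_eq
    unfolding T(2) unfolding T(1) T_def .
qed

abbreviation (input) shift :: "'n mpoly \<Rightarrow> 'n mpoly" where
  "shift g \<equiv> g * Poly_Mapping.single (ones UNIV) 1"

lemma shift_image: "shift ` {g. \<forall>m\<in>keys (shift g). Q m} = {g. keys g \<subseteq> {m. keys m \<subseteq> UNIV \<and> UNIV \<subseteq> keys m \<and> Q m}}"
proof (intro equalityI subsetI)
  fix G assume "G \<in> shift ` {g. \<forall>m\<in>keys (shift g). Q m}"
  then obtain g where g: "G = shift g" "\<forall>m\<in>keys G. Q m" by blast
  have "UNIV \<subseteq> keys m" if "m \<in> keys G" for m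
    using that unfolding g(1) keys_mult_single by (auto simp: keys_add_nat)
  then show "G \<in> {g. keys g \<subseteq> {m. keys m \<subseteq> UNIV \<and> UNIV \<subseteq> keys m \<and> Q m}}" using g(2) by blast
next
  fix G :: "'n mpoly" assume G: "G \<in> {g. keys g \<subseteq> {m. keys m \<subseteq> UNIV \<and> UNIV \<subseteq> keys m \<and> Q m}}"
  then have "\<And>m. m \<in> keys G \<Longrightarrow> UNIV \<subseteq> keys m" by blast
  then obtain g where "G = shift g" by (rule divisible_by_ones)
  then show "G \<in> shift ` {g. \<forall>m\<in>keys (shift g). Q m}" using G by blast
qed

text \<open>u_1 ... u_n df/du_j is u_j df/du_j times the product of the other variables; hence
  divisibility by \<open>UNIV - {j}\<close> in the coefficients.\<close>

lemma shift_jacobian: "shift ` jacobian_ideal f = Lid UNIV UNIV"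
proof -
  have U: "shift (a * pdiff j f) = tder j * (a * Poly_Mapping.single (ones (UNIV - {j})) 1)" for a j
  proof -
    have "Poly_Mapping.single (ones UNIV) 1 = var j * (Poly_Mapping.single (ones (UNIV - {j})) 1 :: 'n mpoly)"
      unfolding prod_var[OF finite, symmetric] by (rule prod.remove) auto
    then show ?thesis by (simp add: mult_ac)
  qed
  have id: "restr UNIV g = g" for g :: "'n mpoly" by (intro part_id) auto
  show ?thesis
  proof (intro equalityI subsetI)
    fix y assume "y \<in> shift ` jacobian_ideal f"
    then obtain a where "y = shift (\<Sum>j\<in>UNIV. a j * pdiff j f)"
      unfolding jacobian_ideal_def ideal_gen_def by blast
    then have "y = restr UNIV (\<Sum>j\<in>UNIV. tder j * (a j * Poly_Mapping.single (ones (UNIV - {j})) 1))"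
      unfolding id by (simp only: sum_distrib_right U)
    moreover have "a j * Poly_Mapping.single (ones (UNIV - {j})) 1 \<in> E (UNIV - {j}) UNIV" for j
      unfolding E_def mem_Collect_eq keys_mult_single by (auto simp: keys_add_nat)
    ultimately show "y \<in> Lid UNIV UNIV" unfolding Lid_def
      by (intro CollectI exI[of _ "\<lambda>j. a j * Poly_Mapping.single (ones (UNIV - {j})) 1"] conjI ballI)
  next
    fix y assume "y \<in> Lid UNIV UNIV"
    then obtain a where a: "y = (\<Sum>j\<in>UNIV. tder j * a j)" "\<And>j. a j \<in> E (UNIV - {j}) UNIV"
      unfolding Lid_def id by blast
    have "\<exists>g. a j = g * Poly_Mapping.single (ones (UNIV - {j})) 1" for j
    proof -
      have "UNIV - {j} \<subseteq> keys m" if "m \<in> keys (a j)" for m using a(2)[of j] that by (auto simp: E_def)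
      then obtain g where "a j = g * Poly_Mapping.single (ones (UNIV - {j})) 1" by (rule divisible_by_ones)
      then show ?thesis by blast
    qed
    then obtain g where g: "\<And>j. a j = g j * Poly_Mapping.single (ones (UNIV - {j})) 1" by metis
    have "y = shift (\<Sum>j\<in>UNIV. g j * pdiff j f)"
      unfolding a(1) g sum_distrib_right U ..
    moreover have "(\<Sum>j\<in>UNIV. g j * pdiff j f) \<in> jacobian_ideal f"
      unfolding jacobian_ideal_def ideal_gen_def polys_in_def by (intro CollectI exI[of _ g]) simp
    ultimately show "y \<in> shift ` jacobian_ideal f" by blast
  qed
qed

text \<open>W is the Newton filtration pulled back along multiplication by u_1 ... u_n. This map is
  injective, so rank and nullity transport all dimensions.\<close>

lemma newton_spectrum_eq:
  assumes \<alpha>: "\<alpha> = of_int s / of_nat D"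
  shows "newton_spectrum f \<alpha> = T UNIV UNIV s"
proof -
  let ?F = "W_filt f" and ?K = "jacobian_ideal f"
  let ?B = "{g \<in> ?F \<alpha>. \<exists>\<beta><\<alpha>. \<exists>g'\<in>?F \<beta>. g - g' \<in> ?K}"
  let ?G = "\<lambda>\<beta>. {g :: 'n mpoly. keys g \<subseteq> {m. keys m \<subseteq> UNIV \<and> UNIV \<subseteq> keys m \<and> nu m \<le> \<beta>}}"
  have F: "?F \<beta> = {g. \<forall>m\<in>keys (shift g). nu m \<le> \<beta>}" for \<beta>
    unfolding W_filt_def prod_var[OF finite] ..
  have FG: "shift ` ?F \<beta> = ?G \<beta>" for \<beta> unfolding F by (rule shift_image)
  have GF: "shift g \<in> ?G \<beta> \<longleftrightarrow> g \<in> ?F \<beta>" for g \<beta>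
    unfolding F mem_Collect_eq keys_mult_single by (auto simp: keys_add_nat)
  have T: "shift ` ?F \<alpha> = V UNIV UNIV s"
    "{g \<in> shift ` ?F \<alpha>. \<exists>\<beta><\<alpha>. \<exists>g'\<in>shift ` ?F \<beta>. g - g' \<in> Lid UNIV UNIV} = B UNIV UNIV s"
    unfolding FG by (rule T_eq_gr_dim[OF subset_UNIV refl \<alpha>])+
  have inj: "g = h" if "shift g = shift h" for g h :: "'n mpoly"
    using mult_single_inj[of "g - h" "ones UNIV"] that by (simp add: left_diff_distrib)
  have subspace_F: "pm.subspace (?F \<beta>)" for \<beta>
  proof (rule pm.subspaceI)
    have G: "pm.subspace (?G \<beta>)" by (rule subspace_keys)
    show "0 \<in> ?F \<beta>" by (simp add: F)
    show "x + y \<in> ?F \<beta>" if "x \<in> ?F \<beta>" "y \<in> ?F \<beta>" for x y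
      using pm.subspace_add[OF G, of "shift x" "shift y"] that GF[of _ \<beta>] by (simp only: distrib_right[symmetric])
    show "scal c * x \<in> ?F \<beta>" if "x \<in> ?F \<beta>" for c x
      using pm.subspace_scale[OF G, of "shift x" c] that GF[of _ \<beta>] by (simp only: mult.assoc[symmetric])
  qed
  have mono: "?F \<beta> \<subseteq> ?F \<gamma>" if "\<beta> \<le> \<gamma>" for \<beta> \<gamma> unfolding F using that by force
  have K: "pm.subspace ?K" unfolding jacobian_ideal_def by (rule subspace_ideal_gen)
  have finX: "finite ((\<lambda>m. m + ones UNIV) -` pts UNIV UNIV s)"
    using finite_pts by (rule finite_vimageI) (simp add: inj_def)
  have span: "?F \<alpha> \<subseteq> pm.span ((\<lambda>m. Poly_Mapping.single m (1::complex)) ` ((\<lambda>m. m + ones UNIV) -` pts UNIV UNIV s))"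
  proof
    fix g assume "g \<in> ?F \<alpha>"
    then have "shift g \<in> V UNIV UNIV s" using T(1) by blast
    then have "keys g \<subseteq> (\<lambda>m. m + ones UNIV) -` pts UNIV UNIV s" unfolding V_def mem_Collect_eq keys_mult_single by blast
    then show "g \<in> pm.span ((\<lambda>m. Poly_Mapping.single m (1::complex)) ` ((\<lambda>m. m + ones UNIV) -` pts UNIV UNIV s))"
      by (rule in_span_singles)
  qed
  have fin: "finite ((\<lambda>m. Poly_Mapping.single m (1::complex)) ` ((\<lambda>m. m + ones UNIV) -` pts UNIV UNIV s))"
    using finX by simp
  have dim: "pm.dim X = pm.dim (shift ` X)" if X: "pm.subspace X" "X \<subseteq> ?F \<alpha>" for X
  proof -
    have "pm.dim X = pm.dim {x \<in> X. shift x = 0} + pm.dim (shift ` X)"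
      by (rule dim_kernel_plus_image[OF X(1) fin order_trans[OF X(2) span]]) (simp_all add: distrib_right mult.assoc)
    also have "{x \<in> X. shift x = 0} = {0}" using pm.subspace_0[OF X(1)] mult_single_inj by auto
    also have "pm.dim {0 :: 'n mpoly} = 0" using pm.basis_card_eq_dim[of "{}" "{0}"] by (simp add: pm.independent_empty)
    finally show ?thesis by simp
  qed
  have "shift ` ?B = {g \<in> shift ` ?F \<alpha>. \<exists>\<beta><\<alpha>. \<exists>g'\<in>shift ` ?F \<beta>. g - g' \<in> Lid UNIV UNIV}"
  proof -
    have "shift g - shift g' \<in> shift ` ?K \<longleftrightarrow> g - g' \<in> ?K" for g g'
      unfolding left_diff_distrib[symmetric] using inj by blast
    then show ?thesis unfolding shift_jacobian[symmetric] by blast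
  qed
  then have B: "shift ` ?B = B UNIV UNIV s" using T(2) by simp
  have "pm.subspace ?B"
  proof (rule pm.subspaceI)
    note sB = subspace_B[of UNIV UNIV s, folded B]
    have iff: "shift g \<in> shift ` ?B \<longleftrightarrow> g \<in> ?B" for g using inj by blast
    show "0 \<in> ?B" using pm.subspace_0[OF sB] iff[of 0] by simp
    show "x + y \<in> ?B" if "x \<in> ?B" "y \<in> ?B" for x y
      using pm.subspace_add[OF sB, of "shift x" "shift y"] that iff by (simp only: distrib_right[symmetric])
    show "scal c * x \<in> ?B" if "x \<in> ?B" for c x
      using pm.subspace_scale[OF sB, of "shift x" c] that iff by (simp only: mult.assoc[symmetric])
  qed
  then have "pm.dim ?B = pm.dim (B UNIV UNIV s)" using dim[of ?B] B by simp
  moreover have "pm.dim (?F \<alpha>) = pm.dim (V UNIV UNIV s)" using dim[OF subspace_F order_refl] T(1) by simp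
  moreover have "int (gr_dim ?F ?K \<alpha>) = int (pm.dim (?F \<alpha>)) - int (pm.dim ?B)"
    by (rule gr_dim_eq[where F = ?F, OF subspace_F mono K fin span])
  ultimately show ?thesis by (simp add: newton_spectrum_def T_def)
qed

text \<open>Without variables only the constants remain, there are no relations, and the single jump
  occurs at level 0.\<close>

lemma T_empty: "T {} {} s = (if s = 0 then 1 else 0)"
proof -
  have pts: "pts {} {} s = (if 0 \<le> s then {0} else {})" for s
    using newton_fun_zero by (auto simp: pts_def)
  have 1: "pm.dim {g :: 'n mpoly. keys g \<subseteq> {0}} = 1"
  proof -
    have "card {1 :: 'n mpoly} = pm.dim {g :: 'n mpoly. keys g \<subseteq> {0}}"
    proof (rule pm.basis_card_eq_dim)
      show "{g :: 'n mpoly. keys g \<subseteq> {0}} \<subseteq> pm.span {1}" using in_span_singles[of _ "{0}"] by auto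
      show "pm.independent {1 :: 'n mpoly}" by (simp add: pm.dependent_single)
    qed auto
    then show ?thesis by simp
  qed
  have 0: "pm.dim {g :: 'n mpoly. keys g \<subseteq> {}} = 0"
    using pm.basis_card_eq_dim[of "{}" "{g :: 'n mpoly. keys g \<subseteq> {}}"] by (auto simp: pm.independent_empty)
  have V: "int (pm.dim (V {} {} s)) = (if 0 \<le> s then 1 else 0)" for s
    using 0 1 by (simp add: V_def pts)
  have "B {} {} s = V {} {} (s - 1)" by (simp add: B_def)
  then have "T {} {} s = (if 0 \<le> s then 1 else 0) - (if 0 \<le> s - 1 then 1 else 0)"
    unfolding T_def by (simp only: V)
  then show ?thesis by auto
qed

end

lemma sum_over_subsets:
  fixes g :: "'n::finite set \<Rightarrow> int"
  shows "(\<Sum>I\<in>UNIV. g I) = g {} + (\<Sum>p=1..CARD('n) - 1. \<Sum>I\<in>{I. card I = p}. g I) + g UNIV"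
proof -
  have n: "0 < CARD('n)" by simp
  have "(\<Sum>I\<in>UNIV. g I) = (\<Sum>p\<in>{0..CARD('n)}. \<Sum>I\<in>{I \<in> UNIV. card I = p}. g I)"
    by (rule sum.group[symmetric]) (auto simp: card_mono)
  also have "{0..CARD('n)} = insert 0 (insert CARD('n) {1..CARD('n) - 1})" using n by auto
  also have "(\<Sum>p\<in>\<dots>. \<Sum>I\<in>{I \<in> UNIV. card I = p}. g I) =
      (\<Sum>I\<in>{I. card I = 0}. g I) + ((\<Sum>I\<in>{I. card I = CARD('n)}. g I) + (\<Sum>p=1..CARD('n) - 1. \<Sum>I\<in>{I. card I = p}. g I))"
  proof -
    have "0 \<notin> insert CARD('n) {1..CARD('n) - 1}" "CARD('n) \<notin> {1..CARD('n) - 1}" by (simp_all add: not_le)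
    then show ?thesis by (simp only: sum.insert finite.insertI finite_atLeastAtMost UNIV_I simp_thms)
  qed
  also have "{I :: 'n set. card I = 0} = {{}}" by auto
  also have "{I :: 'n set. card I = CARD('n)} = {UNIV}" by (auto dest: card_subset_eq[OF finite_class.finite_UNIV subset_UNIV])
  finally show ?thesis by simp
qed

theorem proposition4p4:
  fixes f :: "'n::finite mpoly"
  assumes "convenient f" and "nondegenerate f"
  shows "newton_spectrum f =
    (\<lambda>\<alpha>. toric_newton_spectrum UNIV f \<alpha>
        + (\<Sum>p=1..CARD('n) - 1. (-1) ^ p *
             (\<Sum>I\<in>{I :: 'n set. card I = p}. toric_newton_spectrum (UNIV - I) (set_zero I f) \<alpha>))
        + (if \<alpha> = 0 then (-1) ^ CARD('n) else 0))"
proof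
  fix \<alpha> :: rat
  interpret convenient_on UNIV f "newton_polytope f" by (rule convenient_on_UNIV[OF assms(1)])
  let ?P = "newton_polytope f"
  \<comment> \<open>Including \<alpha> among the numbers to be cleared makes \<alpha> itself a
    multiple of 1/D, so one integer s represents the coefficient in question.\<close>
  have "finite (insert \<alpha> ((\<lambda>(F, i). facet_vec UNIV ?P F i) ` (boundary_facets UNIV ?P \<times> UNIV)))"
    using finite_boundary_facets by simp
  then obtain D :: nat where D: "0 < D"
      "\<And>q. q \<in> insert \<alpha> ((\<lambda>(F, i). facet_vec UNIV ?P F i) ` (boundary_facets UNIV ?P \<times> UNIV)) \<Longrightarrow> of_nat D * q \<in> \<int>"
    using common_denominator by blast
  interpret newton_poly f D
  proof
    show "of_nat D * facet_vec UNIV ?P F i \<in> \<int>" if "F \<in> boundary_facets UNIV ?P" for F i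
      by (intro D(2) insertI2 image_eqI[of _ _ "(F, i)"]) (simp_all add: that)
  qed (use assms D(1) in auto)
  obtain s where "of_nat D * \<alpha> = of_int s" using D(2)[of \<alpha>] by (auto elim: Ints_cases)
  then have \<alpha>: "\<alpha> = of_int s / of_nat D" using D(1) by (simp add: field_simps)
  let ?g = "\<lambda>I. (-1) ^ card I * T {} (UNIV - I) s"
  have toric: "toric_newton_spectrum (UNIV - I) (set_zero I f) \<alpha> = T {} (UNIV - I) s" if "I \<noteq> UNIV" for I
  proof -
    have "UNIV - I \<noteq> {}" using that by auto
    then show ?thesis using toric_spectrum_eq[OF _ \<alpha>, of "UNIV - I"] by (simp add: Compl_eq_Diff_UNIV double_diff)
  qed
  have f0: "set_zero {} f = f" by (auto simp: set_zero_eq intro: part_id)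
  have "newton_spectrum f \<alpha> = (\<Sum>I\<in>UNIV. ?g I)"
    using newton_spectrum_eq[OF \<alpha>] T_expand[of UNIV UNIV s] by (simp only: subset_UNIV Pow_UNIV)
  also have "\<dots> = ?g {} + (\<Sum>p=1..CARD('n) - 1. \<Sum>I\<in>{I. card I = p}. ?g I) + ?g UNIV"
    by (rule sum_over_subsets)
  also have "?g {} = toric_newton_spectrum UNIV f \<alpha>"
    using toric[of "{}"] by (simp add: f0)
  also have "(\<Sum>p=1..CARD('n) - 1. \<Sum>I\<in>{I. card I = p}. ?g I) =
      (\<Sum>p=1..CARD('n) - 1. (-1) ^ p * (\<Sum>I\<in>{I :: 'n set. card I = p}. toric_newton_spectrum (UNIV - I) (set_zero I f) \<alpha>))"
  proof (rule sum.cong[OF refl])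
    fix p assume p: "p \<in> {1..CARD('n) - 1}"
    have "I \<noteq> UNIV" if "card I = p" for I :: "'n set"
    proof
      assume "I = UNIV"
      then have "p = CARD('n)" using that by simp
      moreover have "\<not> CARD('n) \<le> CARD('n) - 1" by (simp add: not_le)
      ultimately show False using p by auto
    qed
    then show "(\<Sum>I\<in>{I. card I = p}. ?g I) =
        (-1) ^ p * (\<Sum>I\<in>{I :: 'n set. card I = p}. toric_newton_spectrum (UNIV - I) (set_zero I f) \<alpha>)"
      unfolding sum_distrib_left by (intro sum.cong refl) (simp add: toric)
  qed
  \<comment> \<open>Removing all variables leaves the constants, which contribute only at exponent
    0.\<close>
  also have "?g UNIV = (if \<alpha> = 0 then (-1) ^ CARD('n) else 0)"
    using D(1) by (simp add: T_empty \<alpha>)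
  finally show "newton_spectrum f \<alpha> = toric_newton_spectrum UNIV f \<alpha>
        + (\<Sum>p=1..CARD('n) - 1. (-1) ^ p *
             (\<Sum>I\<in>{I :: 'n set. card I = p}. toric_newton_spectrum (UNIV - I) (set_zero I f) \<alpha>))
        + (if \<alpha> = 0 then (-1) ^ CARD('n) else 0)" .
qed

end
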